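(* Let $X$ be any countable set of indeterminates. The orbit problem over $\mathbb{Q}(X)$ is decidable; that is, the following problem is decidable: given $n \ge 1$, a matrix $A \in M_{n\times n}(\mathbb{Q}(X))$ and vectors $x, y \in \mathbb{Q}(X)^n$, determine whether there exists $i \in \mathbb{N}$ such that $A^i x = y$.
   Context: $\mathbb{N}$ includes $0$. $\mathbb{Q}(X)$ is the field of rational functions over $\mathbb{Q}$ in the (algebraically independent) indeterminates from $X$; each element involves only finitely many indeterminates. $M_{n\times n}(R)$ is the set of $n\times n$ matrices over a ring $R$. "Decidable" means that there is an algorithm (Turing machine) that halts on every input and answers correctly. Inputs are given exactly: the indeterminates are indexed by (an initial segment of) the natural numbers, and each element of $\mathbb{Q}(X)$ is encoded as a quotient of two polynomials with integer coefficients in finitely many indexed indeterminates. *)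

theory Defs
  imports
    "HOL-Library.Poly_Mapping"
    "HOL-Library.Nat_Bijection"
    "HOL-Computational_Algebra.Fraction_Field"
    "Jordan_Normal_Form.Matrix"
begin

section \<open>Turing machines\<close>

text \<open>
  Deterministic Turing machines with finitely many two-way infinite tapes.  States and tape symbols
  are natural numbers; symbol 0 is the blank.  Only the values of the transition function on the
  finitely many pairs of a state and a tuple of scanned symbols are constrained and ever used, so a
  well-formed machine is a finite object.
\<close>

datatype move = Move_Left | Stay | Move_Right

record turing_machine =
  tm_tapes :: nat
  tm_states :: "nat set"
  tm_symbols :: "nat set"
  tm_start :: nat
  tm_accept :: nat
  tm_reject :: nat
  tm_trans :: "nat \<Rightarrow> nat list \<Rightarrow> nat \<times> (nat \<times> move) list"

definition wf_tm :: "turing_machine \<Rightarrow> bool" where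
  "wf_tm M \<longleftrightarrow>
     tm_tapes M \<ge> 1 \<and>
     finite (tm_states M) \<and> finite (tm_symbols M) \<and> {0, 1} \<subseteq> tm_symbols M \<and>
     {tm_start M, tm_accept M, tm_reject M} \<subseteq> tm_states M \<and> tm_accept M \<noteq> tm_reject M \<and>
     (\<forall>q \<in> tm_states M. \<forall>s. length s = tm_tapes M \<and> set s \<subseteq> tm_symbols M \<longrightarrow>
        fst (tm_trans M q s) \<in> tm_states M \<and>
        length (snd (tm_trans M q s)) = tm_tapes M \<and>
        fst ` set (snd (tm_trans M q s)) \<subseteq> tm_symbols M)"

text \<open>A tape consists of the head position and the contents of the cells.\<close>

type_synonym tape = "int \<times> (int \<Rightarrow> nat)"
type_synonym tm_config = "nat \<times> tape list"

fun tape_read :: "tape \<Rightarrow> nat" where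
  "tape_read (h, c) = c h"

fun move_offset :: "move \<Rightarrow> int" where
  "move_offset Move_Left = -1"
| "move_offset Stay = 0"
| "move_offset Move_Right = 1"

fun tape_act :: "nat \<times> move \<Rightarrow> tape \<Rightarrow> tape" where
  "tape_act (a, d) (h, c) = (h + move_offset d, c(h := a))"

definition tm_step :: "turing_machine \<Rightarrow> tm_config \<Rightarrow> tm_config" where
  "tm_step M = (\<lambda>(q, ts).
     if q = tm_accept M \<or> q = tm_reject M then (q, ts)
     else (case tm_trans M q (map tape_read ts) of (q', as) \<Rightarrow> (q', map2 tape_act as ts)))"

text \<open>
  The input \<open>N\<close> is written in unary on the first tape.  The choice of unary rather than binary
  notation has no influence on decidability.
\<close>

definition tm_init :: "turing_machine \<Rightarrow> nat \<Rightarrow> tm_config" where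
  "tm_init M N =
     (tm_start M,
      (0, \<lambda>j. if 0 \<le> j \<and> j < int N then 1 else 0) # replicate (tm_tapes M - 1) (0, \<lambda>_. 0))"

definition tm_accepts :: "turing_machine \<Rightarrow> nat \<Rightarrow> bool" where
  "tm_accepts M N \<longleftrightarrow> (\<exists>t. fst ((tm_step M ^^ t) (tm_init M N)) = tm_accept M)"

definition tm_rejects :: "turing_machine \<Rightarrow> nat \<Rightarrow> bool" where
  "tm_rejects M N \<longleftrightarrow> (\<exists>t. fst ((tm_step M ^^ t) (tm_init M N)) = tm_reject M)"

definition decidable :: "nat set \<Rightarrow> bool" where
  "decidable S \<longleftrightarrow>
     (\<exists>M. wf_tm M \<and> (\<forall>N. (N \<in> S \<longrightarrow> tm_accepts M N) \<and> (N \<notin> S \<longrightarrow> tm_rejects M N)))"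


section \<open>Rational functions\<close>

text \<open>
  A monomial maps the index of an indeterminate to its exponent.  The type \<open>ratfun\<close> is the field of
  rational functions over the rationals in indeterminates indexed by all natural numbers, and
  \<open>ratfuns X\<close> is its subfield generated by the indeterminates with index in \<open>X\<close>.
\<close>

type_synonym mpoly = "(nat \<Rightarrow>\<^sub>0 nat) \<Rightarrow>\<^sub>0 rat"
type_synonym ratfun = "mpoly fract"

definition vars :: "mpoly \<Rightarrow> nat set" where
  "vars p = (\<Union>m \<in> Poly_Mapping.keys p. Poly_Mapping.keys m)"

definition ratfuns :: "nat set \<Rightarrow> ratfun set" where
  "ratfuns X = {Fraction_Field.Fract p q | p q. q \<noteq> 0 \<and> vars p \<subseteq> X \<and> vars q \<subseteq> X}"


section \<open>Encoding of instances\<close>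

text \<open>
  A monomial is given by a list of pairs (index, exponent), and a polynomial with integer
  coefficients by a list of pairs (coefficient, monomial).  No normal form is required: repeated
  indices and repeated monomials are allowed, and a fraction need not be in lowest terms.
\<close>

type_synonym monom_code = "(nat \<times> nat) list"
type_synonym poly_code = "(int \<times> monom_code) list"
type_synonym ratfun_code = "poly_code \<times> poly_code"
type_synonym vec_code = "ratfun_code list"
type_synonym mat_code = "ratfun_code list list"

definition monom_val :: "monom_code \<Rightarrow> (nat \<Rightarrow>\<^sub>0 nat)" where
  "monom_val m = (\<Sum>(v, e) \<leftarrow> m. Poly_Mapping.single v e)"

definition poly_val :: "poly_code \<Rightarrow> mpoly" where
  "poly_val p = (\<Sum>(a, m) \<leftarrow> p. Poly_Mapping.single (monom_val m) (of_int a))"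

definition poly_code_vars :: "poly_code \<Rightarrow> nat set" where
  "poly_code_vars p = (\<Union>(a, m) \<in> set p. fst ` set m)"

fun encodes_ratfun :: "nat set \<Rightarrow> ratfun_code \<Rightarrow> ratfun \<Rightarrow> bool" where
  "encodes_ratfun X (p, q) f \<longleftrightarrow>
     poly_code_vars p \<subseteq> X \<and> poly_code_vars q \<subseteq> X \<and>
     poly_val q \<noteq> 0 \<and> f = Fraction_Field.Fract (poly_val p) (poly_val q)"

definition encodes_vec :: "nat set \<Rightarrow> vec_code \<Rightarrow> ratfun vec \<Rightarrow> bool" where
  "encodes_vec X xs x \<longleftrightarrow> list_all2 (encodes_ratfun X) xs (list_of_vec x)"

text \<open>A matrix is given by the list of its rows.\<close>

definition encodes_mat :: "nat set \<Rightarrow> mat_code \<Rightarrow> ratfun mat \<Rightarrow> bool" where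
  "encodes_mat X rs A \<longleftrightarrow> list_all2 (encodes_vec X) rs (rows A)"

definition monom_encode :: "monom_code \<Rightarrow> nat" where
  "monom_encode m = list_encode (map prod_encode m)"

definition poly_encode :: "poly_code \<Rightarrow> nat" where
  "poly_encode p = list_encode (map (\<lambda>(a, m). prod_encode (int_encode a, monom_encode m)) p)"

fun ratfun_encode :: "ratfun_code \<Rightarrow> nat" where
  "ratfun_encode (p, q) = prod_encode (poly_encode p, poly_encode q)"

definition vec_encode :: "vec_code \<Rightarrow> nat" where
  "vec_encode xs = list_encode (map ratfun_encode xs)"

definition mat_encode :: "mat_code \<Rightarrow> nat" where
  "mat_encode rs = list_encode (map vec_encode rs)"

text \<open>\<open>N\<close> is a code of the instance \<open>(n, A, x, y)\<close> over \<open>ratfuns X\<close>.\<close>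

definition encodes_instance ::
    "nat set \<Rightarrow> nat \<Rightarrow> nat \<Rightarrow> ratfun mat \<Rightarrow> ratfun vec \<Rightarrow> ratfun vec \<Rightarrow> bool" where
  "encodes_instance X N n A x y \<longleftrightarrow>
     (\<exists>rs xs ys. encodes_mat X rs A \<and> encodes_vec X xs x \<and> encodes_vec X ys y \<and>
        N = prod_encode (n, prod_encode (mat_encode rs, prod_encode (vec_encode xs, vec_encode ys))))"


section \<open>Adequacy of the encoding\<close>

text \<open>The elements of \<open>ratfuns X\<close> are exactly those that have a code.\<close>

lemma keys_sum_list:
  "Poly_Mapping.keys (sum_list ps) \<subseteq> (\<Union>p \<in> set ps. Poly_Mapping.keys p)"
  by (induction ps) (auto dest: keys_add[THEN subsetD])

lemma poly_mapping_sum_singles: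
  "(\<Sum>k\<in>Poly_Mapping.keys p. Poly_Mapping.single k (Poly_Mapping.lookup p k)) = p"
proof (rule poly_mapping_eqI)
  fix k
  show "Poly_Mapping.lookup
      (\<Sum>k\<in>Poly_Mapping.keys p. Poly_Mapping.single k (Poly_Mapping.lookup p k)) k =
      Poly_Mapping.lookup p k"
    by (simp add: lookup_sum lookup_single when_def in_keys_iff)
qed

lemma keys_monom_val: "Poly_Mapping.keys (monom_val m) \<subseteq> fst ` set m"
  unfolding monom_val_def
  by (rule order_trans[OF keys_sum_list]) (auto simp: image_image case_prod_unfold split: if_splits)

lemma vars_poly_val: "vars (poly_val p) \<subseteq> poly_code_vars p"
proof -
  have "Poly_Mapping.keys (poly_val p) \<subseteq> monom_val ` snd ` set p"
    unfolding poly_val_def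
    by (rule order_trans[OF keys_sum_list]) (auto simp: image_image case_prod_unfold split: if_splits)
  then show ?thesis
    unfolding vars_def poly_code_vars_def
  proof (intro subsetI, elim UN_E)
    fix v k assume "Poly_Mapping.keys (poly_val p) \<subseteq> monom_val ` snd ` set p"
      and "k \<in> Poly_Mapping.keys (poly_val p)" and v: "v \<in> Poly_Mapping.keys k"
    then obtain a m where am: "(a, m) \<in> set p" "k = monom_val m" by force
    then have "v \<in> fst ` set m" using keys_monom_val v by blast
    with am(1) show "v \<in> (\<Union>(a, m) \<in> set p. fst ` set m)" by blast
  qed
qed

lemma monom_val_surj: "\<exists>c. fst ` set c = Poly_Mapping.keys m \<and> monom_val c = m"
proof -
  obtain ks where ks: "set ks = Poly_Mapping.keys m" "distinct ks"
    using finite_distinct_list[OF finite_keys[of m]] by auto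
  let ?c = "map (\<lambda>v. (v, Poly_Mapping.lookup m v)) ks"
  have "monom_val ?c = (\<Sum>v\<in>Poly_Mapping.keys m. Poly_Mapping.single v (Poly_Mapping.lookup m v))"
    unfolding monom_val_def using ks by (simp add: comp_def sum_list_distinct_conv_sum_set)
  also have "\<dots> = m" by (rule poly_mapping_sum_singles)
  finally show ?thesis using ks by (intro exI[of _ ?c]) force
qed

lemma poly_val_scale:
  "poly_val (map (\<lambda>(a, m). (d * a, m)) p) = of_int d * poly_val p"
proof (induction p)
  case Nil
  show ?case by (simp add: poly_val_def)
next
  case (Cons t p)
  obtain a m where t: "t = (a, m)" by (cases t)
  have "Poly_Mapping.single (monom_val m) (of_int (d * a)) =
      (of_int d :: mpoly) * Poly_Mapping.single (monom_val m) (of_int a)"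
    by (simp add: mult_single flip: single_of_int)
  then show ?case
    using Cons by (simp add: poly_val_def t distrib_left)
qed

lemma poly_code_vars_scale: "poly_code_vars (map (\<lambda>(a, m). (d * a, m)) p) = poly_code_vars p"
  by (simp add: poly_code_vars_def case_prod_unfold)

lemma poly_val_surj:
  assumes "vars p \<subseteq> X"
  shows "\<exists>(d :: int) c. d \<noteq> 0 \<and> poly_code_vars c \<subseteq> X \<and>
           poly_val c = of_int d * p"
proof -
  have "\<exists>(d :: int) c. d \<noteq> 0 \<and> poly_code_vars c \<subseteq> X \<and>
          poly_val c = of_int d *
            (\<Sum>m\<in>K. Poly_Mapping.single m (Poly_Mapping.lookup p m))"
    if "finite K" "K \<subseteq> Poly_Mapping.keys p" for K
    using that
  proof (induction K)
    case empty
    show ?case by (intro exI[of _ 1] exI[of _ "[]"]) (simp add: poly_code_vars_def poly_val_def)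
  next
    case (insert m K)
    then obtain d c where c: "d \<noteq> 0" "poly_code_vars c \<subseteq> X"
      "poly_val c = of_int d *
         (\<Sum>m\<in>K. Poly_Mapping.single m (Poly_Mapping.lookup p m))" by auto
    obtain a b where ab: "Poly_Mapping.lookup p m = of_int a / of_int b" "b \<noteq> 0"
      by (metis prod.exhaust quotient_of_div quotient_of_denom_pos less_irrefl)
    obtain u where u: "fst ` set u = Poly_Mapping.keys m" "monom_val u = m"
      using monom_val_surj by blast
    let ?c = "(d * a, u) # map (\<lambda>(a, m). (b * a, m)) c"
    have "poly_code_vars ?c \<subseteq> X"
      using c(2) u(1) insert.prems assms poly_code_vars_scale[of b c]
      by (auto simp: poly_code_vars_def vars_def)
    moreover have "poly_val ?c = of_int (d * b) *
        (\<Sum>m\<in>insert m K. Poly_Mapping.single m (Poly_Mapping.lookup p m))"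
    proof -
      have "poly_val ?c = Poly_Mapping.single m (of_int (d * a)) +
              poly_val (map (\<lambda>(a, m). (b * a, m)) c)"
        using u by (simp add: poly_val_def)
      also have "Poly_Mapping.single m (of_int (d * a)) =
          of_int (d * b) * Poly_Mapping.single m (Poly_Mapping.lookup p m)"
        using ab by (simp add: mult_single single_of_int[symmetric] del: single_of_int of_int_mult) (simp add: mult.assoc)
      also have "poly_val (map (\<lambda>(a, m). (b * a, m)) c) = of_int (d * b) *
          (\<Sum>m\<in>K. Poly_Mapping.single m (Poly_Mapping.lookup p m))"
        unfolding poly_val_scale c(3) by (simp add: ac_simps)
      finally show ?thesis
        using insert.hyps by (simp add: distrib_left)
    qed
    ultimately show ?case
      using c(1) ab(2) by (intro exI[of _ "d * b"] exI[of _ ?c]) simp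
  qed
  from this[of "Poly_Mapping.keys p"] show ?thesis
    by (simp add: poly_mapping_sum_singles)
qed

lemma ratfuns_eq_encodable: "ratfuns X = {f. \<exists>c. encodes_ratfun X c f}"
proof (intro subset_antisym subsetI)
  fix f assume "f \<in> {f. \<exists>c. encodes_ratfun X c f}"
  then obtain p q where "encodes_ratfun X (p, q) f" by auto
  then show "f \<in> ratfuns X"
    unfolding ratfuns_def mem_Collect_eq using vars_poly_val[of p] vars_poly_val[of q]
    by (intro exI[of _ "poly_val p"] exI[of _ "poly_val q"]) auto
next
  fix f assume "f \<in> ratfuns X"
  then obtain p q where f: "f = Fraction_Field.Fract p q" "q \<noteq> 0" "vars p \<subseteq> X" "vars q \<subseteq> X"
    unfolding ratfuns_def by auto
  obtain d c where c: "d \<noteq> 0" "poly_code_vars c \<subseteq> X"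
      "poly_val c = of_int d * p"
    using poly_val_surj[OF f(3)] by auto
  obtain d' c' where c': "d' \<noteq> 0" "poly_code_vars c' \<subseteq> X"
      "poly_val c' = of_int d' * q"
    using poly_val_surj[OF f(4)] by auto
  let ?p = "map (\<lambda>(a, m). (d' * a, m)) c" and ?q = "map (\<lambda>(a, m). (d * a, m)) c'"
  let ?e = "of_int (d * d') :: mpoly"
  have e: "?e \<noteq> 0" using c(1) c'(1) by simp
  have p: "poly_val ?p = ?e * p" and q: "poly_val ?q = ?e * q"
    unfolding poly_val_scale c(3) c'(3) by (simp_all add: ac_simps)
  have "Fraction_Field.Fract (?e * p) (?e * q) = f"
    using e f by (simp add: eq_fract)
  then have "encodes_ratfun X (?p, ?q) f"
    using p q e f(2) c(2) c'(2) by (simp add: poly_code_vars_scale)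
  then show "f \<in> {f. \<exists>c. encodes_ratfun X c f}" by blast
qed

end

theory Submission
  imports
    Defs
    "HOL-Library.Countable"
    "HOL-Computational_Algebra.Field_as_Ring"
    "HOL-Computational_Algebra.Fundamental_Theorem_Algebra"
    "Jordan_Normal_Form.Char_Poly"
begin

text \<open>
  It suffices to bound the exponent \<open>i\<close> computably in terms of the input: the finitely many equations
  \<open>A\<^sup>i x = y\<close> that remain are polynomial identities, tested at sufficiently many integer points.

  Over the rationals, let \<open>\<chi>\<close> be the characteristic polynomial of \<open>A\<close>.  If \<open>A\<^sup>i x = y\<close>, then
  \<open>y = q(A) x\<close> for a polynomial \<open>q\<close> of degree less than \<open>n\<close> with coefficients of bounded height, and
  \<open>m = gcd(\<chi>, t\<^sup>i - q)\<close> annihilates \<open>x\<close>.  Every root \<open>\<lambda>\<close> of \<open>m\<close> satisfies \<open>\<lambda>\<^sup>i = q(\<lambda>)\<close>, so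
  there is a constant \<open>c\<close> such that all \<open>c \<lambda>\<^sup>k\<close> with \<open>k \<le> i\<close> are algebraic integers of degree at most
  \<open>n\<close> all of whose conjugates are bounded.  There are few of those, so if \<open>i\<close> is large then two powers
  of \<open>\<lambda>\<close> coincide and \<open>\<lambda>\<close> is zero or a root of unity, whose order is bounded in terms of \<open>n\<close> alone by
  the same argument.  If such a root \<open>\<lambda> \<noteq> 0\<close> is multiple, differentiation gives
  \<open>i \<lambda>\<^sup>i\<^sup>-\<^sup>1 = q'(\<lambda>)\<close>, which bounds \<open>i\<close>.  Otherwise \<open>m\<close> divides \<open>t\<^sup>n (t\<^sup>p - 1)\<close> with \<open>p\<close>
  depending only on \<open>n\<close>, and \<open>A\<^sup>n\<^sup>+\<^sup>p x = A\<^sup>n x\<close>.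

  Over the rational functions, either \<open>A\<^sup>n\<^sup>+\<^sup>p x = A\<^sup>n x\<close>, and some \<open>i < n + p\<close> works, or this equation
  fails at some integer point of bounded size where no denominator vanishes, and the rational case at
  that point bounds \<open>i\<close>.
\<close>

section \<open>Turing machines for while programs\<close>

text \<open>The obstacle is that \<open>i\<close> occurs only as an exponent: eigenvalues of modulus
  1 escape every estimate by size, and if the orbit is eventually periodic, infinitely many
  \<open>i\<close> may solve the equation. The way out is that \<open>y\<close> is given. The system
  expressing \<open>A^i x\<close> through \<open>x, ..., A^(n-1) x\<close> has a right-hand side of
  known height, so it has a solution \<open>q\<close> of height independent of \<open>i\<close>,
  although the remainder of \<open>t^i\<close> modulo the characteristic polynomial may grow. This
  bounds the numbers \<open>c z^k\<close> for all \<open>k <= i\<close> at once and makes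
  Kronecker's theorem on algebraic integers effective. The gcd is needed because other roots of the
  characteristic polynomial need not satisfy \<open>z^i = q(z)\<close>. That \<open>p\<close>
  depends on \<open>n\<close> alone matters for specialisation: \<open>A^(n+p) x = A^n x\<close> is
  one equation, fixed before an evaluation point is chosen, and its degree limits the search for a
  good point. All bounds are closed formulas in the number coding the input, since a program must
  compute them; because polynomials are only evaluated at integer points, that program handles
  nothing but integers.\<close>

datatype com = Lft nat | Wr nat | Dec nat | Seq com com | While nat com

instance com :: countable by countable_datatype

text \<open>\<open>Lft\<close> and \<open>Wr\<close> have no rules of their own. A machine step
  writes before it moves, whereas an increment must move left first and write then; between its two
  halves the tape does not represent a number.\<close>

inductive exec :: "com \<Rightarrow> (nat \<Rightarrow> nat) \<Rightarrow> (nat \<Rightarrow> nat) \<Rightarrow> bool" where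
  Inc: "exec (Seq (Lft r) (Wr r)) s (s(r := Suc (s r)))"
| Dec: "exec (Dec r) s (s(r := s r - 1))"
| Seq: "exec c s t \<Longrightarrow> exec d t u \<Longrightarrow> exec (Seq c d) s u"
| While_False: "s r = 0 \<Longrightarrow> exec (While r c) s s"
| While_True: "s r \<noteq> 0 \<Longrightarrow> exec c s t \<Longrightarrow> exec (While r c) t u \<Longrightarrow> exec (While r c) s u"

abbreviation "Inc r \<equiv> Seq (Lft r) (Wr r)"

fun regs :: "com \<Rightarrow> nat" where
  "regs (Lft r) = Suc r"
| "regs (Wr r) = Suc r"
| "regs (Dec r) = Suc r"
| "regs (Seq c d) = max (regs c) (regs d)"
| "regs (While r c) = max (Suc r) (regs c)"

text \<open>The states of the machine are the stacks of commands still to be executed.\<close>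

fun next_stack :: "(nat \<Rightarrow> nat) \<Rightarrow> com list \<Rightarrow> com list" where
  "next_stack v [] = []"
| "next_stack v (Seq c d # K) = c # d # K"
| "next_stack v (While r c # K) = (if v r \<noteq> 0 then c # While r c # K else K)"
| "next_stack v (c # K) = K"

fun stack_act :: "com list \<Rightarrow> nat \<Rightarrow> nat \<Rightarrow> nat \<times> move" where
  "stack_act (Lft r # K) i a = (a, if i = r then Move_Left else Stay)"
| "stack_act (Wr r # K) i a = (if i = r then 1 else a, Stay)"
| "stack_act (Dec r # K) i a = (if i = r then (0, Move_Right) else (a, Stay))"
| "stack_act K i a = (a, Stay)"

text \<open>The stacks that can occur while \<open>c\<close> runs on top of a fixed rest
  \<open>K\<close>. A loop always returns to the same stack, so the set is finite although runs are
  unbounded; it supplies the finite set of states.\<close>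

fun stacks :: "com \<Rightarrow> com list \<Rightarrow> com list set" where
  "stacks (Seq c d) K = insert (Seq c d # K) (stacks c (d # K) \<union> stacks d K)"
| "stacks (While r c) K = insert (While r c # K) (stacks c (While r c # K))"
| "stacks c K = {c # K}"

lemma finite_stacks: "finite (stacks c K)"
  by (induction c arbitrary: K) auto

lemma start_in_stacks: "c # K \<in> stacks c K"
  by (cases c) auto

lemma next_in_stacks: "S \<in> stacks c K \<Longrightarrow> next_stack v S \<in> insert K (stacks c K)"
proof (induction c arbitrary: K S)
  case (Seq c d)
  then consider "S = Seq c d # K" | "S \<in> stacks c (d # K)" | "S \<in> stacks d K" by auto
  then show ?case
  proof cases
    case 1
    then show ?thesis using start_in_stacks[of c] by auto
  next
    case 2
    then show ?thesis using Seq.IH(1)[of S "d # K"] start_in_stacks[of d K] by auto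
  next
    case 3
    then show ?thesis using Seq.IH(2) by auto
  qed
next
  case (While r c)
  then consider "S = While r c # K" | "S \<in> stacks c (While r c # K)" by auto
  then show ?case
  proof cases
    case 1
    then show ?thesis using start_in_stacks[of c] by auto
  next
    case 2
    then show ?thesis using While.IH by auto
  qed
qed auto

text \<open>The offset keeps 0 and 1 free for the rejecting and the accepting state.\<close>

definition code :: "com list \<Rightarrow> nat" where
  "code S = to_nat S + 2"

text \<open>At the empty stack the symbol scanned on tape 0 becomes the next state: output 0 rejects
  and output 1 accepts.\<close>

definition machine :: "nat \<Rightarrow> com \<Rightarrow> turing_machine" where
  "machine m c = \<lparr>tm_tapes = m, tm_states = insert 0 (insert 1 (insert (code []) (code ` stacks c []))),
     tm_symbols = {0, 1}, tm_start = code [c], tm_accept = 1, tm_reject = 0,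
     tm_trans = \<lambda>q s.
       (if q < 2 then (q, map (\<lambda>a. (a, Stay)) s)
        else case from_nat (q - 2) of [] \<Rightarrow> (s ! 0, map (\<lambda>a. (a, Stay)) s)
          | S \<Rightarrow> (code (next_stack ((!) s) S), map2 (stack_act S) [0..<length s] s))\<rparr>"

lemma machine_sel [simp]:
  "tm_tapes (machine m c) = m" "tm_start (machine m c) = code [c]"
  "tm_symbols (machine m c) = {0, 1}"
  "tm_accept (machine m c) = 1" "tm_reject (machine m c) = 0"
  "tm_states (machine m c) = insert 0 (insert 1 (insert (code []) (code ` stacks c [])))"
  by (simp_all add: machine_def)

lemma trans_machine:
  "tm_trans (machine m c) (code S) s =
     (case S of [] \<Rightarrow> (s ! 0, map (\<lambda>a. (a, Stay)) s)
      | _ \<Rightarrow> (code (next_stack ((!) s) S), map2 (stack_act S) [0..<length s] s))"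
  by (simp add: machine_def code_def split: list.split)

lemma trans_machine_halt:
  "q < 2 \<Longrightarrow> tm_trans (machine m c) q s = (q, map (\<lambda>a. (a, Stay)) s)"
  by (simp add: machine_def)

lemma stack_act_symbols: "a \<in> {0, 1} \<Longrightarrow> fst (stack_act S i a) \<in> {0, 1}"
  by (cases "(S, i, a)" rule: stack_act.cases) auto

lemma wf_machine:
  assumes "m \<ge> 1"
  shows "wf_tm (machine m c)"
  unfolding wf_tm_def
proof (intro conjI ballI allI impI)
  fix q s
  assume q: "q \<in> tm_states (machine m c)"
    and s: "length s = tm_tapes (machine m c) \<and> set s \<subseteq> tm_symbols (machine m c)"
  from s have l: "length s = m" and sy: "\<And>i. i < m \<Longrightarrow> s ! i \<in> {0,1}"
    using nth_mem by fastforce+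
  have s0: "s ! 0 = 0 \<or> s ! 0 = 1" using sy[of 0] assms by auto
  have "\<exists>q' as. tm_trans (machine m c) q s = (q', as) \<and> q' \<in> tm_states (machine m c) \<and>
      length as = m \<and> fst ` set as \<subseteq> {0,1}"
  proof (cases "q < 2")
    case True
    have "fst ` set (map (\<lambda>a. (a, Stay)) s) \<subseteq> {0,1}" using s by auto
    then show ?thesis using q l trans_machine_halt[OF True, of m c s] by simp
  next
    case False
    then obtain S where S: "q = code S" "S = [] \<or> S \<in> stacks c []" using q by auto
    show ?thesis
    proof (cases "S = []")
      case True
      have "fst ` set (map (\<lambda>a. (a, Stay)) s) \<subseteq> {0,1}" using s by auto
      moreover have "tm_trans (machine m c) q s = (s ! 0, map (\<lambda>a. (a, Stay)) s)"
        using S True by (simp add: trans_machine)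
      ultimately show ?thesis using s0 l by auto
    next
      case False
      with S have "next_stack ((!) s) S \<in> insert [] (stacks c [])" using next_in_stacks by blast
      then have "code (next_stack ((!) s) S) \<in> tm_states (machine m c)" by auto
      moreover have "fst (stack_act S i a) \<in> {0,1}" if "(i, a) \<in> set (zip [0..<length s] s)" for i a
        using s stack_act_symbols[of a S i] set_zip_rightD[OF that] by auto
      then have "fst ` set (map2 (stack_act S) [0..<length s] s) \<subseteq> {0,1}"
        unfolding set_map image_image by (intro image_subsetI) (simp only: split_paired_all prod.case)
      moreover have "tm_trans (machine m c) q s =
          (code (next_stack ((!) s) S), map2 (stack_act S) [0..<length s] s)"
        using S False by (simp add: trans_machine split: list.split)
      ultimately show ?thesis using l by simp
    qed
  qed
  then obtain q' as where "tm_trans (machine m c) q s = (q', as)" "q' \<in> tm_states (machine m c)"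
    "length as = m" "fst ` set as \<subseteq> {0,1}" by blast
  then show "fst (tm_trans (machine m c) q s) \<in> tm_states (machine m c)"
    "length (snd (tm_trans (machine m c) q s)) = tm_tapes (machine m c)"
    "fst ` set (snd (tm_trans (machine m c) q s)) \<subseteq> tm_symbols (machine m c)"
    by (simp_all del: machine_sel(6))
qed (use assms start_in_stacks[of c "[]"] in \<open>auto simp: finite_stacks\<close>)

text \<open>A register with value \<open>v\<close> is a block of \<open>v\<close> ones starting at the head, wherever the head is.\<close>

definition tape_rep :: "nat \<Rightarrow> tape \<Rightarrow> bool" where
  "tape_rep v T \<longleftrightarrow> (\<forall>j. snd T j = (if fst T \<le> j \<and> j < fst T + int v then 1 else 0))"

definition store_rep :: "nat \<Rightarrow> (nat \<Rightarrow> nat) \<Rightarrow> tape list \<Rightarrow> bool" where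
  "store_rep m s ts \<longleftrightarrow> length ts = m \<and> (\<forall>i<m. tape_rep (s i) (ts ! i))"

lemma tape_read_rep: "tape_rep v T \<Longrightarrow> tape_read T = (if v = 0 then 0 else 1)"
  by (cases T) (auto simp: tape_rep_def)

lemma step_machine:
  assumes "length ts = m" "S \<noteq> []"
  shows "tm_step (machine m c) (code S, ts) =
    (code (next_stack (\<lambda>i. map tape_read ts ! i) S),
     map (\<lambda>i. tape_act (stack_act S i (tape_read (ts ! i))) (ts ! i)) [0..<m])"
proof -
  have "map2 tape_act (map2 (stack_act S) [0..<m] (map tape_read ts)) ts =
      map (\<lambda>i. tape_act (stack_act S i (tape_read (ts ! i))) (ts ! i)) [0..<m]"
    by (rule nth_equalityI) (use assms in simp_all)
  moreover have "tm_trans (machine m c) (code S) (map tape_read ts) =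
      (code (next_stack ((!) (map tape_read ts)) S), map2 (stack_act S) [0..<m] (map tape_read ts))"
    using assms by (cases S) (simp_all add: trans_machine)
  moreover have "code S \<noteq> 0" "code S \<noteq> 1" by (simp_all add: code_def)
  ultimately show ?thesis by (simp add: tm_step_def)
qed

lemma tape_act_Stay: "tape_act (tape_read T, Stay) T = T"
  by (cases T) auto

text \<open>At value 0 the head still moves, but an empty block has no position, so the result is
  truncated subtraction.\<close>

lemma tape_rep_Dec:
  "tape_rep v T \<Longrightarrow> tape_rep (v - 1) (tape_act (0, Move_Right) T)"
  by (cases T) (auto simp: tape_rep_def)

lemma tape_rep_Inc:
  assumes "tape_rep v T"
  shows "tape_rep (Suc v) (tape_act (1, Stay) (tape_act (tape_read T, Move_Left) T))"
  using assms by (cases T) (auto simp: tape_rep_def)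

lemma map_act_upd:
  assumes "length ts = m"
    and "\<And>i. i < m \<Longrightarrow> i \<noteq> r \<Longrightarrow> f i (tape_read (ts ! i)) = (tape_read (ts ! i), Stay)"
  shows "map (\<lambda>i. tape_act (f i (tape_read (ts ! i))) (ts ! i)) [0..<m] =
     ts[r := tape_act (f r (tape_read (ts ! r))) (ts ! r)]"
proof (rule nth_equalityI)
  fix i assume "i < length (map (\<lambda>i. tape_act (f i (tape_read (ts ! i))) (ts ! i)) [0..<m])"
  then show "map (\<lambda>i. tape_act (f i (tape_read (ts ! i))) (ts ! i)) [0..<m] ! i =
     ts[r := tape_act (f r (tape_read (ts ! r))) (ts ! r)] ! i"
    using assms by (cases "i = r") (simp_all add: tape_act_Stay)
qed (use assms in simp)

lemma step_Act:
  assumes "length ts = m" "c \<in> {Lft r, Wr r, Dec r}"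
  shows "tm_step (machine m p) (code (c # K), ts) =
    (code K, ts[r := tape_act (stack_act [c] r (tape_read (ts ! r))) (ts ! r)])"
proof -
  have "stack_act (c # K) i a = stack_act [c] i a" for i a using assms(2) by auto
  moreover have "map (\<lambda>i. tape_act (stack_act [c] i (tape_read (ts ! i))) (ts ! i)) [0..<m] =
     ts[r := tape_act (stack_act [c] r (tape_read (ts ! r))) (ts ! r)]"
    by (rule map_act_upd[OF assms(1)]) (use assms in auto)
  ultimately show ?thesis
    using assms by (auto simp: step_machine)
qed

lemma step_control:
  assumes "length ts = m"
  shows "tm_step (machine m p) (code (Seq c d # K), ts) = (code (c # d # K), ts)"
    and "r < m \<Longrightarrow> tm_step (machine m p) (code (While r c # K), ts) =
      (code (if tape_read (ts ! r) \<noteq> 0 then c # While r c # K else K), ts)"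
proof -
  have "map ((!) ts) [0..<m] = ts" using assms map_nth by blast
  then show "tm_step (machine m p) (code (Seq c d # K), ts) = (code (c # d # K), ts)"
    "r < m \<Longrightarrow> tm_step (machine m p) (code (While r c # K), ts) =
      (code (if tape_read (ts ! r) \<noteq> 0 then c # While r c # K else K), ts)"
    using assms by (simp_all add: step_machine tape_act_Stay)
qed

text \<open>The stack \<open>K\<close> stays arbitrary because the parts of a sequence and the
  bodies of loops run on top of commands that are still pending.\<close>

lemma exec_machine:
  assumes "exec c s s'" "regs c \<le> m" "store_rep m s ts"
  shows "\<exists>t ts'. (tm_step (machine m p) ^^ t) (code (c # K), ts) = (code K, ts') \<and> store_rep m s' ts'"
  using assms
proof (induction arbitrary: K ts)
  case (Inc r s)
  let ?T = "ts ! r" and ?M = "tm_step (machine m p)"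
  let ?T1 = "tape_act (tape_read ?T, Move_Left) ?T"
  let ?T2 = "tape_act (1, Stay) ?T1"
  from Inc have r: "r < m" and l: "length ts = m" and rep: "tape_rep (s r) ?T"
    by (auto simp: store_rep_def)
  have "(?M ^^ 3) (code (Inc r # K), ts) = (code K, ts[r := ?T2])"
    using l r by (simp add: numeral_3_eq_3 step_control step_Act)
  moreover have "store_rep m (s(r := Suc (s r))) (ts[r := ?T2])"
    using Inc.prems tape_rep_Inc[OF rep] by (auto simp: store_rep_def nth_list_update)
  ultimately show ?case by blast
next
  case (Dec r s)
  let ?T = "ts ! r" and ?M = "tm_step (machine m p)"
  let ?T1 = "tape_act (0, Move_Right) ?T"
  from Dec have r: "r < m" and l: "length ts = m" and rep: "tape_rep (s r) ?T"
    by (auto simp: store_rep_def)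
  have "(?M ^^ 1) (code (Dec r # K), ts) = (code K, ts[r := ?T1])"
    using l r by (simp add: step_Act)
  moreover have "store_rep m (s(r := s r - 1)) (ts[r := ?T1])"
    using Dec.prems tape_rep_Dec[OF rep] by (auto simp: store_rep_def nth_list_update)
  ultimately show ?case by blast
next
  case (Seq c s t d u)
  let ?M = "tm_step (machine m p)"
  from Seq obtain a ts1 where 1: "(?M ^^ a) (code (c # d # K), ts) = (code (d # K), ts1)"
    "store_rep m t ts1" by fastforce
  from Seq 1 obtain b ts2 where 2: "(?M ^^ b) (code (d # K), ts1) = (code K, ts2)"
    "store_rep m u ts2" by fastforce
  have "length ts = m" using Seq.prems by (simp add: store_rep_def)
  then have "(?M ^^ (b + (a + 1))) (code (Seq c d # K), ts) = (code K, ts2)"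
    unfolding funpow_add o_apply by (simp add: step_control 1 2)
  then show ?case using 2 by blast
next
  case (While_False s r c)
  from While_False.prems have "length ts = m" "r < m" "tape_rep (s r) (ts ! r)"
    unfolding store_rep_def by auto
  with While_False.hyps have "(tm_step (machine m p) ^^ 1) (code (While r c # K), ts) = (code K, ts)"
    by (simp add: step_control tape_read_rep)
  then show ?case using While_False by blast
next
  case (While_True s r c t u)
  let ?M = "tm_step (machine m p)"
  from While_True obtain a ts1 where 1: "(?M ^^ a) (code (c # While r c # K), ts) = (code (While r c # K), ts1)"
    "store_rep m t ts1" by fastforce
  from While_True 1 obtain b ts2 where 2: "(?M ^^ b) (code (While r c # K), ts1) = (code K, ts2)"
    "store_rep m u ts2" by fastforce
  have l: "length ts = m" "r < m" "tape_rep (s r) (ts ! r)"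
    using While_True.prems by (auto simp: store_rep_def)
  then have "(?M ^^ (b + (a + 1))) (code (While r c # K), ts) = (code K, ts2)"
    unfolding funpow_add o_apply using While_True.hyps by (simp add: step_control 1 2 tape_read_rep)
  then show ?case using 2 by blast
qed

lemma decidable_by_exec:
  assumes "\<And>N. \<exists>s. exec c ((\<lambda>_. 0)(0 := N)) s \<and> s 0 = (if N \<in> S then 1 else 0)"
  shows "decidable S"
proof -
  define m where "m = regs c + 1"
  let ?M = "tm_step (machine m c)"
  have *: "\<exists>t. fst ((?M ^^ t) (tm_init (machine m c) N)) = (if N \<in> S then 1 else 0)" for N
  proof -
    obtain s where s: "exec c ((\<lambda>_. 0)(0 := N)) s" "s 0 = (if N \<in> S then 1 else 0)"
      using assms by blast
    define ts :: "tape list" where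
      "ts = (0, \<lambda>j. if 0 \<le> j \<and> j < int N then 1 else 0) # replicate (m - 1) (0, \<lambda>_. 0)"
    have init: "tm_init (machine m c) N = (code [c], ts)"
      by (simp add: tm_init_def ts_def)
    have "store_rep m ((\<lambda>_. 0)(0 := N)) ts"
      unfolding store_rep_def
    proof (intro conjI allI impI)
      fix i assume "i < m"
      then show "tape_rep (((\<lambda>_. 0)(0 := N)) i) (ts ! i)"
        by (cases i) (auto simp: ts_def tape_rep_def m_def)
    qed (simp add: ts_def m_def)
    then obtain t ts' where 1: "(?M ^^ t) (code [c], ts) = (code [], ts')" "store_rep m s ts'"
      using exec_machine[OF s(1), of m ts c "[]"] by (auto simp: m_def)
    have l: "length ts' = m" "m > 0" "tape_rep (s 0) (ts' ! 0)"
      using 1(2) by (auto simp: store_rep_def m_def)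
    then have "fst (?M (code [], ts')) = tape_read (ts' ! 0)"
      by (simp add: tm_step_def trans_machine) (simp add: code_def)
    also have "\<dots> = (if N \<in> S then 1 else 0)"
      using tape_read_rep[OF l(3)] s(2) by auto
    finally have "fst ((?M ^^ (Suc t)) (code [c], ts)) = (if N \<in> S then 1 else 0)"
      using 1 by simp
    then show ?thesis unfolding init by blast
  qed
  have "tm_accepts (machine m c) N" if "N \<in> S" for N
    using *[of N] that by (simp add: tm_accepts_def)
  moreover have "tm_rejects (machine m c) N" if "N \<notin> S" for N
    using *[of N] that by (simp add: tm_rejects_def)
  moreover have "wf_tm (machine m c)" by (rule wf_machine) (simp add: m_def)
  ultimately show ?thesis unfolding decidable_def by blast
qed

section \<open>Computable functions\<close>

definition zeros_from :: "nat \<Rightarrow> (nat \<Rightarrow> nat) \<Rightarrow> bool" where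
  "zeros_from k s \<longleftrightarrow> (\<forall>r\<ge>k. s r = 0)"

text \<open>The program leaves the value of \<open>E\<close> in register \<open>k\<close>; the registers above \<open>k\<close> are scratch space.\<close>

definition computes :: "nat \<Rightarrow> ((nat \<Rightarrow> nat) \<Rightarrow> nat) \<Rightarrow> bool" where
  "computes k E \<longleftrightarrow> (\<exists>p. \<forall>s. zeros_from k s \<longrightarrow> exec p s (s(k := E s)))"

lemma cexpI:
  assumes "\<And>s. zeros_from k s \<Longrightarrow> \<exists>t. exec p s t \<and> t = s(k := E s)"
  shows "computes k E"
  unfolding computes_def using assms by blast

lemma exec_Inc: "t = s(r := Suc (s r)) \<Longrightarrow> exec (Inc r) s t"
  by (simp add: exec.Inc)

lemma exec_Dec: "t = s(r := s r - 1) \<Longrightarrow> exec (Dec r) s t"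
  using exec.Dec by blast

lemma exec_While_0: "s r = 0 \<Longrightarrow> t = s \<Longrightarrow> exec (While r c) s t"
  by (simp add: exec.While_False)

lemma exec_clear: "exec (While r (Dec r)) s (s(r := 0))"
proof (induction "s r" arbitrary: s)
  case 0
  then have "s(r := 0) = s" by auto
  with 0 show ?case using While_False[of s r "Dec r"] by simp
next
  case (Suc n)
  let ?s = "s(r := s r - 1)"
  have "exec (While r (Dec r)) ?s (?s(r := 0))" using Suc(1)[of ?s] Suc(2) by simp
  then show ?case
    using While_True[of s r "Dec r" ?s "s(r := 0)"] Suc(2) exec.Dec[of r s] by simp
qed

lemma exec_move:
  assumes "a \<noteq> b"
  shows "exec (While a (Seq (Dec a) (Inc b))) s (s(a := 0, b := s b + s a))"
proof (induction "s a" arbitrary: s)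
  case 0
  then show ?case by (intro exec_While_0) auto
next
  case (Suc n)
  let ?s = "s(a := s a - 1, b := Suc (s b))"
  have w: "exec (While a (Seq (Dec a) (Inc b))) ?s (?s(a := 0, b := ?s b + ?s a))"
    using Suc(1)[of ?s] Suc(2) assms by simp
  have e: "?s(a := 0, b := ?s b + ?s a) = s(a := 0, b := s b + s a)"
    using assms Suc(2) by (auto simp: fun_eq_iff)
  have b: "exec (Seq (Dec a) (Inc b)) s ?s"
    by (rule exec.Seq, rule exec.Dec, rule exec_Inc) (use assms in auto)
  show ?case by (rule While_True[OF _ b w[unfolded e]]) (use Suc(2) in simp)
qed

lemma exec_copy:
  assumes "a \<noteq> b" "a \<noteq> c" "b \<noteq> c"
  shows "exec (While a (Seq (Dec a) (Seq (Inc b) (Inc c)))) s (s(a := 0, b := s b + s a, c := s c + s a))"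
proof (induction "s a" arbitrary: s)
  case 0
  then show ?case by (intro exec_While_0) auto
next
  case (Suc n)
  let ?s = "s(a := s a - 1, b := Suc (s b), c := Suc (s c))"
  let ?p = "Seq (Dec a) (Seq (Inc b) (Inc c))"
  have w: "exec (While a ?p) ?s (?s(a := 0, b := ?s b + ?s a, c := ?s c + ?s a))"
    using Suc(1)[of ?s] Suc(2) assms by simp
  have e: "?s(a := 0, b := ?s b + ?s a, c := ?s c + ?s a) = s(a := 0, b := s b + s a, c := s c + s a)"
    using assms Suc(2) by (auto simp: fun_eq_iff)
  have b: "exec ?p s ?s"
    by (rule exec.Seq, rule exec.Dec, rule exec.Seq, rule exec.Inc, rule exec_Inc)
      (use assms in \<open>auto simp: fun_eq_iff\<close>)
  show ?case by (rule While_True[OF _ b w[unfolded e]]) (use Suc(2) in simp)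
qed

section \<open>Expressions evaluated by while programs\<close>

lemma computes_0: "computes k (\<lambda>_. 0)"
proof (rule cexpI)
  fix s assume "zeros_from k s"
  then show "\<exists>t. exec (While k (Dec k)) s t \<and> t = s(k := 0)"
    using exec_clear by blast
qed

text \<open>Reading a register empties it. It is therefore copied twice, and the second copy is
  moved back.\<close>

lemma computes_var:
  assumes "i < k"
  shows "computes k (\<lambda>s. s i)"
proof (rule cexpI)
  fix s assume z: "zeros_from k s"
  let ?s = "s(i := 0, k := s i, Suc k := s i)"
  have 1: "exec (While i (Seq (Dec i) (Seq (Inc k) (Inc (Suc k))))) s ?s"
    using exec_copy[of i k "Suc k" s] assms z by (simp add: zeros_from_def)
  have 2: "exec (While (Suc k) (Seq (Dec (Suc k)) (Inc i))) ?s
      (?s(Suc k := 0, i := ?s i + ?s (Suc k)))"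
    by (rule exec_move) (use assms in auto)
  have 3: "?s(Suc k := 0, i := ?s i + ?s (Suc k)) = s(k := s i)"
    using assms z by (auto simp: fun_eq_iff zeros_from_def)
  show "\<exists>t. exec (Seq (While i (Seq (Dec i) (Seq (Inc k) (Inc (Suc k)))))
      (While (Suc k) (Seq (Dec (Suc k)) (Inc i)))) s t \<and> t = s(k := s i)"
    using exec.Seq[OF 1 2[unfolded 3]] by blast
qed

lemma computes_Suc:
  assumes "computes k E"
  shows "computes k (\<lambda>s. Suc (E s))"
proof -
  obtain p where p: "\<And>s. zeros_from k s \<Longrightarrow> exec p s (s(k := E s))"
    using assms unfolding computes_def by blast
  show ?thesis
  proof (rule cexpI)
    fix s assume "zeros_from k s"
    then show "\<exists>t. exec (Seq p (Inc k)) s t \<and> t = s(k := Suc (E s))"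
      using exec.Seq[OF p exec_Inc] by fastforce
  qed
qed

lemma computes_pred:
  assumes "computes k E"
  shows "computes k (\<lambda>s. E s - 1)"
proof -
  obtain p where p: "\<And>s. zeros_from k s \<Longrightarrow> exec p s (s(k := E s))"
    using assms unfolding computes_def by blast
  show ?thesis
  proof (rule cexpI)
    fix s assume "zeros_from k s"
    then show "\<exists>t. exec (Seq p (Dec k)) s t \<and> t = s(k := E s - 1)"
      using exec.Seq[OF p exec_Dec] by fastforce
  qed
qed

abbreviation shift_down :: "nat \<Rightarrow> com" where
  "shift_down k \<equiv> Seq (While k (Dec k)) (While (Suc k) (Seq (Dec (Suc k)) (Inc k)))"

lemma exec_shift_down: "exec (shift_down k) s (s(k := s (Suc k), Suc k := 0))"
proof -
  have "exec (While (Suc k) (Seq (Dec (Suc k)) (Inc k))) (s(k := 0)) (s(k := s (Suc k), Suc k := 0))"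
    using exec_move[of "Suc k" k "s(k := 0)"] by (simp add: fun_upd_twist)
  then show ?thesis using exec.Seq[OF exec_clear] by blast
qed

lemma exec_shift_down': "t = s(k := s (Suc k), Suc k := 0) \<Longrightarrow> exec (shift_down k) s t"
  using exec_shift_down by simp

lemma zeros_from_upd: "zeros_from k s \<Longrightarrow> k \<le> r \<Longrightarrow> r < l \<Longrightarrow> zeros_from l (s(r := x))"
  by (auto simp: zeros_from_def)

text \<open>Composition in place: \<open>F\<close> finds the value of \<open>E\<close> in register
  \<open>k\<close>, and \<open>shift_down\<close> then overwrites that value with the
  result.\<close>

lemma computes_let:
  assumes "computes k E" "computes (Suc k) F"
  shows "computes k (\<lambda>s. F (s(k := E s)))"
proof -
  obtain p where p: "\<And>s. zeros_from k s \<Longrightarrow> exec p s (s(k := E s))"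
    using assms unfolding computes_def by blast
  obtain q where q: "\<And>s. zeros_from (Suc k) s \<Longrightarrow> exec q s (s(Suc k := F s))"
    using assms unfolding computes_def by blast
  show ?thesis
  proof (rule cexpI)
    fix s assume z: "zeros_from k s"
    let ?s1 = "s(k := E s)" let ?s2 = "?s1(Suc k := F ?s1)"
    have 1: "exec p s ?s1" and 2: "exec q ?s1 ?s2" using z zeros_from_upd[OF z] by (auto intro!: p q)
    have "s(k := F ?s1) = ?s2(k := ?s2 (Suc k), Suc k := 0)"
      using z by (auto simp: fun_eq_iff zeros_from_def)
    from exec.Seq[OF 1 exec.Seq[OF 2 exec_shift_down'[OF this]]]
    show "\<exists>t. exec (Seq p (Seq q (shift_down k))) s t \<and> t = s(k := F (s(k := E s)))" by blast
  qed
qed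

text \<open>While the loop runs, register \<open>k\<close> holds the countdown and register
  \<open>k + 1\<close> the current value. Hence \<open>I\<close> and \<open>F\<close> must not
  depend on register \<open>k\<close>.\<close>

lemma computes_iter:
  assumes "computes k N" "computes (Suc k) I" "computes (Suc (Suc k)) F"
    and I: "\<And>s v. I (s(k := v)) = I s" and F: "\<And>s v. F (s(k := v)) = F s"
  shows "computes k (\<lambda>s. ((\<lambda>x. F (s(Suc k := x))) ^^ N s) (I s))"
proof -
  obtain p where p: "\<And>s. zeros_from k s \<Longrightarrow> exec p s (s(k := N s))"
    using assms unfolding computes_def by blast
  obtain q where q: "\<And>s. zeros_from (Suc k) s \<Longrightarrow> exec q s (s(Suc k := I s))"
    using assms unfolding computes_def by blast
  obtain r where r: "\<And>s. zeros_from (Suc (Suc k)) s \<Longrightarrow> exec r s (s(Suc (Suc k) := F s))"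
    using assms unfolding computes_def by blast
  let ?body = "Seq (Dec k) (Seq r (shift_down (Suc k)))"
  have loop: "exec (While k ?body) s (s(k := 0, Suc k := ((\<lambda>x. F (s(Suc k := x))) ^^ n) (s (Suc k))))"
    if "zeros_from (Suc (Suc k)) s" "s k = n" for s n
    using that
  proof (induction n arbitrary: s)
    case 0
    then show ?case by (intro exec_While_0) auto
  next
    case (Suc n)
    let ?s1 = "s(k := n)" let ?s2 = "?s1(Suc (Suc k) := F ?s1)"
    let ?s3 = "s(k := n, Suc k := F s)"
    have d: "exec (Dec k) s ?s1" using Suc.prems by (intro exec_Dec) simp
    have e: "exec r ?s1 ?s2" using Suc.prems by (intro r) (auto simp: zeros_from_def)
    have "?s3 = ?s2(Suc k := ?s2 (Suc (Suc k)), Suc (Suc k) := 0)"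
      using Suc.prems by (auto simp: fun_eq_iff zeros_from_def F)
    from exec.Seq[OF d exec.Seq[OF e exec_shift_down'[OF this]]] have 1: "exec ?body s ?s3" .
    have "?s3(Suc k := x) = (s(Suc k := x))(k := n)" for x by auto
    then have eq: "F (?s3(Suc k := x)) = F (s(Suc k := x))" for x using F by simp
    have "exec (While k ?body) ?s3 (?s3(k := 0, Suc k := ((\<lambda>x. F (?s3(Suc k := x))) ^^ n) (?s3 (Suc k))))"
      by (rule Suc.IH) (use Suc.prems in \<open>auto simp: zeros_from_def\<close>)
    then have w: "exec (While k ?body) ?s3 (s(k := 0, Suc k := ((\<lambda>x. F (s(Suc k := x))) ^^ n) (F s)))"
      unfolding eq by (simp add: fun_upd_twist)
    have e: "((\<lambda>x. F (s(Suc k := x))) ^^ Suc n) (s (Suc k)) = ((\<lambda>x. F (s(Suc k := x))) ^^ n) (F s)"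
      by (simp add: funpow_Suc_right del: funpow.simps)
    show ?case unfolding e by (rule While_True[OF _ 1 w]) (use Suc.prems in simp)
  qed
  show ?thesis
  proof (rule cexpI)
    fix s assume z: "zeros_from k s"
    let ?R = "((\<lambda>x. F (s(Suc k := x))) ^^ N s) (I s)"
    let ?s1 = "s(k := N s)" let ?s2 = "?s1(Suc k := I s)"
    have 1: "exec p s ?s1" using p z by blast
    have 2: "exec q ?s1 ?s2" using q[of ?s1] z by (auto simp: zeros_from_def I)
    have "?s2(Suc k := x) = (s(Suc k := x))(k := N s)" for x by auto
    then have eq: "F (?s2(Suc k := x)) = F (s(Suc k := x))" for x using F by simp
    let ?s3 = "s(k := 0, Suc k := ?R)"
    have 3: "exec (While k ?body) ?s2 ?s3"
      using loop[of ?s2 "N s"] z unfolding eq by (simp add: zeros_from_def fun_upd_twist)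
    have "s(k := ?R) = ?s3(k := ?s3 (Suc k), Suc k := 0)"
      using z by (auto simp: fun_eq_iff zeros_from_def)
    from exec.Seq[OF 1 exec.Seq[OF 2 exec.Seq[OF 3 exec_shift_down'[OF this]]]]
    show "\<exists>t. exec (Seq p (Seq q (Seq (While k ?body) (shift_down k)))) s t \<and> t = s(k := ?R)" by blast
  qed
qed

text \<open>Demanding a program for every argument position below every scratch boundary
  \<open>k\<close> lets programs be combined without renaming registers.\<close>

definition prog :: "(nat \<Rightarrow> nat) \<Rightarrow> bool" where
  "prog f \<longleftrightarrow> (\<forall>k i. i < k \<longrightarrow> computes k (\<lambda>s. f (s i)))"

definition prog2 :: "(nat \<Rightarrow> nat \<Rightarrow> nat) \<Rightarrow> bool" where
  "prog2 f \<longleftrightarrow> (\<forall>k i j. i < k \<longrightarrow> j < k \<longrightarrow> computes k (\<lambda>s. f (s i) (s j)))"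

text \<open>The value of \<open>E\<close> is parked in register \<open>k\<close> while
  \<open>F\<close> is evaluated, so \<open>F\<close> must ignore that register.\<close>

lemma computes_prog2:
  assumes "prog2 f" "computes k E" "computes (Suc k) F" "\<And>s v. F (s(k := v)) = F s"
  shows "computes k (\<lambda>s. f (E s) (F s))"
proof -
  have "computes (Suc (Suc k)) (\<lambda>s. f (s k) (s (Suc k)))"
    using assms(1) unfolding prog2_def by auto
  from computes_let[OF assms(3) this] have "computes (Suc k) (\<lambda>s. f (s k) (F s))" by simp
  from computes_let[OF assms(2) this] show ?thesis by (simp add: assms(4))
qed

lemma prog_comp2:
  assumes "prog2 h" "prog f" "prog g"
  shows "prog (\<lambda>x. h (f x) (g x))"
  unfolding prog_def
proof (intro allI impI)
  fix k i :: nat assume "i < k"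
  with assms(2,3) have "computes k (\<lambda>s. f (s i))" "computes (Suc k) (\<lambda>s. g (s i))"
    unfolding prog_def by auto
  from computes_prog2[OF assms(1) this] show "computes k (\<lambda>s. h (f (s i)) (g (s i)))"
    using \<open>i < k\<close> by simp
qed

lemma prog2_comp2:
  assumes "prog2 h" "prog2 f" "prog2 g"
  shows "prog2 (\<lambda>x y. h (f x y) (g x y))"
  unfolding prog2_def
proof (intro allI impI)
  fix k i j :: nat assume "i < k" "j < k"
  with assms(2,3) have "computes k (\<lambda>s. f (s i) (s j))" "computes (Suc k) (\<lambda>s. g (s i) (s j))"
    unfolding prog2_def by auto
  from computes_prog2[OF assms(1) this] show "computes k (\<lambda>s. h (f (s i) (s j)) (g (s i) (s j)))"
    using \<open>i < k\<close> \<open>j < k\<close> by simp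
qed

lemma prog2_fst: "prog f \<Longrightarrow> prog2 (\<lambda>x y. f x)" and prog2_snd: "prog f \<Longrightarrow> prog2 (\<lambda>x y. f y)"
  unfolding prog_def prog2_def by auto

lemma prog_diag: "prog2 f \<Longrightarrow> prog (\<lambda>x. f x x)"
  unfolding prog_def prog2_def by auto

lemma prog_id: "prog (\<lambda>x. x)"
  unfolding prog_def by (auto intro: computes_var)

lemma prog_comp:
  assumes "prog f" "prog g"
  shows "prog (\<lambda>x. f (g x))"
  using prog_comp2[OF prog2_fst[OF assms(1)] assms(2) prog_id] .

lemma prog_Suc: "prog f \<Longrightarrow> prog (\<lambda>x. Suc (f x))"
  unfolding prog_def by (auto intro: computes_Suc)

lemma prog_const: "prog (\<lambda>x. c)"
proof (induction c)
  case 0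
  then show ?case unfolding prog_def by (auto intro: computes_0)
qed (rule prog_Suc)

lemma prog_pred: "prog f \<Longrightarrow> prog (\<lambda>x. f x - 1)"
  unfolding prog_def using computes_pred by blast

lemma prog2_iter:
  assumes "prog2 n" "prog2 a" "prog2 f"
  shows "prog2 (\<lambda>x y. (f x ^^ n x y) (a x y))"
  unfolding prog2_def
proof (intro allI impI)
  fix k i j :: nat assume ij: "i < k" "j < k"
  with assms have "computes k (\<lambda>s. n (s i) (s j))" "computes (Suc k) (\<lambda>s. a (s i) (s j))"
    "computes (Suc (Suc k)) (\<lambda>s. f (s i) (s (Suc k)))"
    unfolding prog2_def by auto
  from computes_iter[OF this] show "computes k (\<lambda>s. (f (s i) ^^ n (s i) (s j)) (a (s i) (s j)))"
    using ij by simp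
qed

section \<open>Arithmetic by iteration\<close>

lemma prog2_add: "prog2 (+)"
proof -
  have "prog2 (\<lambda>x y. (Suc ^^ y) x)"
    by (intro prog2_iter prog2_snd prog2_fst prog_id prog_Suc)
  moreover have "(\<lambda>x y. (Suc ^^ y) x) = (+)" by (auto simp: fun_eq_iff)
  ultimately show ?thesis by metis
qed

lemma prog2_diff: "prog2 (-)"
proof -
  have "prog2 (\<lambda>x y. ((\<lambda>x. x - 1) ^^ y) x)"
    by (intro prog2_iter prog2_snd prog2_fst prog_id prog_pred)
  moreover have "((\<lambda>x. x - 1) ^^ y) x = x - y" for x y :: nat by (induction y) auto
  ultimately show ?thesis by simp
qed

lemma prog2_mult: "prog2 (*)"
proof -
  have "prog2 (\<lambda>x y. ((\<lambda>z. x + z) ^^ y) 0)"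
    by (intro prog2_iter prog2_add prog2_snd prog2_fst prog_id prog_const)
  moreover have "((\<lambda>z. x + z) ^^ y) 0 = x * y" for x y :: nat by (induction y) auto
  ultimately show ?thesis by (simp add: fun_eq_iff)
qed

named_theorems prog_intros

lemmas [prog_intros] = prog_id prog_const prog_Suc prog_comp2[OF prog2_add] prog_comp2[OF prog2_diff]
  prog_comp2[OF prog2_mult]

text \<open>An increasing unary function is inverted by counting upwards.\<close>

lemma iter_search:
  assumes "strict_mono g" "g (0::nat) = (0::nat)" "g w \<le> z" "z < g (Suc w)" "n \<ge> w"
  shows "((\<lambda>w. w + (1 - (g (Suc w) - z))) ^^ n) 0 = w"
proof -
  \<comment> \<open>With truncated subtraction the added term is 1 exactly when
    \<open>g (Suc w) <= z\<close>, so the counter climbs to the wanted value and then rests.\<close>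
  let ?h = "\<lambda>w. w + (1 - (g (Suc w) - z))"
  have 1: "(?h ^^ n) 0 = n" if "n \<le> w" for n
    using that
  proof (induction n)
    case (Suc n)
    then have "g (Suc n) \<le> g w" using assms(1) by (simp add: strict_mono_less_eq)
    then show ?case using Suc assms(3) by simp
  qed simp
  have 2: "(?h ^^ m) w = w" for m
  proof (induction m)
    case (Suc m)
    then show ?case using assms(4) by simp
  qed simp
  have "(?h ^^ (n - w + w)) 0 = (?h ^^ (n - w)) ((?h ^^ w) 0)"
    by (simp only: funpow_add o_apply)
  then show ?thesis by (simp only: le_add_diff_inverse2[OF assms(5)] 1[OF order_refl] 2)
qed

lemma prog_inverse:
  assumes g: "prog g" "strict_mono g" "g 0 = 0" and f: "\<And>z. g (f z) \<le> z \<and> z < g (Suc (f z))"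
  shows "prog f"
proof -
  have "prog2 (\<lambda>z w. w + (1 - (g (Suc w) - z)))"
    by (intro prog2_comp2[OF prog2_add] prog2_comp2[OF prog2_diff] prog2_snd prog2_fst prog_id prog_const
        prog_comp[OF g(1)] prog_Suc)
  from prog_diag[OF prog2_iter[OF prog2_fst[OF prog_id] prog2_fst[OF prog_const[of 0]] this]]
  have "prog (\<lambda>z. ((\<lambda>w. w + (1 - (g (Suc w) - z))) ^^ z) 0)" .
  moreover have "((\<lambda>w. w + (1 - (g (Suc w) - z))) ^^ z) 0 = f z" for z
  proof (rule iter_search[OF g(2,3)])
    \<comment> \<open>A strictly increasing \<open>g\<close> satisfies \<open>w <= g w\<close>, so
      \<open>z\<close> rounds are enough.\<close>
    have "f z \<le> g (f z)" using strict_mono_imp_increasing[OF g(2)] by blast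
    then show "f z \<le> z" using f[of z] by linarith
  qed (use f in auto)
  ultimately show ?thesis by simp
qed

lemma prog_half: "prog (\<lambda>x. x div 2)"
  by (rule prog_inverse[of "\<lambda>w. w + w"]) (auto intro!: prog_intros strict_monoI)

lemma prog_triangle: "prog triangle"
  unfolding triangle_def by (intro prog_comp[OF prog_half] prog_intros)

section \<open>Cantor pairing and recursion\<close>

abbreviation "pr x y \<equiv> prod_encode (x, y)"
definition pfst :: "nat \<Rightarrow> nat" where "pfst z = fst (prod_decode z)"
definition psnd :: "nat \<Rightarrow> nat" where "psnd z = snd (prod_decode z)"

lemma pfst_pr [simp]: "pfst (pr x y) = x" and psnd_pr [simp]: "psnd (pr x y) = y"
  by (simp_all add: pfst_def psnd_def)

lemma pr_pfst_psnd: "pr (pfst z) (psnd z) = z"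
  by (simp add: pfst_def psnd_def)

lemma prog_pr [prog_intros]: "prog f \<Longrightarrow> prog g \<Longrightarrow> prog (\<lambda>x. pr (f x) (g x))"
  by (simp add: prod_encode_def) (intro prog_intros prog_comp[OF prog_triangle])

lemma strict_mono_triangle: "strict_mono triangle"
  by (auto simp: strict_mono_Suc_iff)

text \<open>A pair lies at \<open>triangle (x + y) + x\<close> with \<open>x <= x + y\<close>, so
  \<open>x + y\<close> is an integer inverse of \<open>triangle\<close>. Both projections then
  follow by subtraction.\<close>

lemma prog_root: "prog (\<lambda>z. pfst z + psnd z)"
proof (rule prog_inverse[OF prog_triangle strict_mono_triangle])
  fix z
  have "z = triangle (pfst z + psnd z) + pfst z"
    using pr_pfst_psnd[of z] by (simp add: prod_encode_def)
  then show "triangle (pfst z + psnd z) \<le> z \<and> z < triangle (Suc (pfst z + psnd z))" by simp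
qed simp

lemma prog_pfst [prog_intros]: "prog f \<Longrightarrow> prog (\<lambda>x. pfst (f x))"
proof -
  assume "prog f"
  have "prog (\<lambda>z. z - triangle (pfst z + psnd z))"
    by (intro prog_intros prog_comp[OF prog_triangle] prog_root)
  moreover have "z - triangle (pfst z + psnd z) = pfst z" for z
    using pr_pfst_psnd[of z] by (simp add: prod_encode_def)
  ultimately show ?thesis using prog_comp[OF _ \<open>prog f\<close>] by simp
qed

lemma prog_psnd [prog_intros]: "prog f \<Longrightarrow> prog (\<lambda>x. psnd (f x))"
proof -
  assume "prog f"
  have "prog (\<lambda>z. (pfst z + psnd z) - pfst z)"
    by (intro prog_comp2[OF prog2_diff] prog_root prog_pfst prog_id)
  then show ?thesis using prog_comp[OF _ \<open>prog f\<close>] by simp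
qed

text \<open>Several arguments can now be packed into one number, so that later programs are treated
  as functions of one argument.\<close>

lemma PR2I: "prog (\<lambda>z. h (pfst z) (psnd z)) \<Longrightarrow> prog2 h"
  unfolding prog2_def
proof (intro allI impI)
  fix k i j :: nat assume h: "prog (\<lambda>z. h (pfst z) (psnd z))" and ij: "i < k" "j < k"
  have "prog2 (\<lambda>x y. triangle (x + y))"
    using prog2_comp2[OF prog2_fst[OF prog_triangle] prog2_add prog2_add] .
  then have "prog2 (\<lambda>x y. pr x y)"
    unfolding prod_encode_def prod.case by (intro prog2_comp2[OF prog2_add] prog2_fst prog_id)
  then have "computes k (\<lambda>s. pr (s i) (s j))" using ij unfolding prog2_def by blast
  moreover have "computes (Suc k) (\<lambda>s. h (pfst (s k)) (psnd (s k)))" using h unfolding prog_def by simp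
  ultimately show "computes k (\<lambda>s. h (s i) (s j))" using computes_let by fastforce
qed

lemma prog_iter:
  assumes "prog (\<lambda>z. f (pfst z) (psnd z))" "prog n" "prog a"
  shows "prog (\<lambda>x. (f x ^^ n x) (a x))"
  using prog_diag[OF prog2_iter[OF prog2_fst[OF assms(2)] prog2_fst[OF assms(3)] PR2I[OF assms(1)]]] .

lemma prog_rec:
  assumes f: "prog (\<lambda>z. f (pfst z) (pfst (psnd z)) (psnd (psnd z)))" and n: "prog n" and a: "prog a"
  shows "prog (\<lambda>x. rec_nat (a x) (f x) (n x))"
proof -
  \<comment> \<open>The iterated state pairs the round number with the value, since \<open>f\<close>
    refers to both.\<close>
  let ?F = "\<lambda>x z. pr (Suc (pfst z)) (f x (pfst z) (psnd z))"
  have "prog (\<lambda>x. psnd ((?F x ^^ n x) (pr 0 (a x))))"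
    by (intro prog_psnd prog_iter n prog_pr a prog_const prog_Suc f prog_pfst prog_id)
  moreover have "(?F x ^^ m) (pr 0 b) = pr m (rec_nat b (f x) m)" for x m b
    by (induction m) auto
  ultimately show ?thesis by simp
qed

lemma prog_power [prog_intros]:
  assumes "prog f" "prog g"
  shows "prog (\<lambda>x. f x ^ g x)"
proof -
  have "prog2 (\<lambda>b e. rec_nat 1 (\<lambda>_ y. b * y) e)"
    by (rule PR2I) (intro prog_rec prog_intros)
  moreover have "rec_nat 1 (\<lambda>_ y. b * y) e = b ^ e" for b e :: nat by (induction e) auto
  ultimately show ?thesis using prog_comp2[OF _ assms] by simp
qed

lemma prog_fact [prog_intros]:
  assumes "prog f"
  shows "prog (\<lambda>x. fact (f x))"
proof -
  have "prog (\<lambda>n. rec_nat 1 (\<lambda>j y. Suc j * y) n)" by (intro prog_rec prog_intros)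
  moreover have "rec_nat 1 (\<lambda>j y. Suc j * y) n = fact n" for n by (induction n) auto
  ultimately show ?thesis using prog_comp[OF _ assms] by simp
qed

section \<open>Truth values and bounded quantifiers\<close>

lemma prog_le [prog_intros]:
  assumes "prog f" "prog g"
  shows "prog (\<lambda>x. of_bool (f x \<le> g x))"
proof -
  have "prog (\<lambda>x. 1 - (f x - g x))" by (intro prog_intros assms)
  moreover have "1 - (f x - g x) = of_bool (f x \<le> g x)" for x by simp
  ultimately show ?thesis by simp
qed

lemma prog_less [prog_intros]: "prog f \<Longrightarrow> prog g \<Longrightarrow> prog (\<lambda>x. of_bool (f x < g x))"
  unfolding Suc_le_eq[symmetric] by (intro prog_intros)

lemma prog_conj [prog_intros]:
  assumes "prog (\<lambda>x. of_bool (P x))" "prog (\<lambda>x. of_bool (Q x))"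
  shows "prog (\<lambda>x. of_bool (P x \<and> Q x))"
  unfolding of_bool_conj by (intro prog_intros assms)

lemma prog_not [prog_intros]:
  assumes "prog (\<lambda>x. of_bool (P x))"
  shows "prog (\<lambda>x. of_bool (\<not> P x))"
proof -
  have "prog (\<lambda>x. 1 - of_bool (P x))" by (intro prog_intros assms)
  moreover have "(1 - of_bool (P x) :: nat) = of_bool (\<not> P x)" for x by simp
  ultimately show ?thesis by simp
qed

lemma prog_eq [prog_intros]: "prog f \<Longrightarrow> prog g \<Longrightarrow> prog (\<lambda>x. of_bool (f x = g x))"
  unfolding order_eq_iff[where 'a = nat] by (intro prog_intros)

lemma prog_if [prog_intros]:
  assumes "prog (\<lambda>x. of_bool (P x))" "prog f" "prog g"
  shows "prog (\<lambda>x. if P x then f x else g x)"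
proof -
  have "prog (\<lambda>x. of_bool (P x) * f x + (1 - of_bool (P x)) * g x)" by (intro prog_intros assms)
  moreover have "of_bool (P x) * f x + (1 - of_bool (P x)) * g x = (if P x then f x else g x)" for x
    by simp
  ultimately show ?thesis by simp
qed

lemma prog_ball [prog_intros]:
  assumes "prog (\<lambda>z. of_bool (P (pfst z) (psnd z)))" "prog n"
  shows "prog (\<lambda>x. of_bool (\<forall>j<n x. P x j))"
proof -
  have *: "prog (\<lambda>z. of_bool (P (f z) (g z)))" if "prog f" "prog g" for f g
    using prog_comp[OF assms(1) prog_pr[OF that]] by simp
  have "prog (\<lambda>x. rec_nat 1 (\<lambda>j y. y * of_bool (P x j)) (n x))"
    by (intro prog_rec prog_intros * assms)
  moreover have "rec_nat (1 :: nat) (\<lambda>j y. y * of_bool (P x j)) m = of_bool (\<forall>j<m. P x j)" for x m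
    by (induction m) (auto simp: less_Suc_eq)
  ultimately show ?thesis by simp
qed

lemma prog_bex [prog_intros]:
  assumes "prog (\<lambda>z. of_bool (P (pfst z) (psnd z)))" "prog n"
  shows "prog (\<lambda>x. of_bool (\<exists>j<n x. P x j))"
proof -
  have "prog (\<lambda>x. of_bool (\<not> (\<forall>j<n x. \<not> P x j)))"
    by (intro prog_intros assms)
  then show ?thesis by simp
qed

section \<open>Coded lists\<close>

lemma list_decode_rec: "list_decode l = (if l = 0 then [] else pfst (l - 1) # list_decode (psnd (l - 1)))"
  by (cases l) (simp_all add: pfst_def psnd_def split: prod.split)

lemma le_pr: "x \<le> pr x y" "y \<le> pr x y"
  by (rule le_prod_encode_1 le_prod_encode_2)+

lemma length_le_list_encode: "length xs \<le> list_encode xs"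
proof (induction xs)
  case (Cons x xs)
  then show ?case using le_pr(2)[of "list_encode xs" x] by simp
qed simp

lemma mem_le_list_encode: "x \<in> set xs \<Longrightarrow> x < list_encode xs"
proof (induction xs)
  case (Cons y xs)
  then show ?case using le_pr[of y "list_encode xs"] le_pr(2)[of "list_encode xs" y] by fastforce
qed simp

lemma prog_foldl:
  assumes f: "prog (\<lambda>z. f (pfst z) (pfst (psnd z)) (psnd (psnd z)))" and l: "prog l" and a: "prog a"
  shows "prog (\<lambda>x. foldl (f x) (a x) (list_decode (l x)))"
proof -
  let ?F = "\<lambda>x z. if psnd z = 0 then z else pr (f x (pfst z) (pfst (psnd z - 1))) (psnd (psnd z - 1))"
  have *: "prog (\<lambda>z. f (u z) (v z) (w z))" if "prog u" "prog v" "prog w" for u v w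
    using prog_comp[OF f prog_pr[OF that(1) prog_pr[OF that(2,3)]]] by simp
  \<comment> \<open>The code of a list is at least its length, so this many rounds exhaust the list;
    further rounds find the rest equal to 0 and change nothing.\<close>
  have "prog (\<lambda>x. pfst ((?F x ^^ l x) (pr (a x) (l x))))"
    by (intro prog_iter prog_intros * l a)
  moreover have "pfst ((?F x ^^ n) (pr b m)) = foldl (f x) b (list_decode m)"
    if "length (list_decode m) \<le> n" for x m n b
    using that
  proof (induction n arbitrary: b m)
    case 0
    then show ?case by simp
  next
    case (Suc n)
    show ?case
    proof (cases "m = 0")
      case True
      have "(?F x ^^ Suc n) (pr b 0) = pr b 0" by (induction n) auto
      then show ?thesis using True by simp
    next
      case False
      then have "list_decode m = pfst (m - 1) # list_decode (psnd (m - 1))"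
        by (subst list_decode_rec) simp
      then show ?thesis using Suc False by (simp add: funpow_Suc_right del: funpow.simps)
    qed
  qed
  moreover have "length (list_decode m) \<le> m" for m
    using length_le_list_encode[of "list_decode m"] by simp
  ultimately show ?thesis by simp
qed

lemma prog_ball_list [prog_intros]:
  assumes "prog (\<lambda>z. of_bool (P (pfst z) (psnd z)))" "prog l"
  shows "prog (\<lambda>x. of_bool (\<forall>e\<in>set (list_decode (l x)). P x e))"
proof -
  have *: "prog (\<lambda>z. of_bool (P (f z) (g z)))" if "prog f" "prog g" for f g
    using prog_comp[OF assms(1) prog_pr[OF that]] by simp
  have "prog (\<lambda>x. foldl (\<lambda>b e. b * of_bool (P x e)) 1 (list_decode (l x)))"
    by (intro prog_foldl prog_intros * assms)
  moreover have "foldl (\<lambda>b e. b * of_bool (P x e)) b es = b * of_bool (\<forall>e\<in>set es. P x e)"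
    for x es and b :: nat
    by (induction es arbitrary: b) auto
  ultimately show ?thesis by simp
qed

lemma prog_length [prog_intros]:
  assumes "prog l"
  shows "prog (\<lambda>x. length (list_decode (l x)))"
proof -
  have "prog (\<lambda>x. foldl (\<lambda>n _. Suc n) 0 (list_decode (l x)))"
    by (intro prog_foldl prog_intros assms)
  moreover have "foldl (\<lambda>n _. Suc n) n es = n + length es" for n and es :: "nat list"
    by (induction es arbitrary: n) auto
  ultimately show ?thesis by simp
qed

definition cnth :: "nat \<Rightarrow> nat \<Rightarrow> nat" where
  "cnth l i = pfst (((\<lambda>m. psnd (m - 1)) ^^ i) l - 1)"

lemma prog_cnth [prog_intros]: "prog l \<Longrightarrow> prog i \<Longrightarrow> prog (\<lambda>x. cnth (l x) (i x))"
  unfolding cnth_def by (intro prog_intros prog_iter)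

lemma cnth_list_encode [simp]: "i < length xs \<Longrightarrow> cnth (list_encode xs) i = xs ! i"
proof (induction xs arbitrary: i)
  case (Cons x xs)
  then show ?case by (cases i) (simp_all add: cnth_def funpow_Suc_right del: funpow.simps(2))
qed simp

definition tabulate :: "(nat \<Rightarrow> nat) \<Rightarrow> nat \<Rightarrow> nat" where
  "tabulate f n = list_encode (map f [0..<n])"

lemma prog_tabulate:
  assumes f: "prog (\<lambda>z. f (pfst z) (psnd z))" and n: "prog n"
  shows "prog (\<lambda>x. tabulate (f x) (n x))"
proof -
  have *: "prog (\<lambda>z. f (u z) (v z))" if "prog u" "prog v" for u v
    using prog_comp[OF f prog_pr[OF that]] by simp
  \<comment> \<open>In \<open>list_encode\<close>, \<open>Suc (pr a b)\<close> puts \<open>a\<close>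
    in front of the list coded by \<open>b\<close>, so the table grows from its last entry
    backwards.\<close>
  have "prog (\<lambda>x. rec_nat 0 (\<lambda>j y. Suc (pr (f x (n x - Suc j)) y)) (n x))"
    by (intro prog_rec prog_intros * prog_comp[OF n] n)
  moreover have "rec_nat 0 (\<lambda>j y. Suc (pr (f x (m - Suc j)) y)) k = list_encode (map (f x) [m - k..<m])"
    if "k \<le> m" for x k m
    using that
  proof (induction k)
    case (Suc k)
    then have "[m - Suc k..<m] = (m - Suc k) # [m - k..<m]"
      by (metis Suc_diff_Suc Suc_le_eq diff_less upt_conv_Cons zero_less_Suc less_le_trans)
    then show ?case using Suc by simp
  qed simp
  ultimately show ?thesis unfolding tabulate_def by simp
qed

lemma cnth_tabulate [simp]: "i < n \<Longrightarrow> cnth (tabulate f n) i = f i"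
  unfolding tabulate_def by (subst cnth_list_encode) simp_all

lemma decidable_prog:
  assumes "prog (\<lambda>N. of_bool (N \<in> S))"
  shows "decidable S"
proof -
  obtain p where p: "\<And>s. zeros_from 1 s \<Longrightarrow> exec p s (s(1 := of_bool (s 0 \<in> S)))"
  proof -
    have "computes 1 (\<lambda>s. of_bool (s 0 \<in> S))" using assms unfolding prog_def by simp
    then show ?thesis using that unfolding computes_def by blast
  qed
  show ?thesis
  proof (rule decidable_by_exec)
    fix N
    let ?s = "(\<lambda>_. 0)(0 := N) :: nat \<Rightarrow> nat"
    have "exec p ?s (?s(1 := of_bool (N \<in> S)))" using p[of ?s] by (simp add: zeros_from_def)
    then have "exec (Seq p (shift_down 0)) ?s ((?s(1 := of_bool (N \<in> S)))(0 := of_bool (N \<in> S), 1 := 0))"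
      using exec.Seq exec_shift_down[of 0 "?s(1 := of_bool (N \<in> S))"] by simp
    then show "\<exists>s. exec (Seq p (shift_down 0)) ((\<lambda>_. 0)(0 := N)) s \<and> s 0 = (if N \<in> S then 1 else 0)"
      by (intro exI[of _ "(?s(1 := of_bool (N \<in> S)))(0 := of_bool (N \<in> S), 1 := 0)"]) simp
  qed
qed

section \<open>Kronecker substitution\<close>

text \<open>For exponents below \<open>K\<close> these are the digits of a number in base
  \<open>K\<close>; for \<open>K = 1\<close> the value is the total degree.\<close>

definition wt :: "nat \<Rightarrow> (nat \<Rightarrow>\<^sub>0 nat) \<Rightarrow> nat" where
  "wt K m = (\<Sum>v\<in>Poly_Mapping.keys m. K ^ v * Poly_Mapping.lookup m v)"

lemma wt_superset:
  "finite A \<Longrightarrow> Poly_Mapping.keys m \<subseteq> A \<Longrightarrow> wt K m = (\<Sum>v\<in>A. K ^ v * Poly_Mapping.lookup m v)"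
  unfolding wt_def by (rule sum.mono_neutral_left) (auto simp: in_keys_iff)

lemma wt_add: "wt K (m + m') = wt K m + wt K m'"
proof -
  let ?A = "Poly_Mapping.keys m \<union> Poly_Mapping.keys m'"
  have "wt K (m + m') = (\<Sum>v\<in>?A. K ^ v * Poly_Mapping.lookup (m + m') v)"
    by (rule wt_superset) (auto dest: keys_add[THEN subsetD])
  then show ?thesis
    by (simp add: wt_superset[of ?A m] wt_superset[of ?A m'] lookup_add algebra_simps sum.distrib)
qed

lemma wt_single [simp]: "wt K (Poly_Mapping.single v e) = K ^ v * e"
  by (simp add: wt_superset[of "{v}"])

lemma wt_0 [simp]: "wt K 0 = 0"
  by (simp add: wt_def)

text \<open>Kronecker substitution: the indeterminate with index \<open>v\<close> becomes the power \<open>K ^ v\<close> of a single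
  indeterminate.\<close>

definition kron :: "nat \<Rightarrow> mpoly \<Rightarrow> rat poly" where
  "kron K p = (\<Sum>m\<in>Poly_Mapping.keys p. monom (Poly_Mapping.lookup p m) (wt K m))"

lemma kron_superset:
  "finite A \<Longrightarrow> Poly_Mapping.keys p \<subseteq> A \<Longrightarrow> kron K p = (\<Sum>m\<in>A. monom (Poly_Mapping.lookup p m) (wt K m))"
  unfolding kron_def by (rule sum.mono_neutral_left) (auto simp: in_keys_iff)

lemma kron_add: "kron K (p + q) = kron K p + kron K q"
proof -
  let ?A = "Poly_Mapping.keys p \<union> Poly_Mapping.keys q"
  have "kron K (p + q) = (\<Sum>v\<in>?A. monom (Poly_Mapping.lookup (p + q) v) (wt K v))"
    by (rule kron_superset) (auto dest: keys_add[THEN subsetD])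
  then show ?thesis
    by (simp add: kron_superset[of ?A p] kron_superset[of ?A q] lookup_add add_monom[symmetric] sum.distrib)
qed

lemma kron_single: "kron K (Poly_Mapping.single m c) = monom c (wt K m)"
  by (simp add: kron_superset[of "{m}"])

lemma kron_0 [simp]: "kron K 0 = 0"
  by (simp add: kron_def)

lemma kron_sum: "kron K (\<Sum>i\<in>A. f i) = (\<Sum>i\<in>A. kron K (f i))"
  by (induction A rule: infinite_finite_induct) (simp_all add: kron_add)

lemma kron_mult: "kron K (p * q) = kron K p * kron K q"
proof -
  let ?s = "\<lambda>p m. Poly_Mapping.single m (Poly_Mapping.lookup p m)"
  have "kron K (p * q) = kron K ((\<Sum>m\<in>Poly_Mapping.keys p. ?s p m) * (\<Sum>m\<in>Poly_Mapping.keys q. ?s q m))"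
    by (simp only: poly_mapping_sum_singles)
  also have "\<dots> = kron K p * kron K q"
    unfolding sum_product kron_sum mult_single kron_single wt_add
    by (simp add: kron_def sum_product mult_monom)
  finally show ?thesis .
qed

lemma kron_1 [simp]: "kron K 1 = 1"
  using kron_single[of K 0 1] by simp

interpretation kron: comm_ring_hom "kron K"
  by unfold_locales (simp_all add: kron_add kron_mult)

text \<open>Reduction modulo \<open>K\<close> reveals the lowest digit, and the quotient handles the
  others.\<close>

lemma digits_unique:
  fixes f g :: "nat \<Rightarrow> nat"
  assumes "\<And>v. v < r \<Longrightarrow> f v < K \<and> g v < K"
    and "(\<Sum>v<r. K ^ v * f v) = (\<Sum>v<r. K ^ v * g v)" "v < r"
  shows "f v = g v"
  using assms
proof (induction r arbitrary: f g v)
  case (Suc r)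
  have split: "(\<Sum>v<Suc r. K ^ v * h v) = h 0 + K * (\<Sum>v<r. K ^ v * h (Suc v))" for h :: "nat \<Rightarrow> nat"
    by (simp add: sum.lessThan_Suc_shift sum_distrib_left mult.assoc del: sum.lessThan_Suc)
  have eq: "f 0 + K * (\<Sum>v<r. K ^ v * f (Suc v)) = g 0 + K * (\<Sum>v<r. K ^ v * g (Suc v))"
    using Suc.prems(2) by (simp only: split)
  have lt: "f 0 < K" "g 0 < K" using Suc.prems(1) by auto
  have "f 0 = (f 0 + K * (\<Sum>v<r. K ^ v * f (Suc v))) mod K" using lt by simp
  also have "\<dots> = g 0" unfolding eq using lt by simp
  finally have 0: "f 0 = g 0" .
  with eq lt have "(\<Sum>v<r. K ^ v * f (Suc v)) = (\<Sum>v<r. K ^ v * g (Suc v))" by simp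
  from Suc.IH[OF _ this] Suc.prems(1) have "f (Suc v) = g (Suc v)" if "v < r" for v
    using that by simp
  with 0 Suc.prems(3) show ?case by (cases v) auto
qed simp

lemma digits_bound:
  fixes f :: "nat \<Rightarrow> nat"
  assumes "\<And>v. v < r \<Longrightarrow> f v < K"
  shows "(\<Sum>v<r. K ^ v * f v) < K ^ r"
  using assms
proof (induction r)
  case (Suc r)
  then have "(\<Sum>v<r. K ^ v * f v) < K ^ r" by simp
  moreover have "K ^ r * f r \<le> K ^ r * (K - 1)" using Suc.prems[of r] by (intro mult_left_mono) auto
  moreover have "K ^ r + K ^ r * (K - 1) = K ^ Suc r" using Suc.prems[of r] by (cases K) auto
  ultimately show ?case by (simp only: sum.lessThan_Suc)
qed simp

section \<open>Total degree and occurring indeterminates\<close>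

definition tdeg :: "(nat \<Rightarrow>\<^sub>0 nat) \<Rightarrow> nat" where
  "tdeg m = wt 1 m"

text \<open>Total degree adds up under multiplication and still bounds every single exponent, which
  is what base-\<open>K\<close> digits require.\<close>

definition degs_le :: "nat \<Rightarrow> mpoly \<Rightarrow> bool" where
  "degs_le d p \<longleftrightarrow> (\<forall>m\<in>Poly_Mapping.keys p. tdeg m \<le> d)"

lemma tdeg_lookup: "Poly_Mapping.lookup m v \<le> tdeg m"
proof (cases "v \<in> Poly_Mapping.keys m")
  case True
  then show ?thesis unfolding tdeg_def wt_def
    by (intro order_trans[OF _ member_le_sum[of v]]) auto
qed (simp add: in_keys_iff)

lemma degs_le_mono: "degs_le d p \<Longrightarrow> d \<le> e \<Longrightarrow> degs_le e p"
  by (force simp: degs_le_def)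

lemma degs_le_add: "degs_le d p \<Longrightarrow> degs_le d q \<Longrightarrow> degs_le d (p + q)"
  unfolding degs_le_def using keys_add[of p q] by blast

lemma degs_le_uminus: "degs_le d p \<Longrightarrow> degs_le d (- p)"
  unfolding degs_le_def by simp

lemma degs_le_diff: "degs_le d p \<Longrightarrow> degs_le d q \<Longrightarrow> degs_le d (p - q)"
  using degs_le_add[OF _ degs_le_uminus, of d p q] by simp

lemma degs_le_mult: "degs_le d p \<Longrightarrow> degs_le e q \<Longrightarrow> degs_le (d + e) (p * q)"
  unfolding degs_le_def
proof
  fix m assume d: "\<forall>m\<in>Poly_Mapping.keys p. tdeg m \<le> d" "\<forall>m\<in>Poly_Mapping.keys q. tdeg m \<le> e"
    and "m \<in> Poly_Mapping.keys (p * q)"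
  then obtain a b where "m = a + b" "a \<in> Poly_Mapping.keys p" "b \<in> Poly_Mapping.keys q"
    using keys_mult[of p q] by blast
  then show "tdeg m \<le> d + e" using d by (auto simp: tdeg_def wt_add intro: add_mono)
qed

lemma vars_add: "vars (p + q) \<subseteq> vars p \<union> vars q"
  unfolding vars_def using keys_add[of p q] by blast

lemma vars_diff: "vars (p - q) \<subseteq> vars p \<union> vars q"
  using vars_add[of p "- q"] by (simp add: vars_def)

lemma vars_mult: "vars (p * q) \<subseteq> vars p \<union> vars q"
  unfolding vars_def using keys_mult[of p q]
  by (fastforce dest: keys_add[THEN subsetD])

text \<open>Exponents below \<open>K\<close> are base-\<open>K\<close> digits, so distinct monomials
  receive distinct weights and nothing cancels: the substituted polynomial is nonzero of degree
  below \<open>K^r\<close>. It cannot vanish at \<open>K^r\<close> distinct integers.\<close>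

lemma kron_nonzero:
  assumes p: "p \<noteq> 0" "vars p \<subseteq> {..<r}" "degs_le d p" and K: "d < K"
  shows "\<exists>s < K ^ r. poly (kron K p) (of_nat s) \<noteq> 0"
proof -
  have keys: "Poly_Mapping.keys m \<subseteq> {..<r}" "Poly_Mapping.lookup m v < K"
    if "m \<in> Poly_Mapping.keys p" for m v
    using that p(2,3) K tdeg_lookup[of m v] by (auto simp: vars_def degs_le_def)
  have wt: "wt K m = (\<Sum>v<r. K ^ v * Poly_Mapping.lookup m v)" if "m \<in> Poly_Mapping.keys p" for m
    using keys(1)[OF that] by (intro wt_superset) auto
  have inj: "inj_on (wt K) (Poly_Mapping.keys p)"
  proof (rule inj_onI)
    fix m m' assume m: "m \<in> Poly_Mapping.keys p" "m' \<in> Poly_Mapping.keys p" "wt K m = wt K m'"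
    show "m = m'"
    proof (rule poly_mapping_eqI)
      fix v
      show "Poly_Mapping.lookup m v = Poly_Mapping.lookup m' v"
      proof (cases "v < r")
        case True
        have "(\<Sum>v<r. K ^ v * Poly_Mapping.lookup m v) = (\<Sum>v<r. K ^ v * Poly_Mapping.lookup m' v)"
          using m(3) wt[OF m(1)] wt[OF m(2)] by simp
        then show ?thesis
          by (rule digits_unique[rotated]) (use True m(1,2)[THEN keys(2)] in simp_all)
      next
        case False
        then have "v \<notin> Poly_Mapping.keys m" "v \<notin> Poly_Mapping.keys m'"
          using m(1,2)[THEN keys(1)] by auto
        then show ?thesis by (simp add: in_keys_iff)
      qed
    qed
  qed
  obtain m where m: "m \<in> Poly_Mapping.keys p" using p(1) by fastforce
  have "coeff (kron K p) (wt K m) =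
      (\<Sum>m'\<in>Poly_Mapping.keys p. if m' = m then Poly_Mapping.lookup p m' else 0)"
    unfolding kron_def coeff_sum coeff_monom using inj m by (intro sum.cong) (auto dest: inj_onD)
  also have "\<dots> = Poly_Mapping.lookup p m" using m by simp
  finally have nz: "kron K p \<noteq> 0" using m by (auto simp: in_keys_iff)
  have "degree (kron K p) \<le> K ^ r - 1"
    unfolding kron_def
  proof (intro degree_sum_le order_trans[OF degree_monom_le])
    fix m assume "m \<in> Poly_Mapping.keys p"
    then show "wt K m \<le> K ^ r - 1" using digits_bound[of r "Poly_Mapping.lookup m" K] keys(2) by (simp add: wt)
  qed simp
  moreover have "K ^ r > 0" using K by simp
  ultimately have deg: "degree (kron K p) < K ^ r" by linarith
  show ?thesis
  proof (rule ccontr)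
    assume "\<not> ?thesis"
    then have "of_nat ` {..<K ^ r} \<subseteq> {x. poly (kron K p) x = 0}" by auto
    then have "card (of_nat ` {..<K ^ r} :: rat set) \<le> card {x. poly (kron K p) x = 0}"
      using poly_roots_finite[OF nz] by (rule card_mono[rotated])
    also have "\<dots> \<le> degree (kron K p)" using nz by (rule card_poly_roots_bound)
    finally show False using deg by (simp add: card_image)
  qed
qed

section \<open>The annihilator of an orbit\<close>

text \<open>The linear functional sending \<open>t^j\<close> to \<open>u j\<close>. On the
  coordinates of an orbit it takes the place of evaluating \<open>p\<close> at the matrix.\<close>

definition lin :: "'a::comm_ring_1 poly \<Rightarrow> (nat \<Rightarrow> 'a) \<Rightarrow> 'a" where
  "lin p u = (\<Sum>j\<le>degree p. coeff p j * u j)"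

lemma lin_alt: "degree p \<le> M \<Longrightarrow> lin p u = (\<Sum>j\<le>M. coeff p j * u j)"
  unfolding lin_def by (rule sum.mono_neutral_left) (auto simp: coeff_eq_0)

lemma lin_0 [simp]: "lin 0 u = 0"
  by (simp add: lin_def)

lemma lin_add: "lin (p + q) u = lin p u + lin q u"
proof -
  let ?M = "max (degree p) (degree q)"
  have "lin (p + q) u = (\<Sum>j\<le>?M. coeff (p + q) j * u j)"
    by (rule lin_alt) (rule degree_add_le_max)
  then show ?thesis
    by (simp add: lin_alt[of p ?M] lin_alt[of q ?M] distrib_right sum.distrib)
qed

lemma lin_smult: "lin (Polynomial.smult c p) u = c * lin p u"
proof -
  have "lin (Polynomial.smult c p) u = (\<Sum>j\<le>degree p. coeff (Polynomial.smult c p) j * u j)"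
    by (rule lin_alt) (rule degree_smult_le)
  then show ?thesis by (simp add: lin_def sum_distrib_left mult.assoc)
qed

lemma lin_uminus: "lin (- p) u = - lin p u"
  using lin_smult[of "- 1" p u] by simp

lemma lin_diff: "lin (p - q) u = lin p u - lin q u"
  using lin_add[of p "- q" u] by (simp add: lin_uminus)

lemma lin_sum: "lin (\<Sum>i\<in>A. f i) u = (\<Sum>i\<in>A. lin (f i) u)"
  by (induction A rule: infinite_finite_induct) (simp_all add: lin_add)

lemma lin_monom [simp]: "lin (monom c k) u = c * u k"
  using lin_alt[of "monom c k" k u, OF degree_monom_le]
  by (simp add: if_distrib[of "\<lambda>x. x * _"] cong: if_cong)

lemma lin_1 [simp]: "lin 1 u = u 0"
  by (simp add: lin_def)

lemma lin_pCons: "lin (pCons a p) u = a * u 0 + lin p (\<lambda>j. u (Suc j))"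
proof -
  have "lin (pCons a p) u = (\<Sum>j\<le>Suc (degree p). coeff (pCons a p) j * u j)"
    by (rule lin_alt) (rule degree_pCons_le)
  then show ?thesis by (simp only: sum.atMost_Suc_shift) (simp add: lin_def)
qed

text \<open>Multiplication by \<open>t\<close> becomes the shift of the sequence, so a product acts
  as one factor on the shifted values of the other.\<close>

lemma lin_mult: "lin (p * q) u = lin p (\<lambda>j. lin q (\<lambda>i. u (i + j)))"
proof (induction p arbitrary: u)
  case (pCons a p)
  then show ?case by (simp add: lin_add lin_smult lin_pCons)
qed simp

lemma lin_sum_right: "lin p (\<lambda>j. \<Sum>i\<in>A. f i j) = (\<Sum>i\<in>A. lin p (f i))"
  unfolding lin_def sum_distrib_left by (rule sum.swap)

lemma lin_mult_right: "lin p (\<lambda>j. c * f j) = c * lin p f"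
  unfolding lin_def sum_distrib_left by (intro sum.cong) (simp_all add: mult_ac)

lemma lin_zero_right [simp]: "lin p (\<lambda>j. 0) = 0"
  by (simp add: lin_def)

text \<open>An orbit is given by its coordinates, without matrix powers, so that iterated fractions
  and their specialisations fit in directly.\<close>

definition orbit :: "nat \<Rightarrow> 'a::comm_ring_1 mat \<Rightarrow> (nat \<Rightarrow> nat \<Rightarrow> 'a) \<Rightarrow> bool" where
  "orbit n A v \<longleftrightarrow> A \<in> carrier_mat n n \<and> (\<forall>k. \<forall>r<n. v (Suc k) r = (\<Sum>c<n. A $$ (r, c) * v k c))"

text \<open>For an orbit this says \<open>p(A) v_0 = 0\<close>, as a linear recurrence for each
  coordinate, with no polynomial in a matrix to form.\<close>

definition annihilates :: "nat \<Rightarrow> 'a::comm_ring_1 poly \<Rightarrow> (nat \<Rightarrow> nat \<Rightarrow> 'a) \<Rightarrow> bool" where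
  "annihilates n p v \<longleftrightarrow> (\<forall>r<n. lin p (\<lambda>j. v j r) = 0)"

text \<open>\<open>p(A)\<close> commutes with \<open>A\<close>: applying a row of \<open>A\<close>
  to the recurrence at \<open>k\<close> gives the recurrence at \<open>k + 1\<close>.\<close>

lemma annihilates_shift:
  assumes "orbit n A v" "annihilates n p v" "r < n"
  shows "lin p (\<lambda>j. v (j + k) r) = 0"
  using assms(3)
proof (induction k arbitrary: r)
  case 0
  then show ?case using assms(2) by (simp add: annihilates_def)
next
  case (Suc k)
  have "lin p (\<lambda>j. v (j + Suc k) r) = lin p (\<lambda>j. \<Sum>c<n. A $$ (r, c) * v (j + k) c)"
    using assms(1) Suc.prems by (simp add: orbit_def)
  also have "\<dots> = 0" by (simp add: lin_sum_right lin_mult_right Suc.IH)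
  finally show ?case .
qed

text \<open>With \<open>annihilates_add\<close>, the annihilators of an orbit form an ideal; hence
  gcds of annihilators annihilate.\<close>

lemma annihilates_mult:
  assumes "orbit n A v" "annihilates n p v"
  shows "annihilates n (q * p) v"
  unfolding annihilates_def lin_mult using annihilates_shift[OF assms] by simp

lemma annihilates_add: "annihilates n p v \<Longrightarrow> annihilates n q v \<Longrightarrow> annihilates n (p + q) v"
  by (simp add: annihilates_def lin_add)

text \<open>Cayley--Hamilton, read off from the adjugate of the characteristic matrix.\<close>

lemma char_poly_annihilates:
  assumes "orbit n A v"
  shows "annihilates n (char_poly A) v"
  unfolding annihilates_def
proof (intro allI impI)
  fix r assume r: "r < n"
  have A: "A \<in> carrier_mat n n" using assms by (simp add: orbit_def)
  let ?M = "char_poly_matrix A" let ?B = "adj_mat ?M"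
  have M: "?M \<in> carrier_mat n n" using A by simp
  note B = adj_mat[OF M]
  \<comment> \<open>This is \<open>adj(tI - A) (tI - A) = chi I\<close>, read entry by
    entry.\<close>
  have entry: "(\<Sum>c<n. ?B $$ (r, c) * ?M $$ (c, s)) = (if r = s then char_poly A else 0)" if "s < n" for s
  proof -
    have "(?B * ?M) $$ (r, s) = (\<Sum>c<n. ?B $$ (r, c) * ?M $$ (c, s))"
      using B(1) M r that by (simp add: scalar_prod_def lessThan_atLeast0)
    moreover have "(?B * ?M) $$ (r, s) = (if r = s then char_poly A else 0)"
      unfolding B(3) using r that by (simp add: char_poly_def)
    ultimately show ?thesis by simp
  qed
  \<comment> \<open>Applied to the orbit, \<open>tI - A\<close> turns into
    \<open>v (j + 1) - A (v j)\<close>, which vanishes.\<close>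
  have M_lin: "(\<Sum>s<n. lin (?M $$ (c, s)) (\<lambda>i. v (i + j) s)) = 0" if c: "c < n" for c j
  proof -
    have "lin (?M $$ (c, s)) (\<lambda>i. v (i + j) s) =
        (if c = s then v (Suc j) s else 0) - A $$ (c, s) * v j s" if "s < n" for s
      using c that A by (simp add: char_poly_matrix_def lin_add lin_pCons)
    then have "(\<Sum>s<n. lin (?M $$ (c, s)) (\<lambda>i. v (i + j) s)) =
        (\<Sum>s<n. (if c = s then v (Suc j) s else 0) - A $$ (c, s) * v j s)" by simp
    also have "\<dots> = v (Suc j) c - (\<Sum>s<n. A $$ (c, s) * v j s)"
      using c by (simp add: sum_subtractf)
    also have "\<dots> = 0" using assms c by (simp add: orbit_def)
    finally show ?thesis .
  qed
  have "lin (char_poly A) (\<lambda>j. v j r) = (\<Sum>s<n. lin (if r = s then char_poly A else 0) (\<lambda>j. v j s))"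
    using r by (simp add: if_distrib[of "\<lambda>p. lin p _"] cong: if_cong)
  also have "\<dots> = (\<Sum>s<n. \<Sum>c<n. lin (?B $$ (r, c) * ?M $$ (c, s)) (\<lambda>j. v j s))"
    by (intro sum.cong refl) (simp add: entry[symmetric] lin_sum del: if_split)
  also have "\<dots> = (\<Sum>c<n. lin (?B $$ (r, c)) (\<lambda>j. \<Sum>s<n. lin (?M $$ (c, s)) (\<lambda>i. v (i + j) s)))"
    by (subst sum.swap) (simp add: lin_mult lin_sum_right)
  also have "\<dots> = 0" by (simp add: M_lin)
  finally show "lin (char_poly A) (\<lambda>j. v j r) = 0" .
qed

section \<open>Algebraic integers\<close>

text \<open>\<open>z\<close> is an eigenvalue of some integer matrix with the prescribed vector
  \<open>w\<close>. For fixed \<open>w\<close> such numbers are closed under sum and product,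
  through the sum and product of the matrices; this gives the ring of algebraic integers without
  resultants.\<close>

definition int_eigen :: "nat \<Rightarrow> (nat \<Rightarrow> complex) \<Rightarrow> complex \<Rightarrow> bool" where
  "int_eigen n w z \<longleftrightarrow> (\<exists>M :: nat \<Rightarrow> nat \<Rightarrow> int. \<forall>r<n. (\<Sum>c<n. of_int (M r c) * w c) = z * w r)"

lemma int_eigen_add:
  assumes "int_eigen n w x" "int_eigen n w y"
  shows "int_eigen n w (x + y)"
proof -
  from assms obtain M N where "\<forall>r<n. (\<Sum>c<n. of_int (M r c) * w c) = x * w r"
    "\<forall>r<n. (\<Sum>c<n. of_int (N r c) * w c) = y * w r" unfolding int_eigen_def by auto
  then show ?thesis unfolding int_eigen_def
    by (intro exI[of _ "\<lambda>r c. M r c + N r c"]) (simp add: sum.distrib distrib_right)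
qed

lemma int_eigen_mult:
  assumes "int_eigen n w x" "int_eigen n w y"
  shows "int_eigen n w (x * y)"
proof -
  from assms obtain M N where M: "\<forall>r<n. (\<Sum>c<n. of_int (M r c) * w c) = x * w r"
    and N: "\<forall>r<n. (\<Sum>c<n. of_int (N r c) * w c) = y * w r" unfolding int_eigen_def by auto
  have "(\<Sum>c<n. of_int (\<Sum>d<n. M r d * N d c) * w c) = x * y * w r" if "r < n" for r
  proof -
    have "(\<Sum>c<n. of_int (\<Sum>d<n. M r d * N d c) * w c) = (\<Sum>d<n. of_int (M r d) * (\<Sum>c<n. of_int (N d c) * w c))"
      unfolding of_int_sum sum_distrib_right sum_distrib_left
      by (subst sum.swap) (simp add: mult.assoc)
    also have "\<dots> = y * (\<Sum>d<n. of_int (M r d) * w d)"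
      using N by (simp add: sum_distrib_left mult_ac)
    finally show ?thesis using M that by simp
  qed
  then show ?thesis unfolding int_eigen_def by (intro exI[of _ "\<lambda>r c. \<Sum>d<n. M r d * N d c"]) simp
qed

lemma eigen_root:
  fixes A :: "complex mat"
  assumes "A \<in> carrier_mat n n" "\<And>r. r < n \<Longrightarrow> (\<Sum>c<n. A $$ (r, c) * w c) = z * w r"
    and "r < n" "w r \<noteq> 0"
  shows "poly (char_poly A) z = 0"
proof -
  have "eigenvector A (vec n w) z"
    unfolding eigenvector_def
  proof (intro conjI)
    show "vec n w \<noteq> 0\<^sub>v (dim_row A)"
      using assms(1,3,4) by (metis carrier_matD(1) index_vec index_zero_vec(1))
    show "A *\<^sub>v vec n w = z \<cdot>\<^sub>v vec n w"
    proof (rule eq_vecI)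
      fix i assume "i < dim_vec (z \<cdot>\<^sub>v vec n w)"
      then show "(A *\<^sub>v vec n w) $ i = (z \<cdot>\<^sub>v vec n w) $ i"
        using assms(1,2) by (auto simp: scalar_prod_def lessThan_atLeast0)
    qed (use assms(1) in simp)
  qed (use assms(1) in simp)
  then show ?thesis using eigenvalue_root_char_poly[OF assms(1)] unfolding eigenvalue_def by blast
qed

lemma root_eigen:
  fixes A :: "complex mat"
  assumes "A \<in> carrier_mat n n" "poly (char_poly A) z = 0"
  shows "\<exists>w. (\<forall>r<n. (\<Sum>c<n. A $$ (r, c) * w c) = z * w r) \<and> (\<exists>r<n. w r \<noteq> 0)"
proof -
  obtain x where x: "eigenvector A x z"
    using eigenvalue_root_char_poly[OF assms(1)] assms(2) unfolding eigenvalue_def by blast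
  then have d: "dim_vec x = n" "x \<noteq> 0\<^sub>v n" "A *\<^sub>v x = z \<cdot>\<^sub>v x"
    using assms(1) by (auto simp: eigenvector_def)
  have "(\<Sum>c<n. A $$ (r, c) * x $ c) = z * x $ r" if "r < n" for r
    using arg_cong[OF d(3), of "\<lambda>y. y $ r"] that d(1) assms(1)
    by (simp add: scalar_prod_def lessThan_atLeast0)
  moreover have "\<exists>r<n. x $ r \<noteq> 0"
  proof (rule ccontr)
    assume "\<not> ?thesis"
    then have "x = 0\<^sub>v n" using d(1) by (intro eq_vecI) auto
    then show False using d(2) by simp
  qed
  ultimately show ?thesis by blast
qed

text \<open>The characteristic polynomial of an integer matrix is monic with integer
  coefficients.\<close>

lemma int_eigen_algebraic_int:
  assumes "int_eigen n w z" "r < n" "w r \<noteq> 0"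
  shows "algebraic_int z"
proof -
  obtain M where M: "\<forall>r<n. (\<Sum>c<n. of_int (M r c) * w c) = z * w r"
    using assms unfolding int_eigen_def by auto
  define A :: "int mat" where "A = mat n n (\<lambda>(r, c). M r c)"
  have A: "A \<in> carrier_mat n n" by (simp add: A_def)
  have "poly (char_poly (map_mat of_int A :: complex mat)) z = 0"
    by (rule eigen_root[of _ n w z r]) (use M assms(2,3) in \<open>auto simp: A_def\<close>)
  moreover have "char_poly (map_mat of_int A :: complex mat) = map_poly of_int (char_poly A)"
    by (rule of_int_hom.char_poly_hom[OF A])
  ultimately show ?thesis
    using degree_monic_char_poly[OF A] by (auto simp: algebraic_int_altdef_ipoly)
qed

text \<open>The companion matrix of a monic integer polynomial has the eigenvector
  \<open>1, z, z^2, ...\<close>.\<close>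

lemma algebraic_int_int_eigen:
  assumes "algebraic_int z"
  shows "\<exists>n w. int_eigen n w z \<and> n > 0 \<and> w 0 = 1"
proof -
  from assms obtain p :: "int poly" where p: "poly (map_poly of_int p) z = 0" "lead_coeff p = 1"
    by (auto simp: algebraic_int_altdef_ipoly)
  let ?d = "degree p"
  have d: "?d > 0"
  proof (rule ccontr)
    assume "\<not> ?thesis"
    then obtain a where "p = [:a:]" by (auto elim: degree_eq_zeroE)
    then show False using p by simp
  qed
  have "(\<Sum>j\<le>?d. of_int (coeff p j) * z ^ j) = 0"
    using p(1) by (simp add: poly_altdef degree_map_poly coeff_map_poly)
  moreover have "{..?d} = insert ?d {..<?d}" by auto
  ultimately have top: "(\<Sum>j<?d. - of_int (coeff p j) * z ^ j) = z ^ ?d"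
    using p(2) by (simp add: sum_negf add_eq_0_iff)
  let ?M = "\<lambda>r c. if Suc r = ?d then - coeff p c else if c = Suc r then 1 else 0"
  have "(\<Sum>c<?d. of_int (?M r c) * z ^ c) = z * z ^ r" if "r < ?d" for r
  proof (cases "Suc r = ?d")
    case True
    then show ?thesis using top by (simp flip: power_Suc)
  next
    case False
    then have "(\<Sum>c<?d. of_int (?M r c) * z ^ c) = (\<Sum>c<?d. if c = Suc r then z ^ c else 0)"
      by (intro sum.cong) auto
    then show ?thesis using False that by simp
  qed
  then show ?thesis using d unfolding int_eigen_def
    by (intro exI[of _ ?d] exI[of _ "\<lambda>c. z ^ c"]) (auto intro!: exI[of _ ?M])
qed

text \<open>Two algebraic integers have a common integral eigenvector: the tensor product of theirs.\<close>

lemma algebraic_int_common_eigen: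
  assumes "algebraic_int x" "algebraic_int y"
  shows "\<exists>n w. int_eigen n w x \<and> int_eigen n w y \<and> n > 0 \<and> w 0 \<noteq> 0"
proof -
  obtain n w m u where w: "int_eigen n w x" "n > 0" "w 0 = 1" and u: "int_eigen m u y" "m > 0" "u 0 = 1"
    using assms[THEN algebraic_int_int_eigen] by blast
  obtain M N where M: "\<forall>r<n. (\<Sum>c<n. of_int (M r c) * w c) = x * w r"
    and N: "\<forall>r<m. (\<Sum>c<m. of_int (N r c) * u c) = y * u r" using w(1) u(1) unfolding int_eigen_def by auto
  \<comment> \<open>An index below \<open>n * m\<close> stands for the pair of its quotient and
    remainder by \<open>m\<close>; \<open>M\<close> acts on quotients and \<open>N\<close> on
    remainders.\<close>
  let ?t = "\<lambda>i. w (i div m) * u (i mod m)"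
  have bij: "(\<Sum>c<n * m. f (c div m) (c mod m)) = (\<Sum>a<n. \<Sum>b<m. f a b)" for f :: "nat \<Rightarrow> nat \<Rightarrow> complex"
  proof -
    have lt: "a * m + b < n * m" if "a < n" "b < m" for a b
    proof -
      have "a * m + b < Suc a * m" using that by simp
      also have "\<dots> \<le> n * m" using that by (intro mult_right_mono) auto
      finally show ?thesis .
    qed
    have "(\<Sum>c<n * m. f (c div m) (c mod m)) = (\<Sum>(a, b)\<in>{..<n} \<times> {..<m}. f a b)"
      by (rule sum.reindex_bij_witness[of _ "\<lambda>(a, b). a * m + b" "\<lambda>c. (c div m, c mod m)"])
        (use u(2) lt in \<open>auto simp: less_mult_imp_div_less\<close>)
    then show ?thesis by (simp add: sum.cartesian_product)
  qed
  have rm: "r div m < n" "r mod m < m" if "r < n * m" for r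
    using that u(2) by (auto simp: less_mult_imp_div_less)
  have 1: "(\<Sum>c<n * m. of_int (if c mod m = r mod m then M (r div m) (c div m) else 0) * ?t c) = x * ?t r"
    if r: "r < n * m" for r
  proof -
    have "(\<Sum>c<n * m. of_int (if c mod m = r mod m then M (r div m) (c div m) else 0) * ?t c) =
        (\<Sum>a<n. \<Sum>b<m. of_int (if b = r mod m then M (r div m) a else 0) * (w a * u b))"
      by (rule bij)
    also have "\<dots> = (\<Sum>a<n. \<Sum>b<m. if b = r mod m then of_int (M (r div m) a) * (w a * u b) else 0)"
      by (intro sum.cong) auto
    also have "\<dots> = (\<Sum>a<n. of_int (M (r div m) a) * w a) * u (r mod m)"
      using rm[OF r] by (simp add: sum_distrib_right mult.assoc)
    finally show ?thesis using M rm[OF r] by simp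
  qed
  have "int_eigen (n * m) ?t x" unfolding int_eigen_def
    by (intro exI[of _ "\<lambda>r c. if c mod m = r mod m then M (r div m) (c div m) else 0"] allI impI) (rule 1)
  moreover
  have 2: "(\<Sum>c<n * m. of_int (if c div m = r div m then N (r mod m) (c mod m) else 0) * ?t c) = y * ?t r"
    if r: "r < n * m" for r
  proof -
    have "(\<Sum>c<n * m. of_int (if c div m = r div m then N (r mod m) (c mod m) else 0) * ?t c) =
        (\<Sum>a<n. \<Sum>b<m. of_int (if a = r div m then N (r mod m) b else 0) * (w a * u b))"
      by (rule bij)
    also have "\<dots> = (\<Sum>a<n. if a = r div m then (\<Sum>b<m. of_int (N (r mod m) b) * (w a * u b)) else 0)"
      by (intro sum.cong) auto
    also have "\<dots> = w (r div m) * (\<Sum>b<m. of_int (N (r mod m) b) * u b)"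
      using rm[OF r] by (simp add: sum_distrib_left mult_ac)
    finally show ?thesis using N rm[OF r] by (simp add: mult_ac)
  qed
  have "int_eigen (n * m) ?t y" unfolding int_eigen_def
    by (intro exI[of _ "\<lambda>r c. if c div m = r div m then N (r mod m) (c mod m) else 0"] allI impI) (rule 2)
  ultimately show ?thesis using w(2,3) u(2,3) by (intro exI[of _ "n * m"] exI[of _ ?t]) simp
qed

lemma algebraic_int_add: "algebraic_int x \<Longrightarrow> algebraic_int y \<Longrightarrow> algebraic_int (x + y :: complex)"
  using algebraic_int_common_eigen int_eigen_add int_eigen_algebraic_int by meson

lemma algebraic_int_mult: "algebraic_int x \<Longrightarrow> algebraic_int y \<Longrightarrow> algebraic_int (x * y :: complex)"
  using algebraic_int_common_eigen int_eigen_mult int_eigen_algebraic_int by meson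

lemma algebraic_int_power: "algebraic_int x \<Longrightarrow> algebraic_int (x ^ k :: complex)"
  by (induction k) (auto intro: algebraic_int_mult)

lemma algebraic_int_of_int: "algebraic_int (of_int a :: complex)"
  by (simp add: int_imp_algebraic_int)

lemma algebraic_int_sum: "(\<And>i. i \<in> A \<Longrightarrow> algebraic_int (f i :: complex)) \<Longrightarrow> algebraic_int (\<Sum>i\<in>A. f i)"
  by (induction A rule: infinite_finite_induct) (auto intro: algebraic_int_add)

lemma algebraic_int_root_of_power:
  assumes "algebraic_int (z ^ k :: complex)" "k > 0"
  shows "algebraic_int z"
  by (rule algebraic_int_root[OF assms(1), of "monom 1 k"])
    (use assms(2) in \<open>auto simp: poly_monom degree_monom_eq\<close>)

text \<open>Up to sign these coefficients are elementary symmetric functions of the roots, built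
  here one linear factor at a time.\<close>

lemma algebraic_int_coeff_linear_factors:
  "(\<And>a. a \<in> set as \<Longrightarrow> algebraic_int (a :: complex)) \<Longrightarrow> algebraic_int (coeff (\<Prod>a\<leftarrow>as. [:- a, 1:]) j)"
proof (induction as arbitrary: j)
  case Nil
  then show ?case by (auto simp: coeff_1)
next
  case (Cons a as)
  have "algebraic_int (- a * coeff (\<Prod>a\<leftarrow>as. [:- a, 1:]) i)" for i
    using Cons by (intro algebraic_int_mult) auto
  then have "algebraic_int (- a * coeff (\<Prod>a\<leftarrow>as. [:- a, 1:]) j +
      (if j = 0 then 0 else coeff (\<Prod>a\<leftarrow>as. [:- a, 1:]) (j - 1)))"
    by (rule algebraic_int_add) (use Cons in simp)
  also have "- a * coeff (\<Prod>a\<leftarrow>as. [:- a, 1:]) j + (if j = 0 then 0 else coeff (\<Prod>a\<leftarrow>as. [:- a, 1:]) (j - 1)) =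
      coeff ([:- a, 1:] * (\<Prod>a\<leftarrow>as. [:- a, 1:])) j"
    by (cases j) (simp_all add: coeff_pCons)
  finally show ?case by simp
qed

text \<open>A further root of modulus at most \<open>R\<close> enlarges the coefficient bound at
  most by the factor \<open>1 + R\<close>.\<close>

lemma norm_coeff_linear_factors:
  "(\<And>a. a \<in> set as \<Longrightarrow> norm (a :: complex) \<le> R) \<Longrightarrow> R \<ge> 0 \<Longrightarrow>
    norm (coeff (\<Prod>a\<leftarrow>as. [:- a, 1:]) j) \<le> (1 + R) ^ length as"
proof (induction as arbitrary: j)
  case Nil
  then show ?case by (auto simp: coeff_1)
next
  case (Cons a as)
  let ?q = "\<Prod>a\<leftarrow>as. [:- a, 1:]"
  have IH: "norm (coeff ?q i) \<le> (1 + R) ^ length as" for i using Cons by simp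
  have c: "coeff ([:- a, 1:] * ?q) j = - a * coeff ?q j + (if j = 0 then 0 else coeff ?q (j - 1))"
    by (cases j) (simp_all add: coeff_pCons)
  have "norm (coeff ([:- a, 1:] * ?q) j) \<le> norm a * norm (coeff ?q j) + norm (if j = 0 then 0 else coeff ?q (j - 1))"
    unfolding c by (rule order_trans[OF norm_triangle_ineq]) (simp add: norm_mult)
  also have "\<dots> \<le> R * (1 + R) ^ length as + (1 + R) ^ length as"
    using Cons.prems IH by (intro add_mono mult_mono) auto
  finally show ?case by (simp add: algebra_simps)
qed

section \<open>Powers of conjugate algebraic integers\<close>

lemma pow_mat_commute: "A \<in> carrier_mat n n \<Longrightarrow> A * A ^\<^sub>m k = A ^\<^sub>m k * (A :: 'a::comm_ring_1 mat)"
proof (induction k)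
  case (Suc k)
  have P: "A ^\<^sub>m k \<in> carrier_mat n n" using Suc.prems by simp
  have "A * A ^\<^sub>m Suc k = (A * A ^\<^sub>m k) * A" using Suc.prems P by (simp add: assoc_mult_mat[of _ n n _ n _ n])
  then show ?case using Suc by simp
qed simp

lemma pow_mat_vec_Suc:
  assumes "A \<in> carrier_mat n n" "x \<in> carrier_vec n"
  shows "A ^\<^sub>m Suc k *\<^sub>v x = A *\<^sub>v (A ^\<^sub>m k *\<^sub>v (x :: 'a::comm_ring_1 vec))"
proof -
  have "A ^\<^sub>m Suc k *\<^sub>v x = (A * A ^\<^sub>m k) *\<^sub>v x" using pow_mat_commute[OF assms(1)] by simp
  also have "\<dots> = A *\<^sub>v (A ^\<^sub>m k *\<^sub>v x)"
    by (rule assoc_mult_mat_vec) (use assms in auto)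
  finally show ?thesis .
qed

lemma smult_mat_vec:
  "A \<in> carrier_mat n k \<Longrightarrow> x \<in> carrier_vec k \<Longrightarrow>
    (c \<cdot>\<^sub>m A) *\<^sub>v x = c \<cdot>\<^sub>v (A *\<^sub>v (x :: 'a::comm_ring_1 vec))"
  by (rule eq_vecI) (auto simp: scalar_prod_def sum_distrib_left mult.assoc)

lemma orbit_pow_mat:
  assumes "A \<in> carrier_mat n n" "x \<in> carrier_vec n"
  shows "orbit n A (\<lambda>k r. (A ^\<^sub>m k *\<^sub>v x) $ r)"
  unfolding orbit_def
proof (intro conjI allI impI assms(1))
  fix k r assume "r < n"
  then show "(A ^\<^sub>m Suc k *\<^sub>v x) $ r = (\<Sum>c<n. A $$ (r, c) * (A ^\<^sub>m k *\<^sub>v x) $ c)"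
    unfolding pow_mat_vec_Suc[OF assms] using assms
    by (simp add: scalar_prod_def lessThan_atLeast0)
qed

text \<open>Powers of the companion matrix provide polynomials over the base field whose roots are
  exactly the powers of the roots of \<open>m\<close>; that their coefficients are rational for
  rational \<open>m\<close> comes for free.\<close>

definition companion :: "'a::comm_ring_1 poly \<Rightarrow> 'a mat" where
  "companion m = mat (degree m) (degree m)
     (\<lambda>(r, c). if Suc r = degree m then - coeff m c else if c = Suc r then 1 else 0)"

lemma companion_carrier [simp]: "companion m \<in> carrier_mat (degree m) (degree m)"
  by (simp add: companion_def)

lemma companion_row:
  assumes "r < degree m"
  shows "(\<Sum>c<degree m. companion m $$ (r, c) * w c) =
    (if Suc r = degree m then - (\<Sum>c<degree m. coeff m c * w c) else w (Suc r))"
proof (cases "Suc r = degree m")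
  case True
  then have "(\<Sum>c<degree m. companion m $$ (r, c) * w c) = (\<Sum>c<degree m. - (coeff m c * w c))"
    using assms by (intro sum.cong) (auto simp: companion_def)
  then show ?thesis using True by (simp add: sum_negf)
next
  case False
  then have "(\<Sum>c<degree m. companion m $$ (r, c) * w c) = (\<Sum>c<degree m. if c = Suc r then w c else 0)"
    using assms by (intro sum.cong) (auto simp: companion_def)
  then show ?thesis using False assms by simp
qed

lemma poly_monic_lessThan:
  "lead_coeff m = 1 \<Longrightarrow> poly m z = (\<Sum>c<degree m. coeff m c * z ^ c) + z ^ degree (m :: 'a::comm_ring_1 poly)"
proof -
  assume "lead_coeff m = 1"
  moreover have "{..degree m} = insert (degree m) {..<degree m}" by auto
  ultimately show ?thesis by (simp add: poly_altdef add.commute)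
qed

text \<open>Only the sets of roots are compared, which eigenvectors settle: a root \<open>z\<close>
  gives the vector \<open>1, z, z^2, ...\<close>, and conversely the rows force every eigenvector to
  be a multiple of such a vector.\<close>

lemma companion_root:
  fixes m :: "complex poly"
  assumes m: "lead_coeff m = 1"
  shows "poly (char_poly (companion m)) z = 0 \<longleftrightarrow> poly m z = 0"
proof
  let ?d = "degree m"
  assume "poly m z = 0"
  then have top: "- (\<Sum>c<?d. coeff m c * z ^ c) = z ^ ?d"
    using poly_monic_lessThan[OF m, of z] by (simp add: add_eq_0_iff)
  have d: "?d > 0"
  proof (rule ccontr)
    assume "\<not> ?thesis"
    then show False using top by simp
  qed
  show "poly (char_poly (companion m)) z = 0"
  proof (rule eigen_root[of _ ?d "\<lambda>c. z ^ c" z 0])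
    fix r assume r: "r < ?d"
    show "(\<Sum>c<?d. companion m $$ (r, c) * z ^ c) = z * z ^ r"
      using companion_row[OF r] top by (simp split: if_splits) (metis power_Suc)
  qed (use d in auto)
next
  let ?d = "degree m"
  assume "poly (char_poly (companion m)) z = 0"
  then obtain w r0 where w: "\<And>r. r < ?d \<Longrightarrow> (\<Sum>c<?d. companion m $$ (r, c) * w c) = z * w r"
    and r0: "r0 < ?d" "w r0 \<noteq> 0"
    using root_eigen[OF companion_carrier, of m z] by blast
  have w0: "w r = z ^ r * w 0" if "r < ?d" for r
    using that
  proof (induction r)
    case (Suc r)
    then have "w (Suc r) = z * w r" using w[of r] by (simp add: companion_row)
    then show ?case using Suc by simp
  qed simp
  have "w 0 \<noteq> 0" using w0[OF r0(1)] r0(2) by auto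
  obtain r where r: "?d = Suc r" using r0 by (cases ?d) auto
  have "- (\<Sum>c<?d. coeff m c * w c) = z * w r"
    using w[of r] companion_row[of r m w] r by (simp del: sum.lessThan_Suc)
  also have "z * w r = z ^ ?d * w 0" using w0[of r] r by simp
  also have "(\<Sum>c<?d. coeff m c * w c) = (\<Sum>c<?d. coeff m c * z ^ c) * w 0"
    unfolding sum_distrib_right by (intro sum.cong refl) (subst w0, auto)
  finally have e: "- ((\<Sum>c<?d. coeff m c * z ^ c) * w 0) = z ^ ?d * w 0" .
  have "((\<Sum>c<?d. coeff m c * z ^ c) + z ^ ?d) * w 0 = 0"
    unfolding distrib_right e[symmetric] by simp
  then show "poly m z = 0"
    using \<open>w 0 \<noteq> 0\<close> by (simp add: poly_monic_lessThan[OF m])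
qed

lemma pow_root:
  fixes M :: "complex mat"
  assumes M: "M \<in> carrier_mat d d" and z: "poly (char_poly M) z = 0"
  shows "poly (char_poly (c \<cdot>\<^sub>m M ^\<^sub>m k)) (c * z ^ k) = 0"
proof -
  obtain x where x: "eigenvector M x z"
    using eigenvalue_root_char_poly[OF M] z unfolding eigenvalue_def by blast
  then have xc: "x \<in> carrier_vec d" "x \<noteq> 0\<^sub>v d" using M by (auto simp: eigenvector_def)
  have "M ^\<^sub>m k *\<^sub>v x = z ^ k \<cdot>\<^sub>v x" using eigenvector_pow[OF M x] .
  then have "(c \<cdot>\<^sub>m M ^\<^sub>m k) *\<^sub>v x = (c * z ^ k) \<cdot>\<^sub>v x"
    using M xc by (simp add: smult_mat_vec[of _ d d] smult_smult_assoc)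
  then have "eigenvector (c \<cdot>\<^sub>m M ^\<^sub>m k) x (c * z ^ k)"
    using M xc by (simp add: eigenvector_def)
  then show ?thesis
    using eigenvalue_root_char_poly[of "c \<cdot>\<^sub>m M ^\<^sub>m k" d "c * z ^ k"] M
    unfolding eigenvalue_def by auto
qed

text \<open>An eigenvector of a power of \<open>M\<close> is annihilated by \<open>t^k - \<mu>\<close> and by the characteristic
  polynomial of \<open>M\<close>, so these have a common root.\<close>

lemma root_pow:
  fixes M :: "complex mat"
  assumes M: "M \<in> carrier_mat d d" and c: "c \<noteq> 0" and y: "poly (char_poly (c \<cdot>\<^sub>m M ^\<^sub>m k)) y = 0"
  shows "\<exists>z. poly (char_poly M) z = 0 \<and> y = c * z ^ k"
proof -
  have C: "c \<cdot>\<^sub>m M ^\<^sub>m k \<in> carrier_mat d d" using M by simp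
  obtain x where x: "eigenvector (c \<cdot>\<^sub>m M ^\<^sub>m k) x y"
    using eigenvalue_root_char_poly[OF C] y unfolding eigenvalue_def by blast
  then have xc: "x \<in> carrier_vec d" "x \<noteq> 0\<^sub>v d" "(c \<cdot>\<^sub>m M ^\<^sub>m k) *\<^sub>v x = y \<cdot>\<^sub>v x"
    using M by (auto simp: eigenvector_def)
  have "(M ^\<^sub>m k *\<^sub>v x) $ r = (y / c) * x $ r" if "r < d" for r
  proof -
    have "c * (M ^\<^sub>m k *\<^sub>v x) $ r = y * x $ r"
      using arg_cong[OF xc(3), of "\<lambda>u. vec_index u r"] that xc(1) M
      by (simp add: smult_mat_vec[of _ d d])
    then show ?thesis using c by (simp add: field_simps)
  qed
  moreover define v where "v = (\<lambda>j r. (M ^\<^sub>m j *\<^sub>v x) $ r)"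
  ultimately have vk: "v k r = (y / c) * v 0 r" if "r < d" for r using that M xc(1) by simp
  have orb: "orbit d M v" unfolding v_def by (rule orbit_pow_mat[OF M xc(1)])
  let ?p = "char_poly M" and ?q = "monom 1 k - [:y / c:]"
  have q: "annihilates d ?q v"
    using vk by (simp add: annihilates_def lin_diff lin_pCons)
  obtain a b where ab: "a * ?p + b * ?q = gcd ?p ?q"
    using bezout_coefficients_fst_snd by metis
  have g: "annihilates d (gcd ?p ?q) v"
    unfolding ab[symmetric]
    by (intro annihilates_add annihilates_mult[OF orb] char_poly_annihilates[OF orb] q)
  have p0: "?p \<noteq> 0" using degree_monic_char_poly[OF M] by auto
  \<comment> \<open>A constant gcd would annihilate the eigenvector itself.\<close>
  have "degree (gcd ?p ?q) \<noteq> 0"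
  proof
    assume "degree (gcd ?p ?q) = 0"
    then obtain e where e: "gcd ?p ?q = [:e:]" by (auto elim: degree_eq_zeroE)
    then have "e \<noteq> 0" using p0 by auto
    then have "v 0 r = 0" if "r < d" for r
      using g that unfolding e annihilates_def by (simp add: lin_pCons)
    then have "x = 0\<^sub>v d" using M xc(1) by (intro eq_vecI) (auto simp: v_def)
    then show False using xc(2) by simp
  qed
  then obtain z where "poly (gcd ?p ?q) z = 0"
    using alg_closed_imp_poly_has_root[of "gcd ?p ?q"] by auto
  then have "poly ?p z = 0" "poly ?q z = 0"
    by (meson dvd_trans gcd_dvd1 gcd_dvd2 poly_eq_0_iff_dvd)+
  then show ?thesis using c by (intro exI[of _ z]) (auto simp: poly_monom)
qed

text \<open>There are \<open>(2 b + 1)^(n + 1)\<close> integer polynomials of degree at most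
  \<open>n\<close> with coefficients bounded by \<open>b = (1 + R)^n\<close>, and each nonzero one
  has at most \<open>n\<close> roots. This \<open>b\<close> bounds the coefficients of a monic
  polynomial whose roots have modulus at most \<open>R\<close>.\<close>

definition root_count :: "nat \<Rightarrow> nat \<Rightarrow> nat" where
  "root_count n R = (2 * (1 + R) ^ n + 1) ^ (n + 1) * n"

lemma card_bounded_roots:
  fixes Z :: "complex set"
  assumes Z: "\<And>z. z \<in> Z \<Longrightarrow> \<exists>f. f \<noteq> 0 \<and> degree f \<le> n \<and> (\<forall>j. coeff f j \<in> \<int> \<and> norm (coeff f j) \<le> real b) \<and> poly f z = 0"
  shows "finite Z \<and> card Z \<le> (2 * b + 1) ^ (n + 1) * n"
proof -
  let ?F = "PiE {..n} (\<lambda>_. {- int b..int b})"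
  let ?P = "\<lambda>f. \<Sum>j\<le>n. monom (of_int (f j)) j :: complex poly"
  let ?R = "\<lambda>f. if ?P f = 0 then {} else {z. poly (?P f) z = 0}"
  have deg: "degree (?P f) \<le> n" for f
    by (intro degree_sum_le order_trans[OF degree_monom_le]) auto
  have R: "finite (?R f) \<and> card (?R f) \<le> n" for f
    using poly_roots_finite[of "?P f"] card_poly_roots_bound[of "?P f"] deg[of f] by auto
  have finF: "finite ?F" by (rule finite_PiE) auto
  have "Z \<subseteq> (\<Union>f\<in>?F. ?R f)"
  proof
    fix z assume "z \<in> Z"
    then obtain f where f: "f \<noteq> 0" "degree f \<le> n" "\<And>j. coeff f j \<in> \<int>"
      "\<And>j. norm (coeff f j) \<le> real b" "poly f z = 0" using Z by blast
    define g where "g = restrict (\<lambda>j. \<lfloor>Re (coeff f j)\<rfloor>) {..n}"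
    have int: "of_int \<lfloor>Re (coeff f j)\<rfloor> = coeff f j" for j
      using f(3)[of j] by (auto elim!: Ints_cases)
    have "\<bar>\<lfloor>Re (coeff f j)\<rfloor>\<bar> \<le> int b" for j
    proof -
      have "norm (of_int \<lfloor>Re (coeff f j)\<rfloor> :: complex) \<le> real b" using f(4) int by simp
      then have "\<bar>real_of_int \<lfloor>Re (coeff f j)\<rfloor>\<bar> \<le> real b" by simp
      then show ?thesis by linarith
    qed
    then have "g \<in> ?F" by (auto simp: g_def abs_le_iff minus_le_iff)
    moreover have "?P g = f"
    proof (rule poly_eqI)
      fix j
      have "coeff (?P g) j = (if j \<le> n then coeff f j else 0)"
        by (simp add: coeff_sum g_def int)
      then show "coeff (?P g) j = coeff f j" using f(2) by (simp add: coeff_eq_0)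
    qed
    ultimately show "z \<in> (\<Union>f\<in>?F. ?R f)" using f(1,5) by (intro UN_I[of g]) simp_all
  qed
  moreover have fin: "finite (\<Union>f\<in>?F. ?R f)" using finF R by blast
  moreover have "card (\<Union>f\<in>?F. ?R f) \<le> (\<Sum>f\<in>?F. card (?R f))"
    using finF by (rule card_UN_le)
  moreover have "(\<Sum>f\<in>?F. card (?R f)) \<le> card ?F * n"
    using sum_bounded_above[of ?F "\<lambda>f. card (?R f)" n] R by simp
  moreover have "card ?F = (2 * b + 1) ^ (n + 1)"
  proof -
    have "card {- int b..int b} = 2 * b + 1" by (simp add: nat_eq_iff)
    then show ?thesis by (simp add: card_PiE)
  qed
  ultimately show ?thesis
    using card_mono[OF fin, of Z] finite_subset[OF _ fin, of Z] by (metis (no_types, lifting) le_trans)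
qed

text \<open>Kronecker's theorem in effective form. For fixed \<open>k\<close> the numbers
  \<open>c y^k\<close>, with \<open>y\<close> running over the roots of \<open>m\<close>, are the
  roots of a monic integer polynomial of bounded height, so all \<open>c z^k\<close> lie in a set of
  at most \<open>root_count n R\<close> elements.\<close>

lemma kronecker_pigeonhole:
  fixes m :: "rat poly"
  defines "mc \<equiv> map_poly of_rat m :: complex poly"
  assumes m: "lead_coeff m = 1" "degree m \<le> n" and c: "c > 0"
    and int: "\<And>z k. poly mc z = 0 \<Longrightarrow> k \<le> i \<Longrightarrow> algebraic_int (of_nat c * z ^ k)"
    and bound: "\<And>z k. poly mc z = 0 \<Longrightarrow> k \<le> i \<Longrightarrow> norm (of_nat c * z ^ k) \<le> real R"
    and i: "root_count n R \<le> i" and z: "poly mc z = 0"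
  shows "\<exists>k l. k < l \<and> l \<le> root_count n R \<and> z ^ k = z ^ l"
proof -
  have mc: "lead_coeff mc = 1" "degree mc = degree m"
    using m(1) by (simp_all add: mc_def)
  have comp: "map_mat of_rat (companion m) = companion mc"
    unfolding companion_def mc(2) by (rule eq_matI) (auto simp: mc_def of_rat_minus)
  let ?d = "degree m"
  let ?Z = "(\<lambda>k. of_nat c * z ^ k) ` {..root_count n R}"
  have "finite ?Z \<and> card ?Z \<le> (2 * (1 + R) ^ n + 1) ^ (n + 1) * n"
  proof (rule card_bounded_roots)
    fix x assume "x \<in> ?Z"
    then obtain k where "k \<le> root_count n R" and kx: "x = of_nat c * z ^ k" by blast
    with i have k: "k \<le> i" by linarith
    \<comment> \<open>\<open>F\<close> shows that the coefficients are rational; the linear factors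
      of its complex image \<open>G\<close> show that they are algebraic integers of bounded
      modulus. Together they are bounded integers.\<close>
    define F where "F = char_poly (of_nat c \<cdot>\<^sub>m companion m ^\<^sub>m k)"
    define G where "G = char_poly (of_nat c \<cdot>\<^sub>m companion mc ^\<^sub>m k)"
    have Cm: "companion mc \<in> carrier_mat ?d ?d" using companion_carrier[of mc] mc(2) by simp
    then have Cc: "of_nat c \<cdot>\<^sub>m companion mc ^\<^sub>m k \<in> carrier_mat ?d ?d" by simp
    have "map_mat of_rat (of_nat c \<cdot>\<^sub>m companion m ^\<^sub>m k) = (of_nat c :: complex) \<cdot>\<^sub>m companion mc ^\<^sub>m k"
      unfolding comp[symmetric] of_rat_hom.mat_hom_pow[OF companion_carrier, symmetric]
      by (rule eq_matI) (simp_all add: of_rat_mult)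
    then have GF: "G = map_poly of_rat F"
      unfolding F_def G_def by (subst of_rat_hom.char_poly_hom[symmetric, of _ ?d]) simp_all
    have dG: "degree G = ?d" "coeff G ?d = 1"
      using degree_monic_char_poly[OF Cc] unfolding G_def by auto
    obtain as where as: "G = (\<Prod>a\<leftarrow>as. [:- a, 1:])" "length as = ?d"
      using char_poly_factorized[OF Cc] unfolding G_def by auto
    have root: "\<exists>w. poly mc w = 0 \<and> a = of_nat c * w ^ k" if "a \<in> set as" for a
    proof -
      have "poly G a = 0" unfolding as(1) using that by (simp add: poly_prod_list prod_list_zero_iff)
      then show ?thesis
        using root_pow[OF Cm, of "of_nat c" k a] c companion_root[OF mc(1)] unfolding G_def by auto
    qed
    have "coeff G j \<in> \<int> \<and> norm (coeff G j) \<le> real ((1 + R) ^ n)" for j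
    proof
      have "algebraic_int (coeff G j)"
        unfolding as(1) by (rule algebraic_int_coeff_linear_factors) (use root int k in blast)
      moreover have "coeff G j \<in> \<rat>" unfolding GF by (simp add: Rats_of_rat)
      ultimately show "coeff G j \<in> \<int>" by (rule rational_algebraic_int_is_int)
      have "norm (coeff G j) \<le> (1 + real R) ^ length as"
        unfolding as(1) by (rule norm_coeff_linear_factors) (use root bound k in auto)
      also have "\<dots> \<le> (1 + real R) ^ n" using as(2) m(2) by (intro power_increasing) auto
      finally show "norm (coeff G j) \<le> real ((1 + R) ^ n)" by simp
    qed
    moreover have "poly G x = 0"
      unfolding G_def kx by (rule pow_root[OF Cm]) (use companion_root[OF mc(1)] z in simp)
    moreover have "G \<noteq> 0" using dG(2) by auto
    ultimately show "\<exists>f. f \<noteq> 0 \<and> degree f \<le> n \<and>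
        (\<forall>j. coeff f j \<in> \<int> \<and> norm (coeff f j) \<le> real ((1 + R) ^ n)) \<and> poly f x = 0"
      using dG(1) m(2) by (intro exI[of _ G]) simp
  qed
  \<comment> \<open>There is one exponent more than there are possible values.\<close>
  then have "card ?Z < card {..root_count n R}" by (simp add: root_count_def)
  then have "\<not> inj_on (\<lambda>k. of_nat c * z ^ k) {..root_count n R}" using pigeonhole by blast
  then obtain k l where "k \<le> root_count n R" "l \<le> root_count n R" "k \<noteq> l" "of_nat c * z ^ k = of_nat c * z ^ l"
    unfolding inj_on_def by auto
  then have "z ^ k = z ^ l" "k \<noteq> l" "k \<le> root_count n R" "l \<le> root_count n R" using c by simp_all
  then show ?thesis by (metis linorder_neqE_nat)
qed

section \<open>Orbits over the rationals\<close>

text \<open>Elimination passes from \<open>k + 1\<close> to \<open>k\<close> unknowns and from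
  height \<open>H\<close> to \<open>2 H^2\<close>; back substitution costs a factor
  \<open>(k + 1) H\<close>. With base \<open>2 (k + 2) H\<close> the exponents must satisfy
  \<open>2 e_k + 1 <= e_(k+1)\<close>, and \<open>e_k = 4^k\<close> does.\<close>

definition solution_bound :: "nat \<Rightarrow> nat \<Rightarrow> nat" where
  "solution_bound k H = (2 * (k + 1) * H) ^ (4 ^ k)"

lemma solution_bound_Suc:
  assumes "H \<ge> 1"
  shows "(k + 1) * H * solution_bound k (2 * H * H) \<le> solution_bound (Suc k) H"
proof -
  let ?x = "2 * (Suc k + 1) * H"
  have "2 * (k + 1) * (2 * H * H) \<le> ?x ^ 2" by (simp add: power2_eq_square algebra_simps)
  then have "solution_bound k (2 * H * H) \<le> (?x ^ 2) ^ (4 ^ k)"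
    unfolding solution_bound_def by (rule power_mono) simp
  then have "(k + 1) * H * solution_bound k (2 * H * H) \<le> ?x * (?x ^ 2) ^ (4 ^ k)"
    by (intro mult_mono) (auto simp: algebra_simps)
  also have "\<dots> = ?x ^ (1 + 2 * 4 ^ k)" by (simp add: power_mult)
  also have "\<dots> \<le> ?x ^ (4 ^ Suc k)"
  proof (rule power_increasing)
    have "(1 :: nat) \<le> 4 ^ k" by simp
    then show "1 + 2 * 4 ^ k \<le> (4 :: nat) ^ Suc k" by simp
    show "1 \<le> ?x" using assms by simp
  qed
  finally show ?thesis by (simp only: solution_bound_def)
qed

text \<open>Elimination of one unknown squares the coefficients at worst.\<close>

lemma solve_bounded:
  fixes a :: "'r \<Rightarrow> nat \<Rightarrow> int" and b :: "'r \<Rightarrow> int" and z :: "nat \<Rightarrow> rat"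
  assumes "\<And>r. r \<in> S \<Longrightarrow> (\<Sum>j<k. of_int (a r j) * z j) = of_int (b r)"
    and "\<And>r j. r \<in> S \<Longrightarrow> j < k \<Longrightarrow> \<bar>a r j\<bar> \<le> int H" and "\<And>r. r \<in> S \<Longrightarrow> \<bar>b r\<bar> \<le> int H" and "H \<ge> 1"
  shows "\<exists>d q. d \<ge> 1 \<and> d \<le> int (solution_bound k H) \<and> (\<forall>j<k. \<bar>q j\<bar> \<le> int (solution_bound k H)) \<and>
    (\<forall>r\<in>S. (\<Sum>j<k. a r j * q j) = d * b r)"
  using assms
proof (induction k arbitrary: a b H)
  case 0
  then show ?case by (intro exI[of _ 1]) (auto simp: solution_bound_def)
next
  case (Suc k)
  let ?G = "int (solution_bound (Suc k) H)" and ?g = "int (solution_bound k (2 * H * H))"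
  have mono: "int H * ?g + int k * (int H * ?g) \<le> ?G"
    using solution_bound_Suc[OF \<open>H \<ge> 1\<close>, of k] by (simp flip: of_nat_mult of_nat_add add: algebra_simps)
  have G1: "?g \<le> int H * ?g"
    using \<open>H \<ge> 1\<close> by (simp flip: of_nat_mult)
  have nn: "0 \<le> int k * (int H * ?g)" by simp
  have H2: "int H \<le> int (2 * H * H)" using \<open>H \<ge> 1\<close> by (simp flip: of_nat_mult)
  show ?case
  proof (cases "\<forall>r\<in>S. a r k = 0")
    \<comment> \<open>The last unknown does not occur, so it is set to 0.\<close>
    case True
    have "\<exists>d q. d \<ge> 1 \<and> d \<le> ?g \<and> (\<forall>j<k. \<bar>q j\<bar> \<le> ?g) \<and>
      (\<forall>r\<in>S. (\<Sum>j<k. a r j * q j) = d * b r)"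
    proof (rule Suc.IH)
      show "(\<Sum>j<k. of_int (a r j) * z j) = of_int (b r)" if "r \<in> S" for r
        using Suc.prems(1)[OF that] True that by simp
      show "\<bar>a r j\<bar> \<le> int (2 * H * H)" if "r \<in> S" "j < k" for r j
        using Suc.prems(2)[OF that(1), of j] that(2) H2 by linarith
      show "\<bar>b r\<bar> \<le> int (2 * H * H)" if "r \<in> S" for r
        using Suc.prems(3)[OF that] H2 by linarith
      show "1 \<le> 2 * H * H" using \<open>H \<ge> 1\<close> by simp
    qed
    then obtain d q where dq: "d \<ge> 1" "d \<le> ?g"
      "\<forall>j<k. \<bar>q j\<bar> \<le> ?g" "\<forall>r\<in>S. (\<Sum>j<k. a r j * q j) = d * b r" by blast
    have le: "?g \<le> ?G" using mono G1 nn by linarith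
    have "(\<Sum>j<Suc k. a r j * (q(k := 0)) j) = d * b r" if "r \<in> S" for r
      using dq(4) that by simp
    moreover have "\<bar>(q(k := 0)) j\<bar> \<le> ?G" if "j < Suc k" for j
      using dq(3) le that by (cases "j = k") (auto simp: less_Suc_eq intro: order_trans)
    ultimately show ?thesis using dq(1,2) le
      by (intro exI[of _ d] exI[of _ "q(k := 0)"]) auto
  next
    case False
    then obtain r0 where r0: "r0 \<in> S" "a r0 k \<noteq> 0" by blast
    \<comment> \<open>Fraction-free elimination of the last unknown with the pivot row
      \<open>r0\<close>.\<close>
    let ?a = "\<lambda>r j. a r0 k * a r j - a r k * a r0 j"
    let ?b = "\<lambda>r. a r0 k * b r - a r k * b r0"
    have ak: "\<bar>a r k\<bar> \<le> int H" if "r \<in> S" for r using Suc.prems(2)[OF that, of k] by simp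
    have bnd: "\<bar>a r0 k * x - a r k * y\<bar> \<le> int (2 * H * H)"
      if "r \<in> S" "\<bar>x\<bar> \<le> int H" "\<bar>y\<bar> \<le> int H" for r x y
    proof -
      have "\<bar>a r0 k * x - a r k * y\<bar> \<le> \<bar>a r0 k\<bar> * \<bar>x\<bar> + \<bar>a r k\<bar> * \<bar>y\<bar>"
        using abs_triangle_ineq4[of "a r0 k * x" "a r k * y"] by (simp add: abs_mult)
      also have "\<dots> \<le> int H * int H + int H * int H"
        using that ak r0(1) by (intro add_mono mult_mono) auto
      finally show ?thesis by simp
    qed
    have "\<exists>d q. d \<ge> 1 \<and> d \<le> ?g \<and> (\<forall>j<k. \<bar>q j\<bar> \<le> ?g) \<and>
      (\<forall>r\<in>S. (\<Sum>j<k. ?a r j * q j) = d * ?b r)"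
    proof (rule Suc.IH)
      show "(\<Sum>j<k. of_int (?a r j) * z j) = of_int (?b r)" if "r \<in> S" for r
      proof -
        have e: "(\<Sum>j<k. of_int (a r j) * z j) = of_int (b r) - of_int (a r k) * z k" if "r \<in> S" for r
          using Suc.prems(1)[OF that] by (simp add: algebra_simps)
        have "(\<Sum>j<k. of_int (?a r j) * z j) =
            of_int (a r0 k) * (\<Sum>j<k. of_int (a r j) * z j) - of_int (a r k) * (\<Sum>j<k. of_int (a r0 j) * z j)"
          by (simp add: sum_distrib_left sum_subtractf algebra_simps)
        then show ?thesis unfolding e[OF that] e[OF r0(1)] by (simp add: algebra_simps)
      qed
      show "\<bar>?a r j\<bar> \<le> int (2 * H * H)" if "r \<in> S" "j < k" for r j
        using that r0(1) Suc.prems(2) by (intro bnd) auto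
      show "\<bar>?b r\<bar> \<le> int (2 * H * H)" if "r \<in> S" for r
        using that r0(1) Suc.prems(3) by (intro bnd) auto
      show "1 \<le> 2 * H * H" using \<open>H \<ge> 1\<close> by simp
    qed
    then obtain d q where dq: "d \<ge> 1" "d \<le> ?g"
      "\<And>j. j < k \<Longrightarrow> \<bar>q j\<bar> \<le> ?g"
      "\<And>r. r \<in> S \<Longrightarrow> (\<Sum>j<k. ?a r j * q j) = d * ?b r" by blast
    \<comment> \<open>Back substitution produces the denominator \<open>a r0 k * d\<close>;
      multiplying through by the sign of the pivot makes it positive.\<close>
    let ?s = "sgn (a r0 k)"
    let ?qk = "d * b r0 - (\<Sum>j<k. a r0 j * q j)"
    let ?q = "\<lambda>j. ?s * (if j = k then ?qk else a r0 k * q j)"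
    have eq: "(\<Sum>j<Suc k. a r j * ?q j) = \<bar>a r0 k\<bar> * d * b r" if "r \<in> S" for r
    proof -
      have "(\<Sum>j<k. a r j * ?q j) = ?s * (a r0 k * (\<Sum>j<k. a r j * q j))"
        by (simp add: sum_distrib_left mult_ac)
      then have "(\<Sum>j<Suc k. a r j * ?q j) =
          ?s * (a r0 k * (\<Sum>j<k. a r j * q j) - a r k * (\<Sum>j<k. a r0 j * q j) + a r k * (d * b r0))"
        by (simp add: algebra_simps)
      also have "a r0 k * (\<Sum>j<k. a r j * q j) - a r k * (\<Sum>j<k. a r0 j * q j) = (\<Sum>j<k. ?a r j * q j)"
        by (simp add: sum_distrib_left sum_subtractf algebra_simps)
      also have "?s * ((\<Sum>j<k. ?a r j * q j) + a r k * (d * b r0)) = ?s * a r0 k * d * b r"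
        unfolding dq(4)[OF that] by (simp add: algebra_simps)
      finally show ?thesis by (simp add: abs_sgn mult.commute)
    qed
    have s: "\<bar>?s * x\<bar> = \<bar>x\<bar>" for x using r0(2) by (simp add: abs_mult abs_sgn_eq)
    have q1: "\<bar>?q j\<bar> \<le> ?G" if "j < Suc k" for j
    proof (cases "j = k")
      case True
      have "\<bar>?qk\<bar> \<le> \<bar>d * b r0\<bar> + \<bar>\<Sum>j<k. a r0 j * q j\<bar>"
        by (rule abs_triangle_ineq4)
      also have "\<dots> \<le> \<bar>d\<bar> * \<bar>b r0\<bar> + (\<Sum>j<k. \<bar>a r0 j\<bar> * \<bar>q j\<bar>)"
        by (intro add_mono order_trans[OF sum_abs]) (simp_all add: abs_mult)
      also have "\<dots> \<le> ?g * int H + (\<Sum>j<k. int H * ?g)"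
        using dq(1-3) Suc.prems(2,3) r0(1) by (intro add_mono mult_mono sum_mono) auto
      also have "\<dots> \<le> ?G" using mono by (simp add: algebra_simps)
      finally show ?thesis using True s by simp
    next
      case False
      then have "\<bar>a r0 k * q j\<bar> \<le> int H * ?g"
        unfolding abs_mult using dq(3) ak[OF r0(1)] that by (intro mult_mono) auto
      also have "\<dots> \<le> ?G" using mono nn by linarith
      finally show ?thesis using False s by simp
    qed
    have "1 \<le> \<bar>a r0 k\<bar> * d" using r0(2) dq(1) by (simp add: zero_less_mult_iff int_one_le_iff_zero_less)
    moreover have "\<bar>a r0 k\<bar> * d \<le> int H * ?g"
      using dq(1,2) ak[OF r0(1)] by (intro mult_mono) auto
    then have "\<bar>a r0 k\<bar> * d \<le> ?G" using mono nn by linarith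
    ultimately show ?thesis using eq q1
      by (intro exI[of _ "\<bar>a r0 k\<bar> * d"] exI[of _ ?q]) blast
  qed
qed

text \<open>Complex polynomials split, so multiplicities decide divisibility; one common linear
  factor is removed at each step.\<close>

lemma dvd_if_orders_le:
  fixes p q :: "complex poly"
  assumes "q \<noteq> 0" "\<And>z. poly p z = 0 \<Longrightarrow> order z p \<le> order z q" "p \<noteq> 0"
  shows "p dvd q"
  using assms
proof (induction "degree p" arbitrary: p q)
  case 0
  then show ?case by (metis is_unit_iff_degree unit_imp_dvd)
next
  case (Suc d)
  then obtain z where z: "poly p z = 0" using alg_closed_imp_poly_has_root[of p] by auto
  then obtain p' where p': "p = [:-z, 1:] * p'" by (auto simp: poly_eq_0_iff_dvd)
  have "order z p \<noteq> 0" using z Suc.prems by (simp add: order_root)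
  then have "order z q \<noteq> 0" using Suc.prems(2)[OF z] by simp
  then have "poly q z = 0" using Suc.prems by (simp add: order_root)
  then obtain q' where q': "q = [:-z, 1:] * q'" by (auto simp: poly_eq_0_iff_dvd)
  have nz: "p' \<noteq> 0" "q' \<noteq> 0" using Suc.prems p' q' by auto
  have "degree p = 1 + degree p'" unfolding p' by (subst degree_mult_eq) (use nz in auto)
  then have "d = degree p'" using Suc.hyps(2) by simp
  moreover have "order y p' \<le> order y q'" if "poly p' y = 0" for y
  proof -
    have "order y p \<le> order y q" using that Suc.prems(2)[of y] p' by simp
    moreover have "order y p = order y [:-z, 1:] + order y p'"
      unfolding p' by (rule order_mult) (use Suc.prems(3) p' in metis)
    moreover have "order y q = order y [:-z, 1:] + order y q'"
      unfolding q' by (rule order_mult) (use Suc.prems(1) q' in metis)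
    ultimately show ?thesis by simp
  qed
  ultimately have "p' dvd q'" using Suc.hyps(1) nz by blast
  then show ?case unfolding p' q' by (rule mult_dvd_mono[OF dvd_refl])
qed


text \<open>The eigenvector equation is compared at a coordinate of largest modulus.\<close>

lemma root_norm_bound:
  fixes A :: "complex mat"
  assumes "A \<in> carrier_mat n n" "poly (char_poly A) z = 0"
    and "\<And>r c. r < n \<Longrightarrow> c < n \<Longrightarrow> norm (A $$ (r, c)) \<le> B"
  shows "norm z \<le> real n * B"
proof -
  obtain w r0 where w: "\<And>r. r < n \<Longrightarrow> (\<Sum>c<n. A $$ (r, c) * w c) = z * w r" and r0: "r0 < n" "w r0 \<noteq> 0"
    using root_eigen[OF assms(1,2)] by blast
  define W where "W = Max ((\<lambda>r. norm (w r)) ` {..<n})"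
  have le: "norm (w r) \<le> W" if "r < n" for r unfolding W_def using that by (intro Max_ge) auto
  have "W \<in> (\<lambda>r. norm (w r)) ` {..<n}" unfolding W_def using r0 by (intro Max_in) auto
  then obtain r where r: "r < n" "W = norm (w r)" by auto
  have pos: "W > 0" using le[OF r0(1)] r0(2) by (metis less_le_trans zero_less_norm_iff)
  have "norm z * W = norm (\<Sum>c<n. A $$ (r, c) * w c)" using w[OF r(1)] r(2) by (simp add: norm_mult)
  also have "\<dots> \<le> (\<Sum>c<n. norm (A $$ (r, c)) * norm (w c))"
    by (rule order_trans[OF norm_sum]) (simp add: norm_mult)
  also have "\<dots> \<le> (\<Sum>c<n. B * W)"
  proof (intro sum_mono mult_mono)
    show "0 \<le> B" using order_trans[OF norm_ge_zero assms(3)[OF r(1) r(1)]] .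
  qed (use assms(3) r(1) le in auto)
  finally show ?thesis using pos by (simp add: mult.assoc[symmetric])
qed

text \<open>After multiplication by \<open>D^(n + 1)\<close> the linear system for \<open>q\<close>
  has integer data of size at most \<open>(n H)^(n + 1)\<close>.\<close>

definition coeff_bound :: "nat \<Rightarrow> nat \<Rightarrow> nat" where
  "coeff_bound n H = solution_bound n ((n * H) ^ (n + 1))"

text \<open>With \<open>G = coeff_bound n H\<close>, this dominates both \<open>G (n H)^n\<close>, a
  bound for \<open>c\<close>, and \<open>D^n * n * G (n H)^n\<close>, a bound for
  \<open>c z^i\<close>.\<close>

definition conjugate_bound :: "nat \<Rightarrow> nat \<Rightarrow> nat" where
  "conjugate_bound n H = coeff_bound n H * (n * H) ^ (2 * n + 1)"

text \<open>The first summand lets the pigeonhole argument run; the second excludes multiple nonzero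
  roots of the annihilator.\<close>

definition rat_iter_bound :: "nat \<Rightarrow> nat \<Rightarrow> nat" where
  "rat_iter_bound n H = root_count n (conjugate_bound n H) + n * n * coeff_bound n H"

text \<open>Roots of unity need no scaling and have modulus 1, so \<open>root_count n 1\<close>
  bounds the exponents that occur; its factorial is a common multiple of them.\<close>

definition common_order :: "nat \<Rightarrow> nat" where
  "common_order n = fact (root_count n 1)"

text \<open>\<open>D\<close> will be a common denominator of the matrix and both vectors.\<close>

definition scaled_int :: "nat \<Rightarrow> nat \<Rightarrow> rat \<Rightarrow> bool" where
  "scaled_int D H u \<longleftrightarrow> of_nat D * u \<in> \<int> \<and> \<bar>of_nat D * u\<bar> \<le> of_nat H"

text \<open>By Cayley-Hamilton the system is solvable, with a solution that may grow with
  \<open>i\<close>. But its data involve \<open>i\<close> only through \<open>v i\<close>, which is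
  bounded by hypothesis, so \<open>solve_bounded\<close> finds a solution that does not
  grow.\<close>

lemma orbit_relation:
  fixes A :: "rat mat" and v :: "nat \<Rightarrow> nat \<Rightarrow> rat"
  assumes orb: "orbit n A v" and n: "n \<ge> 1" and D: "1 \<le> D" "D \<le> H"
    and A: "\<And>r c. r < n \<Longrightarrow> c < n \<Longrightarrow> scaled_int D H (A $$ (r, c))"
    and x: "\<And>r. r < n \<Longrightarrow> scaled_int D H (v 0 r)"
    and y: "\<And>r. r < n \<Longrightarrow> scaled_int D H (v i r)"
  shows "\<exists>d q. d \<ge> 1 \<and> d \<le> int (coeff_bound n H) \<and> (\<forall>j<n. \<bar>q j\<bar> \<le> int (coeff_bound n H)) \<and>
    (\<forall>r<n. (\<Sum>j<n. of_int (q j) * v j r) = of_int d * v i r)"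
proof -
  note A = A[unfolded scaled_int_def] and x = x[unfolded scaled_int_def] and y = y[unfolded scaled_int_def]
  have Ac: "A \<in> carrier_mat n n" using orb by (simp add: orbit_def)
  let ?D = "of_nat D :: rat" and ?H = "of_nat H :: rat" and ?n = "of_nat n :: rat"
  have H: "H \<ge> 1" using D by simp
  have nH: "1 \<le> n * H" using n H by simp
  \<comment> \<open>Each step of the iteration uses up one factor \<open>D\<close> and enlarges the
    numerator at most by the factor \<open>n H\<close>.\<close>
  have V: "?D ^ Suc j * v j r \<in> \<int> \<and> \<bar>?D ^ Suc j * v j r\<bar> \<le> (?n * ?H) ^ j * ?H" if "r < n" for j r
    using that
  proof (induction j arbitrary: r)
    case 0
    then show ?case using x by simp
  next
    case (Suc j)
    have e: "?D ^ Suc (Suc j) * v (Suc j) r = (\<Sum>c<n. (?D * A $$ (r, c)) * (?D ^ Suc j * v j c))"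
      using orb Suc.prems by (simp add: orbit_def sum_distrib_left mult_ac)
    have "\<bar>?D ^ Suc (Suc j) * v (Suc j) r\<bar> \<le> (\<Sum>c<n. ?H * ((?n * ?H) ^ j * ?H))"
      unfolding e
    proof (rule order_trans[OF sum_abs], rule sum_mono)
      fix c assume "c \<in> {..<n}"
      then show "\<bar>?D * A $$ (r, c) * (?D ^ Suc j * v j c)\<bar> \<le> ?H * ((?n * ?H) ^ j * ?H)"
        unfolding abs_mult[of "?D * A $$ (r, c)"]
        using A[OF Suc.prems] Suc.IH by (intro mult_mono) auto
    qed
    then have "\<bar>?D ^ Suc (Suc j) * v (Suc j) r\<bar> \<le> (?n * ?H) ^ Suc j * ?H" by (simp add: mult_ac)
    moreover have "?D ^ Suc (Suc j) * v (Suc j) r \<in> \<int>"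
      unfolding e
    proof (rule Ints_sum, rule Ints_mult)
      fix c assume "c \<in> {..<n}"
      then show "?D * A $$ (r, c) \<in> \<int>" "?D ^ Suc j * v j c \<in> \<int>"
        using A[OF Suc.prems] Suc.IH by blast+
    qed
    ultimately show ?case by blast
  qed
  \<comment> \<open>The exponent \<open>n + 1\<close> is a common scale: it covers the vectors up to
    index \<open>n - 1\<close> as well as \<open>v i\<close>, for which one factor \<open>D\<close>
    is enough.\<close>
  have scale: "?D ^ (n + 1) * u \<in> \<int> \<and> \<bar>?D ^ (n + 1) * u\<bar> \<le> of_nat ((n * H) ^ (n + 1))"
    if "?D ^ Suc j * u \<in> \<int>" "\<bar>?D ^ Suc j * u\<bar> \<le> (?n * ?H) ^ j * ?H" "j \<le> n" for j u
  proof
    have e: "?D ^ (n + 1) * u = ?D ^ (n - j) * (?D ^ Suc j * u)"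
      using that(3) by (simp add: mult.assoc[symmetric] flip: power_add)
    show "?D ^ (n + 1) * u \<in> \<int>" unfolding e by (rule Ints_mult[OF Ints_power[OF Ints_of_nat] that(1)])
    have "\<bar>?D ^ (n + 1) * u\<bar> \<le> (?n * ?H) ^ (n - j) * ((?n * ?H) ^ j * (?n * ?H))"
      unfolding e abs_mult[of "?D ^ (n - j)"]
    proof (intro mult_mono)
      have "?D \<le> ?H" using D by simp
      also have le: "?H \<le> ?n * ?H" unfolding of_nat_mult[symmetric] of_nat_le_iff using n by simp
      finally show "\<bar>?D ^ (n - j)\<bar> \<le> (?n * ?H) ^ (n - j)" by (simp add: power_mono)
      show "\<bar>?D ^ Suc j * u\<bar> \<le> (?n * ?H) ^ j * (?n * ?H)"
        using le by (intro order_trans[OF that(2)] mult_left_mono) simp_all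
    qed auto
    also have "\<dots> = of_nat ((n * H) ^ (n + 1))"
      using that(3) by (simp add: mult.assoc[symmetric] flip: power_add)
    finally show "\<bar>?D ^ (n + 1) * u\<bar> \<le> of_nat ((n * H) ^ (n + 1))" .
  qed
  have Vs: "?D ^ (n + 1) * v j r \<in> \<int> \<and> \<bar>?D ^ (n + 1) * v j r\<bar> \<le> of_nat ((n * H) ^ (n + 1))"
    if "r < n" "j < n" for j r
    using V[OF that(1), of j] that(2) by (intro scale[of j]) auto
  have ys: "?D ^ (n + 1) * v i r \<in> \<int> \<and> \<bar>?D ^ (n + 1) * v i r\<bar> \<le> of_nat ((n * H) ^ (n + 1))"
    if "r < n" for r
    using y[OF that] by (intro scale[of 0]) auto
  define a where "a = (\<lambda>r j. \<lfloor>?D ^ (n + 1) * v j r\<rfloor>)"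
  define b where "b = (\<lambda>r. \<lfloor>?D ^ (n + 1) * v i r\<rfloor>)"
  have fl: "of_int \<lfloor>u\<rfloor> = u" "\<bar>\<lfloor>u\<rfloor>\<bar> \<le> int K" if "u \<in> \<int> \<and> \<bar>u\<bar> \<le> of_nat K" for u :: rat and K
  proof -
    show e: "of_int \<lfloor>u\<rfloor> = u" using that by (auto elim!: Ints_cases)
    have "\<bar>of_int \<lfloor>u\<rfloor> :: rat\<bar> \<le> of_nat K" unfolding e using that by simp
    then show "\<bar>\<lfloor>u\<rfloor>\<bar> \<le> int K" by linarith
  qed
  have a: "of_int (a r j) = ?D ^ (n + 1) * v j r" "\<bar>a r j\<bar> \<le> int ((n * H) ^ (n + 1))" if "r < n" "j < n" for r j
    unfolding a_def using fl[OF Vs[OF that]] by blast+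
  have b: "of_int (b r) = ?D ^ (n + 1) * v i r" "\<bar>b r\<bar> \<le> int ((n * H) ^ (n + 1))" if "r < n" for r
    unfolding b_def using fl[OF ys[OF that]] by blast+
  \<comment> \<open>This remainder only shows that a solution exists; its height is never
    estimated.\<close>
  let ?p = "monom 1 i mod char_poly A"
  have chi: "degree (char_poly A) = n" "char_poly A \<noteq> 0"
    using degree_monic_char_poly[OF Ac] by auto
  have dp: "degree ?p < n"
    using degree_mod_less'[OF chi(2), of "monom 1 i"] chi(1) n by (cases "?p = 0") auto
  have vi: "v i r = (\<Sum>j<n. coeff ?p j * v j r)" if "r < n" for r
  proof -
    have "annihilates n (monom 1 i div char_poly A * char_poly A) v"
      by (rule annihilates_mult[OF orb char_poly_annihilates[OF orb]])
    then have "lin (monom 1 i div char_poly A * char_poly A) (\<lambda>j. v j r) = 0"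
      using that by (simp add: annihilates_def)
    moreover have "lin (monom 1 i) (\<lambda>j. v j r) =
        lin (monom 1 i div char_poly A * char_poly A) (\<lambda>j. v j r) + lin ?p (\<lambda>j. v j r)"
      unfolding lin_add[symmetric] by (simp only: div_mult_mod_eq)
    ultimately have "v i r = lin ?p (\<lambda>j. v j r)" by simp
    also have "\<dots> = (\<Sum>j\<le>n - 1. coeff ?p j * v j r)" by (rule lin_alt) (use dp in simp)
    also have "{..n - 1} = {..<n}" using n by auto
    finally show ?thesis .
  qed
  have "\<exists>d q. d \<ge> 1 \<and> d \<le> int (solution_bound n ((n * H) ^ (n + 1))) \<and> (\<forall>j<n. \<bar>q j\<bar> \<le> int (solution_bound n ((n * H) ^ (n + 1)))) \<and>
    (\<forall>r\<in>{..<n}. (\<Sum>j<n. a r j * q j) = d * b r)"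
  proof (rule solve_bounded)
    show "(\<Sum>j<n. of_int (a r j) * coeff ?p j) = of_int (b r)" if "r \<in> {..<n}" for r
      using that a(1) b(1) vi by (simp add: sum_distrib_left mult_ac)
    show "1 \<le> (n * H) ^ (n + 1)" using nH by (rule one_le_power)
  qed (use a(2) b(2) in auto)
  then obtain d q where dq: "d \<ge> 1" "d \<le> int (coeff_bound n H)" "\<forall>j<n. \<bar>q j\<bar> \<le> int (coeff_bound n H)"
    "\<And>r. r < n \<Longrightarrow> (\<Sum>j<n. a r j * q j) = d * b r" unfolding coeff_bound_def by blast
  have "(\<Sum>j<n. of_int (q j) * v j r) = of_int d * v i r" if "r < n" for r
  proof -
    have "(of_int (\<Sum>j<n. a r j * q j) :: rat) = of_int (d * b r)" unfolding dq(4)[OF that] ..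
    then have "?D ^ (n + 1) * (\<Sum>j<n. of_int (q j) * v j r) = ?D ^ (n + 1) * (of_int d * v i r)"
      using a(1)[OF that] b(1)[OF that] by (simp add: sum_distrib_left mult_ac)
    then show ?thesis using D by simp
  qed
  with dq(1-3) show ?thesis by blast
qed


lemma norm_of_rat: "norm (of_rat q :: complex) = real_of_rat \<bar>q\<bar>"
  by (cases q) (simp add: of_rat_rat norm_divide)

lemma pow_eq_root_of_unity:
  fixes z :: complex
  assumes "z ^ k = z ^ l" "k < l" "z \<noteq> 0"
  shows "z ^ (l - k) = 1"
proof -
  have "z ^ l = z ^ k * z ^ (l - k)" using assms(2) by (simp flip: power_add)
  then show ?thesis using assms(1,3) by simp
qed

interpretation rat_poly: map_poly_inj_idom_hom "of_rat :: rat \<Rightarrow> complex" ..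

theorem rational_orbit_bound:
  fixes A :: "rat mat" and v :: "nat \<Rightarrow> nat \<Rightarrow> rat"
  assumes orb: "orbit n A v" and n: "n \<ge> 1" and D: "1 \<le> D" "D \<le> H"
    and A: "\<And>r c. r < n \<Longrightarrow> c < n \<Longrightarrow> scaled_int D H (A $$ (r, c))"
    and x: "\<And>r. r < n \<Longrightarrow> scaled_int D H (v 0 r)"
    and y: "\<And>r. r < n \<Longrightarrow> scaled_int D H (v i r)"
  shows "i \<le> rat_iter_bound n H \<or> (\<forall>r<n. v (n + common_order n) r = v n r)"
proof (rule ccontr)
  assume neg: "\<not> ?thesis"
  have Ac: "A \<in> carrier_mat n n" using orb by (simp add: orbit_def)
  let ?h = "of_rat :: rat \<Rightarrow> complex"
  let ?G = "coeff_bound n H"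
  obtain d q where d: "d \<ge> 1" "d \<le> int ?G" and q: "\<And>j. j < n \<Longrightarrow> \<bar>q j\<bar> \<le> int ?G"
    and rel: "\<And>r. r < n \<Longrightarrow> (\<Sum>j<n. of_int (q j) * v j r) = of_int d * v i r"
    using orbit_relation[OF assms] by blast
  note A = A[unfolded scaled_int_def]
  define Q where "Q = (\<Sum>j<n. monom (of_int (q j) / of_int d) j :: rat poly)"
  define P where "P = monom 1 i - Q"
  \<comment> \<open>The gcd is taken over the rationals, where it is monic and has a rational
    companion matrix. It annihilates the orbit because \<open>char_poly A\<close> and
    \<open>P\<close> do.\<close>
  define m where "m = gcd (char_poly A) P"
  define mc where "mc = map_poly ?h m"
  have annP: "annihilates n P v"
    unfolding annihilates_def P_def
  proof (intro allI impI)
    fix r assume r: "r < n"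
    have "lin Q (\<lambda>j. v j r) = (\<Sum>j<n. of_int (q j) * v j r) / of_int d"
      by (simp add: Q_def lin_sum sum_divide_distrib)
    also have "\<dots> = v i r" using rel[OF r] d(1) by simp
    finally show "lin (monom 1 i - Q) (\<lambda>j. v j r) = 0" by (simp add: lin_diff)
  qed
  obtain s t where "s * char_poly A + t * P = m"
    unfolding m_def using bezout_coefficients_fst_snd by metis
  then have annm: "annihilates n m v"
    using annihilates_add[OF annihilates_mult[OF orb char_poly_annihilates[OF orb]] annihilates_mult[OF orb annP]]
    by metis
  have chi: "degree (char_poly A) = n" "char_poly A \<noteq> 0" using degree_monic_char_poly[OF Ac] by auto
  then have m0: "m \<noteq> 0" by (simp add: m_def)
  have dm: "degree m \<le> n" using chi dvd_imp_degree_le[of m "char_poly A"] by (simp add: m_def)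
  have "normalize m = m" by (simp add: m_def)
  then have "lead_coeff m = lead_coeff m div unit_factor (lead_coeff m)"
    using coeff_normalize[of m "degree m"] by simp
  then have lm: "lead_coeff m = 1" using m0 by simp
  have mc0: "mc \<noteq> 0" using m0 by (simp add: mc_def)
  have dmc: "degree mc = degree m" by (simp add: mc_def)
  have chi_dvd: "mc dvd map_poly ?h (char_poly A)" and P_dvd: "mc dvd map_poly ?h P"
    unfolding mc_def m_def by (rule rat_poly.hom_dvd, simp)+
  have hchi: "map_poly ?h (char_poly A) = char_poly (map_mat ?h A)"
    by (rule of_rat_hom.char_poly_hom[OF Ac, symmetric])
  have hQ: "poly (map_poly ?h Q) z = (\<Sum>j<n. of_int (q j) * z ^ j) / of_int d" for z
    by (simp add: Q_def rat_poly.hom_sum hom_distribs poly_sum poly_monom sum_divide_distrib of_rat_divide)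
  have hP: "map_poly ?h P = monom 1 i - map_poly ?h Q" by (simp add: P_def hom_distribs)
  have root_chi: "poly (char_poly (map_mat ?h A)) z = 0" if "poly mc z = 0" for z
    using that chi_dvd unfolding hchi by (meson dvd_trans poly_eq_0_iff_dvd)
  have root_P: "of_int d * z ^ i = (\<Sum>j<n. of_int (q j) * z ^ j)" if "poly mc z = 0" for z
  proof -
    have "poly (map_poly ?h P) z = 0" using that P_dvd by (meson dvd_trans poly_eq_0_iff_dvd)
    then have "z ^ i = (\<Sum>j<n. of_int (q j) * z ^ j) / of_int d" by (simp add: hP hQ poly_monom)
    then show ?thesis using d(1) by (simp add: field_simps)
  qed
  have H: "H \<ge> 1" using D by simp
  have Ah: "map_mat ?h A \<in> carrier_mat n n" using Ac by simp
  have nrm: "norm z \<le> real (n * H)" if z: "poly mc z = 0" for z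
  proof -
    have "norm (map_mat ?h A $$ (r, c)) \<le> real H" if "r < n" "c < n" for r c
    proof -
      have "\<bar>A $$ (r, c)\<bar> \<le> \<bar>of_nat D * A $$ (r, c)\<bar>"
        using D mult_right_mono[of 1 "of_nat D :: rat" "\<bar>A $$ (r, c)\<bar>"] by (simp add: abs_mult)
      then have "\<bar>A $$ (r, c)\<bar> \<le> of_nat H" using A[OF that] by linarith
      then have "real_of_rat \<bar>A $$ (r, c)\<bar> \<le> real H"
        by (metis of_rat_less_eq of_rat_of_nat_eq)
      then show ?thesis using that Ac by (simp add: norm_of_rat)
    qed
    from root_norm_bound[OF Ah root_chi[OF z] this] show ?thesis by simp
  qed
  \<comment> \<open>The matrix \<open>D A\<close> has integer entries.\<close>
  have Dz: "algebraic_int (of_nat D * z)" if z: "poly mc z = 0" for z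
  proof -
    obtain w r0 where w: "\<And>r. r < n \<Longrightarrow> (\<Sum>c<n. map_mat ?h A $$ (r, c) * w c) = z * w r"
      and r0: "r0 < n" "w r0 \<noteq> 0"
      using root_eigen[OF Ah root_chi[OF z]] by blast
    have fl: "(of_int \<lfloor>of_nat D * A $$ (r, c)\<rfloor> :: complex) = of_nat D * map_mat ?h A $$ (r, c)"
      if rc: "r < n" "c < n" for r c
    proof -
      obtain e where e: "of_nat D * A $$ (r, c) = of_int e" using A[OF rc] by (auto elim: Ints_cases)
      then have "of_nat D * ?h (A $$ (r, c)) = of_int e"
        by (metis of_rat_mult of_rat_of_int_eq of_rat_of_nat_eq)
      then show ?thesis using rc Ac e by simp
    qed
    have "int_eigen n w (of_nat D * z)"
      unfolding int_eigen_def
    proof (intro exI allI impI)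
      fix r assume r: "r < n"
      have "(\<Sum>c<n. of_int \<lfloor>of_nat D * A $$ (r, c)\<rfloor> * w c) =
          of_nat D * (\<Sum>c<n. map_mat ?h A $$ (r, c) * w c)"
        unfolding sum_distrib_left by (intro sum.cong refl) (simp only: fl[OF r] lessThan_iff mult.assoc)
      then show "(\<Sum>c<n. of_int \<lfloor>of_nat D * A $$ (r, c)\<rfloor> * w c) = of_nat D * z * w r"
        using w[OF r] by (simp add: mult.assoc)
    qed
    then show ?thesis using r0 by (rule int_eigen_algebraic_int)
  qed
  \<comment> \<open>\<open>d\<close> clears the denominators of \<open>Q\<close>, and
    \<open>D^n\<close> those of the powers \<open>z^j\<close> with \<open>j < n\<close>.\<close>
  define c where "c = nat d * D ^ n"
  have c0: "c > 0" using d(1) D by (simp add: c_def)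
  have cz: "of_nat c * z ^ i = of_nat (D ^ n) * (\<Sum>j<n. of_int (q j) * z ^ j)" if "poly mc z = 0" for z
    using root_P[OF that] d(1) by (simp add: c_def mult_ac)
  have int_i: "algebraic_int (of_nat c * z ^ i)" if z: "poly mc z = 0" for z
  proof -
    have "of_nat c * z ^ i = (\<Sum>j<n. of_int (q j * int (D ^ (n - j))) * (of_nat D * z) ^ j)"
      unfolding cz[OF z] sum_distrib_left
    proof (intro sum.cong refl)
      fix j assume "j \<in> {..<n}"
      then have "D ^ n = D ^ (n - j) * D ^ j" by (simp flip: power_add)
      then show "of_nat (D ^ n) * (of_int (q j) * z ^ j) = of_int (q j * int (D ^ (n - j))) * (of_nat D * z) ^ j"
        by (simp add: power_mult_distrib)
    qed
    then show ?thesis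
      by (simp only:) (intro algebraic_int_sum algebraic_int_mult algebraic_int_of_int algebraic_int_power Dz[OF z])
  qed
  have int_k: "algebraic_int (of_nat c * z ^ k)" if z: "poly mc z = 0" and k: "k \<le> i" for z k
  proof (cases "i = 0")
    case True
    then show ?thesis using int_i[OF z] k by simp
  next
    case False
    \<comment> \<open>A number with an integral power is integral, so integrality passes from
      \<open>c z^i\<close> down to \<open>c z^k\<close>.\<close>
    have "(of_nat c * z ^ k) ^ i = of_int (int c) ^ (i - k) * (of_nat c * z ^ i) ^ k"
    proof -
      have "(of_nat c :: complex) ^ i = of_nat c ^ (i - k) * of_nat c ^ k" using k by (simp flip: power_add)
      then show ?thesis by (simp add: power_mult_distrib mult.commute flip: power_mult)
    qed
    then have "algebraic_int ((of_nat c * z ^ k) ^ i)"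
      by (simp only:) (intro algebraic_int_mult algebraic_int_power algebraic_int_of_int int_i[OF z])
    then show ?thesis by (rule algebraic_int_root_of_power) (use False in simp)
  qed
  have nH: "1 \<le> n * H" "D \<le> n * H" "n \<le> n * H"
    using n H D by (auto intro: order_trans[of D H])
  have "real 1 \<le> real (n * H)" unfolding of_nat_le_iff by (rule nH)
  then have nHr: "1 \<le> real (n * H)" by (simp only: of_nat_1)
  have cG: "real c \<le> real ?G * real (n * H) ^ n"
  proof -
    have "real c = real_of_int d * real D ^ n" using d(1) by (simp add: c_def)
    also have "\<dots> \<le> real ?G * real (n * H) ^ n"
    proof (intro mult_mono power_mono)
      show "real D \<le> real (n * H)" unfolding of_nat_le_iff by (rule nH)
    qed (use d in auto)
    finally show ?thesis .
  qed
  \<comment> \<open>For \<open>|z| <= 1\<close> the factor \<open>c\<close> is already a bound.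
    Otherwise the modulus grows with \<open>k\<close>, and at \<open>k = i\<close> the relation for
    \<open>z^i\<close> bounds it.\<close>
  have bound: "norm (of_nat c * z ^ k) \<le> real (conjugate_bound n H)" if z: "poly mc z = 0" and k: "k \<le> i" for z k
  proof (cases "norm z \<le> 1")
    case True
    have "norm (of_nat c * z ^ k) \<le> real c * 1"
      unfolding norm_mult norm_power using True by (intro mult_mono power_le_one) auto
    also have "\<dots> \<le> real ?G * real (n * H) ^ n" using cG by simp
    also have "\<dots> \<le> real ?G * real (n * H) ^ (2 * n + 1)"
      using nHr by (intro mult_left_mono power_increasing) auto
    finally show ?thesis by (simp add: conjugate_bound_def)
  next
    case False
    have "norm (of_nat c * z ^ k) \<le> norm (of_nat c * z ^ i)"
      unfolding norm_mult norm_power using False k by (intro mult_left_mono power_increasing) auto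
    also have "\<dots> \<le> real (D ^ n) * (\<Sum>j<n. real ?G * real (n * H) ^ n)"
      unfolding cz[OF z] norm_mult norm_of_nat
    proof (intro mult_left_mono order_trans[OF norm_sum] sum_mono)
      fix j assume j: "j \<in> {..<n}"
      have "norm (of_int (q j) * z ^ j) = \<bar>real_of_int (q j)\<bar> * norm z ^ j" by (simp add: norm_mult norm_power)
      also have "\<dots> \<le> real ?G * real (n * H) ^ n"
      proof (intro mult_mono)
        have "\<bar>q j\<bar> \<le> int ?G" using q j by simp
        then show "\<bar>real_of_int (q j)\<bar> \<le> real ?G" by linarith
        have "norm z ^ j \<le> real (n * H) ^ j" using nrm[OF z] by (intro power_mono) auto
        also have "\<dots> \<le> real (n * H) ^ n" using nHr j by (intro power_increasing) auto
        finally show "norm z ^ j \<le> real (n * H) ^ n" .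
      qed auto
      finally show "norm (of_int (q j) * z ^ j) \<le> real ?G * real (n * H) ^ n" .
    qed auto
    also have "\<dots> = real ?G * (real (D ^ n) * real (n * H) ^ n * real n)" by simp
    also have "\<dots> \<le> real ?G * (real (n * H) ^ n * real (n * H) ^ n * real (n * H))"
    proof (intro mult_mono mult_left_mono)
      show "real (D ^ n) \<le> real (n * H) ^ n"
        unfolding of_nat_power[symmetric] of_nat_le_iff by (rule power_mono) (use nH in auto)
      show "real n \<le> real (n * H)" unfolding of_nat_le_iff by (rule nH)
    qed auto
    also have "\<dots> = real (conjugate_bound n H)"
      by (simp only: conjugate_bound_def of_nat_mult of_nat_power mult_2 power_add power_one_right)
    finally show ?thesis .
  qed
  have big: "root_count n (conjugate_bound n H) \<le> i" "n * n * ?G < i" using neg by (auto simp: rat_iter_bound_def)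
  have unity: "\<exists>p\<ge>1. z ^ p = 1" if z: "poly mc z = 0" "z \<noteq> 0" for z
  proof -
    obtain k l where "k < l" "z ^ k = z ^ l"
      using kronecker_pigeonhole[of m n c i "conjugate_bound n H" z] lm dm c0 int_k bound big(1) z(1)
      unfolding mc_def by blast
    then show ?thesis using pow_eq_root_of_unity[of z k l] z(2) by (intro exI[of _ "l - k"]) auto
  qed
  have norm1: "norm z = 1" if z: "poly mc z = 0" "z \<noteq> 0" for z
  proof -
    obtain p where p: "p \<ge> 1" "z ^ p = 1" using unity[OF z] by blast
    have "norm z ^ p = 1" using p(2) by (metis norm_one norm_power)
    then show ?thesis using p(1) power_eq_iff_eq_base[of p "norm z" 1] by simp
  qed
  \<comment> \<open>All roots are now 0 or roots of unity, so the argument repeats with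
    \<open>c = 1\<close> and \<open>R = 1\<close>; the bound on the order thereby loses its
    dependence on \<open>H\<close>.\<close>
  have per: "z ^ common_order n = 1" if z: "poly mc z = 0" "z \<noteq> 0" for z
  proof -
    have "\<exists>k l. k < l \<and> l \<le> root_count n 1 \<and> z ^ k = z ^ l"
    proof (rule kronecker_pigeonhole[of m n 1 "root_count n 1" 1 z])
      fix y k assume "poly (map_poly ?h m) y = 0"
      then have y: "poly mc y = 0" by (simp add: mc_def)
      have "algebraic_int y"
      proof (cases "y = 0")
        case False
        then obtain p where p: "p \<ge> 1" "y ^ p = 1" using unity[OF y] by blast
        show ?thesis by (rule algebraic_int_root_of_power[of y p]) (use p in auto)
      qed simp
      then show "algebraic_int (of_nat 1 * y ^ k)" using algebraic_int_power by simp
      have "norm y \<le> 1" using norm1[OF y] by (cases "y = 0") auto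
      then show "norm (of_nat 1 * y ^ k) \<le> real 1" by (simp add: norm_power power_le_one)
    qed (use lm dm z(1) in \<open>auto simp: mc_def\<close>)
    then obtain k l where kl: "k < l" "l \<le> root_count n 1" "z ^ k = z ^ l" by blast
    have "z ^ (l - k) = 1" using pow_eq_root_of_unity[OF kl(3,1) z(2)] .
    moreover have "l - k dvd common_order n" unfolding common_order_def using kl by (intro dvd_fact) auto
    ultimately show ?thesis by (metis dvdE power_mult power_one)
  qed
  \<comment> \<open>At a multiple root the derivative of \<open>P\<close> vanishes too, so
    \<open>i z^(i-1) = Q'(z)\<close>. As \<open>|z| = 1\<close>, this forces
    \<open>i <= n * n * G\<close> with \<open>G = coeff_bound n H\<close>.\<close>
  have simple: "poly (pderiv mc) z \<noteq> 0" if z: "poly mc z = 0" "z \<noteq> 0" for z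
  proof
    assume pd: "poly (pderiv mc) z = 0"
    obtain g where g: "map_poly ?h P = mc * g" using P_dvd by blast
    have "poly (pderiv (map_poly ?h P)) z = 0" unfolding g pderiv_mult using pd z(1) by simp
    then have e: "of_nat i * z ^ (i - 1) = poly (pderiv (map_poly ?h Q)) z"
      by (simp add: hP pderiv_diff pderiv_monom poly_monom)
    have mQ: "map_poly ?h Q = (\<Sum>j<n. monom (of_int (q j) / of_int d) j)"
      by (simp add: Q_def rat_poly.hom_sum hom_distribs of_rat_divide)
    have "poly (pderiv (map_poly ?h Q)) z = (\<Sum>j<n. of_nat j * (of_int (q j) / of_int d) * z ^ (j - 1))"
      unfolding mQ by (simp add: pderiv_sum pderiv_monom poly_sum poly_monom)
    then have "real i = norm (\<Sum>j<n. of_nat j * (of_int (q j) / of_int d) * z ^ (j - 1) :: complex)"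
      using arg_cong[OF e, of norm] norm1[OF z] by (simp add: norm_mult norm_power)
    also have "\<dots> \<le> (\<Sum>j<n. real n * real ?G)"
    proof (rule order_trans[OF norm_sum], rule sum_mono)
      fix j assume j: "j \<in> {..<n}"
      have "\<bar>q j\<bar> \<le> int ?G" using q j by simp
      then have "\<bar>real_of_int (q j)\<bar> \<le> real ?G" by linarith
      moreover have "\<bar>real_of_int (q j)\<bar> / real_of_int d \<le> \<bar>real_of_int (q j)\<bar> / 1"
        using d(1) by (intro divide_left_mono) auto
      ultimately have "\<bar>real_of_int (q j)\<bar> / real_of_int d \<le> real ?G" by linarith
      then have "real j * (\<bar>real_of_int (q j)\<bar> / real_of_int d) \<le> real n * real ?G"
        using j d(1) by (intro mult_mono) auto
      then show "norm (of_nat j * (of_int (q j) / of_int d) * z ^ (j - 1)) \<le> real n * real ?G"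
        using d(1) norm1[OF z] by (simp add: norm_mult norm_power norm_divide)
    qed
    also have "\<dots> = real (n * n * ?G)" by simp
    finally show False using big(2) by (simp only: of_nat_le_iff)
  qed
  let ?N = "common_order n"
  \<comment> \<open>The factor \<open>t^n\<close> absorbs the root 0, whose multiplicity is at most
    \<open>n\<close>; the nonzero roots are simple and satisfy \<open>t^N = 1\<close>.\<close>
  let ?T = "monom 1 n * (monom 1 ?N - 1) :: complex poly"
  have N: "?N \<ge> 1" unfolding common_order_def by (rule fact_ge_1)
  have T0: "monom 1 ?N - 1 \<noteq> (0 :: complex poly)"
  proof
    assume "monom 1 ?N - 1 = (0 :: complex poly)"
    then have "degree (monom 1 ?N :: complex poly) = degree (1 :: complex poly)" by simp
    then show False using N by (simp add: degree_monom_eq)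
  qed
  then have T0': "?T \<noteq> 0" by simp
  have "mc dvd ?T"
  proof (rule dvd_if_orders_le[OF T0' _ mc0])
    fix z assume z: "poly mc z = 0"
    show "order z mc \<le> order z ?T"
    proof (cases "z = 0")
      case True
      have "order z mc \<le> degree mc" using mc0 by (rule order_degree)
      also have "\<dots> \<le> n" using dm dmc by simp
      also have "n \<le> order 0 ?T" using monom_1_dvd_iff[OF T0', of n] by simp
      finally show ?thesis using True by simp
    next
      case False
      have "order z mc \<le> 1"
      proof (rule ccontr)
        assume "\<not> ?thesis"
        then have "[:-z, 1:] ^ 2 dvd mc" by (subst order_divides) simp
        then have "[:-z, 1:] * [:-z, 1:] dvd mc" by (simp only: power2_eq_square)
        then obtain g where "mc = [:-z, 1:] * [:-z, 1:] * g" by (rule dvdE)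
        then have g: "mc = [:-z, 1:] * ([:-z, 1:] * g)" by (simp only: mult.assoc)
        have "poly (pderiv mc) z = 0"
          unfolding g pderiv_mult[of "[:-z, 1:]"] poly_add poly_mult by simp
        then show False using simple[OF z False] by simp
      qed
      moreover have "poly ?T z = 0" using per[OF z False] by (simp add: poly_monom)
      then have "order z ?T \<noteq> 0" using T0' order_root by blast
      ultimately show ?thesis by simp
    qed
  qed
  moreover have "?T = map_poly ?h (monom 1 n * (monom 1 ?N - 1))" by (simp add: hom_distribs)
  ultimately have "map_poly ?h m dvd map_poly ?h (monom 1 n * (monom 1 ?N - 1))" by (simp add: mc_def)
  \<comment> \<open>Divisibility descends from the complex numbers to the rationals.\<close>
  then have "m dvd monom 1 n * (monom 1 ?N - 1)" by (rule of_rat_hom.dvd_map_poly_hom_imp_dvd)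
  then obtain g where "monom 1 n * (monom 1 ?N - 1) = g * m" by (metis dvdE mult.commute)
  then have "annihilates n (monom 1 n * (monom 1 ?N - 1)) v"
    using annihilates_mult[OF orb annm] by metis
  moreover have "monom 1 n * (monom 1 ?N - 1) = monom 1 (n + ?N) - (monom 1 n :: rat poly)"
    by (simp add: right_diff_distrib mult_monom)
  ultimately have "\<forall>r<n. v (n + ?N) r = v n r" by (simp add: annihilates_def lin_diff)
  then show False using neg by simp
qed

section \<open>Iteration with uncancelled fractions\<close>

text \<open>A fraction is a pair (numerator, denominator); no division and no cancellation takes place, so
  the operations make sense over any ring and commute with ring homomorphisms.\<close>

definition padd :: "'a::comm_ring_1 \<times> 'a \<Rightarrow> 'a \<times> 'a \<Rightarrow> 'a \<times> 'a" where
  "padd p q = (fst p * snd q + fst q * snd p, snd p * snd q)"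

definition pmul :: "'a::comm_ring_1 \<times> 'a \<Rightarrow> 'a \<times> 'a \<Rightarrow> 'a \<times> 'a" where
  "pmul p q = (fst p * fst q, snd p * snd q)"

text \<open>The numerator of the difference of two fractions, so that equality becomes a zero test
  without division.\<close>

definition cross :: "'a::comm_ring_1 \<times> 'a \<Rightarrow> 'a \<times> 'a \<Rightarrow> 'a" where
  "cross p q = fst p * snd q - fst q * snd p"

primrec psum :: "(nat \<Rightarrow> 'a::comm_ring_1 \<times> 'a) \<Rightarrow> nat \<Rightarrow> 'a \<times> 'a" where
  "psum f 0 = (0, 1)"
| "psum f (Suc j) = padd (psum f j) (f j)"

primrec pvec :: "nat \<Rightarrow> (nat \<Rightarrow> nat \<Rightarrow> 'a::comm_ring_1 \<times> 'a) \<Rightarrow> (nat \<Rightarrow> 'a \<times> 'a) \<Rightarrow> nat \<Rightarrow> nat \<Rightarrow> 'a \<times> 'a" where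
  "pvec n a x 0 r = x r"
| "pvec n a x (Suc k) r = psum (\<lambda>c. pmul (a r c) (pvec n a x k c)) n"

lemma psum_cong: "(\<And>c. c < m \<Longrightarrow> f c = g c) \<Longrightarrow> psum f m = psum g m"
  by (induction m) simp_all

definition pval :: "'a::field \<times> 'a \<Rightarrow> 'a" where
  "pval p = fst p / snd p"

lemma cross_eq_0_iff: "snd p \<noteq> 0 \<Longrightarrow> snd q \<noteq> 0 \<Longrightarrow> cross p q = 0 \<longleftrightarrow> pval p = pval q"
  by (simp add: cross_def pval_def frac_eq_eq)

lemma psum_field:
  assumes "\<And>c. c < n \<Longrightarrow> snd (f c) \<noteq> (0 :: 'a::field)"
  shows "snd (psum f n) \<noteq> 0 \<and> pval (psum f n) = (\<Sum>c<n. pval (f c))"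
  using assms
proof (induction n)
  case (Suc n)
  then have "snd (psum f n) \<noteq> 0" "snd (f n) \<noteq> 0" by auto
  then have "pval (padd (psum f n) (f n)) = pval (psum f n) + pval (f n)"
    by (simp add: pval_def padd_def add_frac_eq)
  then show ?case using Suc by (simp add: padd_def)
qed (simp add: pval_def)

lemma pval_pmul: "pval (pmul p q) = pval p * pval q"
  by (simp add: pval_def pmul_def)

lemma pvec_field:
  fixes a :: "nat \<Rightarrow> nat \<Rightarrow> 'a::field \<times> 'a"
  assumes "\<And>r c. r < n \<Longrightarrow> c < n \<Longrightarrow> snd (a r c) \<noteq> 0" "\<And>r. r < n \<Longrightarrow> snd (x r) \<noteq> 0"
  shows "r < n \<Longrightarrow> snd (pvec n a x k r) \<noteq> 0"
    and "orbit n (mat n n (\<lambda>(r, c). pval (a r c))) (\<lambda>k r. pval (pvec n a x k r))"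
proof -
  have nz: "snd (pvec n a x k r) \<noteq> 0" if "r < n" for k r
    using that
  proof (induction k arbitrary: r)
    case (Suc k)
    have "snd (psum (\<lambda>c. pmul (a r c) (pvec n a x k c)) n) \<noteq> 0"
      by (rule conjunct1[OF psum_field]) (use Suc assms in \<open>simp add: pmul_def\<close>)
    then show ?case by simp
  qed (use assms in simp)
  then show "r < n \<Longrightarrow> snd (pvec n a x k r) \<noteq> 0" .
  show "orbit n (mat n n (\<lambda>(r, c). pval (a r c))) (\<lambda>k r. pval (pvec n a x k r))"
    unfolding orbit_def
  proof (intro conjI allI impI)
    fix k r assume r: "r < n"
    have "pval (psum (\<lambda>c. pmul (a r c) (pvec n a x k c)) n) = (\<Sum>c<n. pval (pmul (a r c) (pvec n a x k c)))"
      by (rule conjunct2[OF psum_field]) (use nz r assms in \<open>simp add: pmul_def\<close>)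
    then show "pval (pvec n a x (Suc k) r) =
        (\<Sum>c<n. mat n n (\<lambda>(r, c). pval (a r c)) $$ (r, c) * pval (pvec n a x k c))"
      using r by (simp add: pval_pmul)
  qed simp
qed

lemma pvec_hom:
  assumes h: "h 0 = 0" "h 1 = 1" "\<And>x y. h (x + y) = h x + h y" "\<And>x y. h (x * y) = h x * h y"
  shows "map_prod h h (pvec n a x k r) = pvec n (\<lambda>r c. map_prod h h (a r c)) (\<lambda>r. map_prod h h (x r)) k r"
proof -
  have s: "map_prod h h (psum f m) = psum (\<lambda>c. map_prod h h (f c)) m" for f m
    by (induction m) (simp_all add: padd_def h prod_eq_iff)
  have p: "map_prod h h (pmul p q) = pmul (map_prod h h p) (map_prod h h q)" for p q
    by (simp add: pmul_def h)
  show ?thesis by (induction k arbitrary: r) (simp_all add: s p)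
qed

lemma orbit_unique:
  assumes "orbit n A v" "orbit n A w" "\<And>r. r < n \<Longrightarrow> v 0 r = w 0 r" "r < n"
  shows "v k r = w k r"
  using assms(4)
proof (induction k arbitrary: r)
  case (Suc k)
  then show ?case using assms(1,2) by (simp add: orbit_def)
qed (use assms(3) in simp)

lemma orbit_periodic:
  assumes orb: "orbit n A v" and per: "\<And>r. r < n \<Longrightarrow> v (m + p) r = v m r" and r: "r < n"
  shows "v (m + k) r = v (m + k mod p) r"
proof -
  have shift: "v (m + p + j) r = v (m + j) r" if "r < n" for j r
    using that
  proof (induction j arbitrary: r)
    case (Suc j)
    then show ?case using orb by (simp add: orbit_def)
  qed (use per in simp)
  have "v (m + (j * p + l)) r = v (m + l) r" for j l
  proof (induction j)
    case (Suc j)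
    have "v (m + (Suc j * p + l)) r = v (m + p + (j * p + l)) r" by (simp add: algebra_simps)
    then show ?case using shift[OF r] Suc by simp
  qed simp
  from this[of "k div p" "k mod p"] show ?thesis by (simp add: mult.commute)
qed

section \<open>Degrees along the iteration\<close>

definition pdegs_le :: "nat \<Rightarrow> nat set \<Rightarrow> mpoly \<times> mpoly \<Rightarrow> bool" where
  "pdegs_le d X p \<longleftrightarrow> degs_le d (fst p) \<and> degs_le d (snd p) \<and> vars (fst p) \<subseteq> X \<and> vars (snd p) \<subseteq> X"

lemma pdegs_le_mono: "pdegs_le d X p \<Longrightarrow> d \<le> e \<Longrightarrow> pdegs_le e X p"
  unfolding pdegs_le_def using degs_le_mono by blast

lemma degs_le_0 [simp]: "degs_le d 0" "degs_le d 1"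
  by (auto simp: degs_le_def tdeg_def)

lemma vars_0 [simp]: "vars 0 = {}" "vars 1 = {}"
  by (auto simp: vars_def)

lemma pdegs_le_pmul: "pdegs_le d X p \<Longrightarrow> pdegs_le e X q \<Longrightarrow> pdegs_le (d + e) X (pmul p q)"
  unfolding pdegs_le_def pmul_def fst_conv snd_conv
  by (intro conjI degs_le_mult order_trans[OF vars_mult] Un_least) simp_all

lemma pdegs_le_padd:
  assumes "pdegs_le d X p" "pdegs_le e X q"
  shows "pdegs_le (d + e) X (padd p q)"
  unfolding pdegs_le_def padd_def fst_conv snd_conv
proof (intro conjI)
  show "degs_le (d + e) (fst p * snd q + fst q * snd p)"
    using assms degs_le_mult[of d "fst p" e "snd q"] degs_le_mult[of e "fst q" d "snd p"]
    by (intro degs_le_add) (auto simp: pdegs_le_def add.commute)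
  show "degs_le (d + e) (snd p * snd q)" using assms by (intro degs_le_mult) (auto simp: pdegs_le_def)
  have "vars (fst p * snd q) \<subseteq> X" "vars (fst q * snd p) \<subseteq> X" and *: "vars (snd p * snd q) \<subseteq> X"
    using assms vars_mult unfolding pdegs_le_def by blast+
  then show "vars (fst p * snd q + fst q * snd p) \<subseteq> X" using vars_add by blast
  show "vars (snd p * snd q) \<subseteq> X" by (rule *)
qed

lemma pdegs_le_cross:
  assumes "pdegs_le d X p" "pdegs_le e X q"
  shows "degs_le (d + e) (cross p q) \<and> vars (cross p q) \<subseteq> X"
proof
  show "degs_le (d + e) (cross p q)" unfolding cross_def
    using assms degs_le_mult[of d "fst p" e "snd q"] degs_le_mult[of e "fst q" d "snd p"]
    by (intro degs_le_diff) (auto simp: pdegs_le_def add.commute)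
  have "vars (fst p * snd q) \<subseteq> X" "vars (fst q * snd p) \<subseteq> X"
    using assms vars_mult unfolding pdegs_le_def by blast+
  then show "vars (cross p q) \<subseteq> X" unfolding cross_def using vars_diff by blast
qed

lemma pdegs_le_psum:
  assumes "\<And>c. c < n \<Longrightarrow> pdegs_le d X (f c)"
  shows "pdegs_le (n * d) X (psum f n)"
  using assms
proof (induction n)
  case 0
  then show ?case by (simp add: pdegs_le_def)
next
  case (Suc n)
  then have "pdegs_le (n * d + d) X (psum f (Suc n))" unfolding psum.simps by (intro pdegs_le_padd) auto
  then show ?case by (simp add: add.commute)
qed

text \<open>Uncancelled sums and products only add degrees, so one step takes \<open>d >= 1\<close>
  to at most \<open>n (N + d) <= (N + 1)^2 d\<close>.\<close>

definition deg_bound :: "nat \<Rightarrow> nat \<Rightarrow> nat" where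
  "deg_bound N k = (N + 1) ^ (2 * k + 2)"

lemma pdegs_le_pvec:
  assumes "\<And>r c. r < n \<Longrightarrow> c < n \<Longrightarrow> pdegs_le N X (a r c)" "\<And>r. r < n \<Longrightarrow> pdegs_le N X (x r)" "n \<le> N"
  shows "r < n \<Longrightarrow> pdegs_le (deg_bound N k) X (pvec n a x k r)"
proof (induction k arbitrary: r)
  case 0
  have "N \<le> deg_bound N 0" by (simp add: deg_bound_def)
  then show ?case using assms(2)[OF 0] pdegs_le_mono by simp
next
  case (Suc k)
  have "pdegs_le (n * (N + deg_bound N k)) X (pvec n a x (Suc k) r)"
    unfolding pvec.simps using Suc assms(1) by (intro pdegs_le_psum pdegs_le_pmul) auto
  moreover have "n * (N + deg_bound N k) \<le> deg_bound N (Suc k)"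
  proof -
    have "1 \<le> deg_bound N k" unfolding deg_bound_def by (rule one_le_power) simp
    then have "N + deg_bound N k \<le> (N + 1) * deg_bound N k" by simp
    then have "n * (N + deg_bound N k) \<le> (N + 1) * ((N + 1) * deg_bound N k)"
      using assms(3) by (intro mult_mono) auto
    then show ?thesis by (simp add: deg_bound_def mult.assoc)
  qed
  ultimately show ?case by (rule pdegs_le_mono)
qed

section \<open>Evaluation of codes at integer points\<close>

definition mwt :: "nat \<Rightarrow> monom_code \<Rightarrow> nat" where
  "mwt K m = (\<Sum>(v, e)\<leftarrow>m. K ^ v * e)"

definition ieval :: "nat \<Rightarrow> nat \<Rightarrow> poly_code \<Rightarrow> int" where
  "ieval s K p = (\<Sum>(a, m)\<leftarrow>p. a * int (s ^ mwt K m))"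

lemma wt_monom_val: "wt K (monom_val m) = mwt K m"
  by (induction m) (auto simp: monom_val_def mwt_def wt_add)

text \<open>Evaluation at the integer point with coordinates \<open>s^(K^v)\<close>. It is a ring
  homomorphism and hence commutes with the iteration of fractions.\<close>

definition kev :: "nat \<Rightarrow> nat \<Rightarrow> mpoly \<Rightarrow> rat" where
  "kev s K p = poly (kron K p) (of_nat s)"

lemma kev_poly_val: "kev s K (poly_val p) = of_int (ieval s K p)"
  by (induction p) (auto simp: kev_def poly_val_def ieval_def kron_add kron_single poly_monom wt_monom_val)

lemma tdeg_monom_val: "tdeg (monom_val m) = sum_list (map snd m)"
  unfolding tdeg_def wt_monom_val mwt_def by (simp add: case_prod_unfold)

text \<open>The reason is \<open>w <= triangle w\<close>. This inequality and its companions for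
  single entries let the number coding an instance serve as a bound for all degrees, indices and
  coefficients in it.\<close>

lemma sum_list_le_list_encode: "sum_list xs \<le> list_encode xs"
proof (induction xs)
  case (Cons x xs)
  have "x + list_encode xs \<le> triangle (x + list_encode xs)"
    by (rule strict_mono_imp_increasing[OF strict_mono_triangle])
  then show ?case using Cons by (simp add: prod_encode_def)
qed simp

lemma sum_list_map_le_list_encode:
  assumes "\<And>x. x \<in> set xs \<Longrightarrow> f x \<le> g x"
  shows "sum_list (map f xs) \<le> list_encode (map g xs)"
  by (rule order_trans[OF sum_list_mono[OF assms] sum_list_le_list_encode])

lemma monom_encode_le_poly_encode: "(a, m) \<in> set p \<Longrightarrow> monom_encode m \<le> poly_encode p"
proof -
  assume "(a, m) \<in> set p"
  then have "prod_encode (int_encode a, monom_encode m) < poly_encode p"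
    unfolding poly_encode_def by (intro mem_le_list_encode) force
  then show ?thesis using le_pr(2)[of "monom_encode m" "int_encode a"] by linarith
qed

lemma degs_le_poly_val: "degs_le (poly_encode p) (poly_val p)"
  unfolding degs_le_def
proof
  fix k assume "k \<in> Poly_Mapping.keys (poly_val p)"
  then have "k \<in> monom_val ` snd ` set p"
    unfolding poly_val_def
    using keys_sum_list[of "map (\<lambda>(a, m). Poly_Mapping.single (monom_val m) (of_int a)) p"]
    by (fastforce simp: case_prod_unfold split: if_splits)
  then obtain a m where am: "(a, m) \<in> set p" "k = monom_val m" by force
  have "tdeg k \<le> monom_encode m"
    unfolding am(2) tdeg_monom_val monom_encode_def
    by (rule sum_list_map_le_list_encode) (use le_pr in auto)
  also have "\<dots> \<le> poly_encode p" using am(1) by (rule monom_encode_le_poly_encode)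
  finally show "tdeg k \<le> poly_encode p" .
qed

lemma poly_code_vars_le: "poly_code_vars p \<subseteq> {..<Suc (poly_encode p)}"
proof
  fix v assume "v \<in> poly_code_vars p"
  then obtain a m e where am: "(a, m) \<in> set p" "(v, e) \<in> set m" unfolding poly_code_vars_def by force
  have "v \<le> prod_encode (v, e)" by (rule le_pr)
  also have "\<dots> \<le> monom_encode m"
    unfolding monom_encode_def using am(2) by (intro less_imp_le mem_le_list_encode) force
  also have "\<dots> \<le> poly_encode p" using am(1) by (rule monom_encode_le_poly_encode)
  finally show "v \<in> {..<Suc (poly_encode p)}" by simp
qed

lemma abs_le_int_encode: "nat \<bar>a\<bar> \<le> int_encode a"
  by (auto simp: int_encode_def sum_encode_def)

lemma mwt_le:
  assumes "K \<ge> 1"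
  shows "mwt K m \<le> K ^ monom_encode m * monom_encode m"
proof -
  have "mwt K m \<le> (\<Sum>(v, e)\<leftarrow>m. K ^ monom_encode m * e)"
    unfolding mwt_def case_prod_unfold
  proof (rule sum_list_mono)
    fix u assume u: "u \<in> set m"
    have "fst u \<le> prod_encode u" using le_pr(1)[of "fst u" "snd u"] by simp
    also have "\<dots> \<le> monom_encode m"
      unfolding monom_encode_def using u by (intro less_imp_le mem_le_list_encode) auto
    finally show "K ^ fst u * snd u \<le> K ^ monom_encode m * snd u"
      using assms by (intro mult_right_mono power_increasing) auto
  qed
  also have "\<dots> = K ^ monom_encode m * sum_list (map snd m)"
    by (simp add: case_prod_unfold sum_list_const_mult)
  also have "\<dots> \<le> K ^ monom_encode m * monom_encode m"
    unfolding monom_encode_def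
    by (intro mult_left_mono sum_list_map_le_list_encode) (use le_pr in auto)
  finally show ?thesis .
qed

text \<open>\<open>T\<close> exceeds \<open>s\<close> so that \<open>T >= 1\<close>; powers of
  \<open>T\<close> then grow with the exponent even if \<open>s = 0\<close>.\<close>

lemma abs_ieval_le:
  assumes K: "K \<ge> 1" and N: "poly_encode p \<le> N" and s: "s + 1 \<le> T"
  shows "\<bar>ieval s K p\<bar> \<le> int (N * T ^ (K ^ N * N))"
proof -
  have le: "s ^ mwt K m \<le> T ^ (K ^ N * N)" if am: "(a, m) \<in> set p" for a m
  proof -
    have m: "monom_encode m \<le> N" using monom_encode_le_poly_encode[OF am] N by simp
    have "mwt K m \<le> K ^ monom_encode m * monom_encode m" by (rule mwt_le[OF K])
    also have "\<dots> \<le> K ^ N * N" using m K by (intro mult_mono power_increasing) auto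
    finally have w: "mwt K m \<le> K ^ N * N" .
    have "s ^ mwt K m \<le> T ^ mwt K m" using s by (intro power_mono) auto
    also have "\<dots> \<le> T ^ (K ^ N * N)" using w s by (intro power_increasing) auto
    finally show ?thesis .
  qed
  have "\<bar>ieval s K p\<bar> \<le> (\<Sum>u\<leftarrow>p. \<bar>fst u * int (s ^ mwt K (snd u))\<bar>)"
    unfolding ieval_def case_prod_unfold by (rule sum_list_abs[of "map _ p", unfolded map_map o_def])
  also have "\<dots> \<le> (\<Sum>u\<leftarrow>p. int (nat \<bar>fst u\<bar>) * int (T ^ (K ^ N * N)))"
  proof (rule sum_list_mono)
    fix u assume "u \<in> set p"
    then have "int (s ^ mwt K (snd u)) \<le> int (T ^ (K ^ N * N))"
      unfolding of_nat_le_iff by (intro le[of "fst u"]) simp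
    then show "\<bar>fst u * int (s ^ mwt K (snd u))\<bar> \<le> int (nat \<bar>fst u\<bar>) * int (T ^ (K ^ N * N))"
      unfolding abs_mult by (intro mult_mono) auto
  qed
  also have "\<dots> = int (sum_list (map (\<lambda>u. nat \<bar>fst u\<bar>) p) * T ^ (K ^ N * N))"
    by (induction p) (auto simp: algebra_simps)
  also have "\<dots> \<le> int (N * T ^ (K ^ N * N))"
  proof -
    have "sum_list (map (\<lambda>u. nat \<bar>fst u\<bar>) p) \<le> poly_encode p"
      unfolding poly_encode_def case_prod_unfold
      by (rule sum_list_map_le_list_encode) (rule order_trans[OF abs_le_int_encode le_pr(1)])
    then show ?thesis using N unfolding of_nat_le_iff by (intro mult_right_mono) auto
  qed
  finally show ?thesis .
qed

section \<open>Specialisation of instances\<close>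

definition ratfun_of :: "ratfun_code \<Rightarrow> ratfun" where
  "ratfun_of e = Fraction_Field.Fract (poly_val (fst e)) (poly_val (snd e))"

definition ok_code :: "nat set \<Rightarrow> ratfun_code \<Rightarrow> bool" where
  "ok_code X e \<longleftrightarrow> poly_code_vars (fst e) \<subseteq> X \<and> poly_code_vars (snd e) \<subseteq> X \<and> poly_val (snd e) \<noteq> 0"

lemma encodes_ratfun_iff: "encodes_ratfun X e f \<longleftrightarrow> ok_code X e \<and> f = ratfun_of e"
  by (cases e) (auto simp: ok_code_def ratfun_of_def)

abbreviation num_den :: "ratfun_code \<Rightarrow> mpoly \<times> mpoly" where
  "num_den e \<equiv> (poly_val (fst e), poly_val (snd e))"

definition emb :: "mpoly \<Rightarrow> ratfun" where
  "emb p = Fraction_Field.Fract p 1"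

lemma emb_hom: "emb 0 = 0" "emb 1 = 1" "emb (p + q) = emb p + emb q" "emb (p * q) = emb p * emb q"
  by (simp_all add: emb_def Zero_fract_def One_fract_def)

lemma emb_eq_0: "emb p = 0 \<longleftrightarrow> p = 0"
  by (simp add: emb_def Zero_fract_def eq_fract)

lemma emb_diff: "emb (p - q) = emb p - emb q"
  by (simp add: emb_def)

lemma kev_hom: "kev s K 0 = 0" "kev s K 1 = 1" "kev s K (p + q) = kev s K p + kev s K q"
  "kev s K (p * q) = kev s K p * kev s K q"
  by (simp_all add: kev_def kron_add kron_mult)

lemma kev_diff: "kev s K (p - q) = kev s K p - kev s K q"
  by (simp add: kev_def kron.hom_minus)

lemma kev_prod: "kev s K (prod f A) = (\<Prod>e\<in>A. kev s K (f e))"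
  by (induction A rule: infinite_finite_induct) (simp_all add: kev_hom)

lemma degs_le_prod:
  assumes "finite A" "\<And>e. e \<in> A \<Longrightarrow> degs_le d (f e) \<and> vars (f e) \<subseteq> X"
  shows "degs_le (card A * d) (prod f A) \<and> vars (prod f A) \<subseteq> X"
  using assms
proof (induction A)
  case (insert e A)
  then have "degs_le (d + card A * d) (f e * prod f A)" by (intro degs_le_mult) auto
  moreover have "vars (f e * prod f A) \<subseteq> X"
    using insert by (intro order_trans[OF vars_mult] Un_least) auto
  ultimately show ?case using insert.hyps by simp
qed simp

lemma poly_encode_le_ratfun_encode: "poly_encode (fst e) \<le> ratfun_encode e" "poly_encode (snd e) \<le> ratfun_encode e"
  by (cases e; simp add: le_pr)+

text \<open>Exceeds the degree of the polynomial that must not vanish at the evaluation point: two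
  iterates are compared, and each of the at most \<open>n * n + 2 * n\<close> entries contributes a
  denominator of degree at most \<open>N\<close>.\<close>

definition point_base :: "nat \<Rightarrow> nat \<Rightarrow> nat" where
  "point_base N n = 2 * deg_bound N (n + common_order n) + (n * n + 2 * n) * N + 1"

text \<open>The estimate of \<open>abs_ieval_le\<close> for \<open>s < K^(N + 1)\<close> with
  \<open>K = point_base N n\<close>; the exponent \<open>N + 1\<close> counts the indeterminates of
  index at most \<open>N\<close>.\<close>

definition value_bound :: "nat \<Rightarrow> nat \<Rightarrow> nat" where
  "value_bound N n = N * (point_base N n ^ (N + 1)) ^ (point_base N n ^ N * N)"

text \<open>A product of at most \<open>n * n + 2 * n\<close> denominators times one numerator, each
  bounded by \<open>value_bound N n\<close>.\<close>

definition height_bound :: "nat \<Rightarrow> nat \<Rightarrow> nat" where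
  "height_bound N n = value_bound N n ^ (n * n + 2 * n + 1)"

text \<open>The last two summands cover the eventually periodic case.\<close>

definition iter_bound :: "nat \<Rightarrow> nat \<Rightarrow> nat" where
  "iter_bound N n = rat_iter_bound n (height_bound N n) + n + common_order n"

text \<open>The single number \<open>N\<close> carries all information about the size of the
  instance.\<close>

locale valid_instance =
  fixes X :: "nat set" and N n :: nat and rs :: mat_code and xs ys :: vec_code
  assumes n: "n \<ge> 1" "n \<le> N"
    and length: "length rs = n" "\<And>r. r < n \<Longrightarrow> length (rs ! r) = n" "length xs = n" "length ys = n"
    and codes: "\<And>e. e \<in> set (concat rs) \<union> set xs \<union> set ys \<Longrightarrow> ok_code X e \<and> ratfun_encode e \<le> N"
begin

definition "entries = set (concat rs) \<union> set xs \<union> set ys"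

lemma in_entries: "r < n \<Longrightarrow> c < n \<Longrightarrow> rs ! r ! c \<in> entries" "r < n \<Longrightarrow> xs ! r \<in> entries" "r < n \<Longrightarrow> ys ! r \<in> entries"
proof -
  show "rs ! r ! c \<in> entries" if "r < n" "c < n"
  proof -
    have "rs ! r \<in> set rs" "rs ! r ! c \<in> set (rs ! r)" using that length by simp_all
    then show ?thesis unfolding entries_def by auto
  qed
qed (use length in \<open>simp_all add: entries_def\<close>)

lemma entries_nonzero: "e \<in> entries \<Longrightarrow> poly_val (snd e) \<noteq> 0"
  using codes unfolding entries_def ok_code_def by blast

lemma finite_entries: "finite entries"
  by (simp add: entries_def)

lemma card_entries: "card entries \<le> n * n + 2 * n"
proof -
  have "length (concat rs) = sum_list (map length rs)" by (simp add: length_concat)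
  also have "map length rs = map (\<lambda>_. n) rs"
    using length(1,2) by (metis (no_types, lifting) in_set_conv_nth map_eq_conv)
  finally have "card (set (concat rs)) \<le> n * n"
    using card_length[of "concat rs"] length(1) by (simp add: sum_list_triv)
  moreover have "card (set xs) \<le> n" "card (set ys) \<le> n"
    using card_length[of xs] card_length[of ys] length by simp_all
  moreover have "card entries \<le> card (set (concat rs)) + card (set xs) + card (set ys)"
    unfolding entries_def using card_Un_le[of "set (concat rs) \<union> set xs" "set ys"]
      card_Un_le[of "set (concat rs)" "set xs"] by linarith
  ultimately show ?thesis by linarith
qed

lemma entries_pdegs:
  assumes "e \<in> entries"
  shows "pdegs_le N {..<Suc N} (num_den e)"
proof -
  have le: "ratfun_encode e \<le> N" using codes assms unfolding entries_def by blast
  have "degs_le N (poly_val p) \<and> vars (poly_val p) \<subseteq> {..<Suc N}" if "poly_encode p \<le> ratfun_encode e" for p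
    using degs_le_mono[OF degs_le_poly_val, of p N] that le vars_poly_val[of p] poly_code_vars_le[of p]
    by (auto simp: subset_iff)
  then show ?thesis unfolding pdegs_le_def using poly_encode_le_ratfun_encode by simp
qed

definition "PV k r = pvec n (\<lambda>r c. num_den (rs ! r ! c)) (\<lambda>r. num_den (xs ! r)) k r"

definition "solves i \<longleftrightarrow> (\<forall>r<n. cross (PV i r) (num_den (ys ! r)) = 0)"

lemma PV_pdegs: "r < n \<Longrightarrow> pdegs_le (deg_bound N k) {..<Suc N} (PV k r)"
  unfolding PV_def by (rule pdegs_le_pvec) (use in_entries entries_pdegs n in auto)

definition "A\<^sub>f = mat n n (\<lambda>(r, c). ratfun_of (rs ! r ! c))"
definition "x\<^sub>f = vec n (\<lambda>r. ratfun_of (xs ! r))"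
definition "y\<^sub>f = vec n (\<lambda>r. ratfun_of (ys ! r))"

lemma pval_emb: "e \<in> entries \<Longrightarrow> pval (map_prod emb emb (num_den e)) = ratfun_of e"
  using entries_nonzero by (simp add: pval_def ratfun_of_def emb_def)

definition "vf k r = pval (map_prod emb emb (PV k r))"

lemma PV_emb: "map_prod emb emb (PV k r) = pvec n (\<lambda>r c. map_prod emb emb (num_den (rs ! r ! c))) (\<lambda>r. map_prod emb emb (num_den (xs ! r))) k r"
  unfolding PV_def by (rule pvec_hom[of emb, OF emb_hom])

lemma PV_snd: "r < n \<Longrightarrow> snd (map_prod emb emb (PV k r)) \<noteq> 0"
  unfolding PV_emb by (rule pvec_field) (use in_entries entries_nonzero in \<open>simp_all add: emb_eq_0\<close>)

lemma orbit_vf: "orbit n A\<^sub>f vf"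
proof -
  have "A\<^sub>f = mat n n (\<lambda>(r, c). pval (map_prod emb emb (num_den (rs ! r ! c))))"
    unfolding A\<^sub>f_def by (rule eq_matI) (use in_entries pval_emb in auto)
  moreover have "orbit n (mat n n (\<lambda>(r, c). pval (map_prod emb emb (num_den (rs ! r ! c))))) vf"
    unfolding vf_def PV_emb
    by (rule pvec_field(2)) (use in_entries entries_nonzero in \<open>simp_all add: emb_eq_0\<close>)
  ultimately show ?thesis by simp
qed

lemma cross_emb: "cross (map_prod emb emb p) (map_prod emb emb q) = emb (cross p q)"
  unfolding cross_def by (simp add: emb_diff emb_hom)

lemma cross_PV:
  assumes "r < n" "snd q \<noteq> 0"
  shows "cross (PV k r) q = 0 \<longleftrightarrow> vf k r = pval (map_prod emb emb q)"
proof -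
  have "cross (PV k r) q = 0 \<longleftrightarrow> cross (map_prod emb emb (PV k r)) (map_prod emb emb q) = 0"
    unfolding cross_emb emb_eq_0 ..
  also have "\<dots> \<longleftrightarrow> vf k r = pval (map_prod emb emb q)"
    unfolding vf_def by (rule cross_eq_0_iff) (use PV_snd assms in \<open>simp_all add: emb_eq_0\<close>)
  finally show ?thesis .
qed

lemma solves_vf: "solves i \<longleftrightarrow> (\<forall>r<n. vf i r = ratfun_of (ys ! r))"
proof -
  have "cross (PV i r) (num_den (ys ! r)) = 0 \<longleftrightarrow> vf i r = ratfun_of (ys ! r)" if r: "r < n" for r
    using cross_PV[OF r, of "num_den (ys ! r)"] in_entries(3)[OF r] entries_nonzero pval_emb by simp
  then show ?thesis unfolding solves_def by blast
qed

lemma solves_iff: "solves i \<longleftrightarrow> A\<^sub>f ^\<^sub>m i *\<^sub>v x\<^sub>f = y\<^sub>f"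
proof -
  have A: "A\<^sub>f \<in> carrier_mat n n" and x: "x\<^sub>f \<in> carrier_vec n" by (simp_all add: A\<^sub>f_def x\<^sub>f_def)
  have vf: "vf i r = (A\<^sub>f ^\<^sub>m i *\<^sub>v x\<^sub>f) $ r" if "r < n" for r
  proof (rule orbit_unique[OF orbit_vf orbit_pow_mat[OF A x] _ that])
    fix r assume r: "r < n"
    then show "vf 0 r = (A\<^sub>f ^\<^sub>m 0 *\<^sub>v x\<^sub>f) $ r"
      using A x pval_emb[OF in_entries(2)[OF r]] by (simp add: vf_def PV_def x\<^sub>f_def)
  qed
  have d: "dim_vec (A\<^sub>f ^\<^sub>m i *\<^sub>v x\<^sub>f) = n" using A by simp
  show ?thesis
  proof
    assume "solves i"
    then show "A\<^sub>f ^\<^sub>m i *\<^sub>v x\<^sub>f = y\<^sub>f"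
      using vf d by (intro eq_vecI) (simp_all add: solves_vf y\<^sub>f_def)
  next
    assume "A\<^sub>f ^\<^sub>m i *\<^sub>v x\<^sub>f = y\<^sub>f"
    then show "solves i" using vf by (simp add: solves_vf y\<^sub>f_def)
  qed
qed

lemma solves_bounded:
  assumes sol: "solves i"
  shows "\<exists>i' \<le> iter_bound N n. solves i'"
proof (cases "\<forall>r<n. vf (n + common_order n) r = vf n r")
  case True
  show ?thesis
  proof (cases "i < n")
    case True
    then show ?thesis using sol by (intro exI[of _ i]) (simp add: iter_bound_def)
  next
    case False
    \<comment> \<open>From index \<open>n\<close> on the orbit has period
      \<open>common_order n\<close>, so \<open>i\<close> can be reduced.\<close>
    then have "vf i r = vf (n + (i - n) mod common_order n) r" if "r < n" for r
      using orbit_periodic[OF orbit_vf _ that, of n "common_order n" "i - n"] True by simp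
    then have "solves (n + (i - n) mod common_order n)" using sol by (simp add: solves_vf)
    moreover have "common_order n > 0" by (simp add: common_order_def)
    then have "(i - n) mod common_order n < common_order n" by simp
    ultimately show ?thesis by (intro exI[of _ "n + (i - n) mod common_order n"]) (simp add: iter_bound_def)
  qed
next
  case False
  then obtain r0 where r0: "r0 < n" "vf (n + common_order n) r0 \<noteq> vf n r0" by blast
  let ?M = "n + common_order n"
  define K where "K = point_base N n"
  define T where "T = cross (PV ?M r0) (PV n r0)"
  \<comment> \<open>A point where \<open>Z\<close> is nonzero preserves the failure of periodicity
    and keeps all denominators, those of \<open>y\<close> included, nonzero.\<close>
  define Z where "Z = T * (\<Prod>e\<in>entries. poly_val (snd e))"
  have "snd (PV n r0) \<noteq> 0" using PV_snd[OF r0(1), of n] by (auto simp: emb_eq_0)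
  then have "T \<noteq> 0" unfolding T_def using cross_PV[OF r0(1), of "PV n r0" ?M] r0(2) by (simp add: vf_def)
  then have Z0: "Z \<noteq> 0" unfolding Z_def using entries_nonzero finite_entries by simp
  have T_deg: "degs_le (deg_bound N ?M + deg_bound N n) T \<and> vars T \<subseteq> {..<Suc N}"
    unfolding T_def using PV_pdegs[OF r0(1)] by (intro pdegs_le_cross)
  have P_deg: "degs_le (card entries * N) (\<Prod>e\<in>entries. poly_val (snd e)) \<and> vars (\<Prod>e\<in>entries. poly_val (snd e)) \<subseteq> {..<Suc N}"
    by (rule degs_le_prod[OF finite_entries]) (use entries_pdegs in \<open>simp add: pdegs_le_def\<close>)
  have "degs_le (deg_bound N ?M + deg_bound N n + card entries * N) Z"
    unfolding Z_def using T_deg P_deg by (intro degs_le_mult) auto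
  moreover have "vars Z \<subseteq> {..<Suc N}"
    unfolding Z_def using T_deg P_deg by (intro order_trans[OF vars_mult] Un_least) auto
  moreover have "deg_bound N ?M + deg_bound N n + card entries * N < K"
  proof -
    have "deg_bound N n \<le> deg_bound N ?M" unfolding deg_bound_def by (rule power_increasing) auto
    moreover have "card entries * N \<le> (n * n + 2 * n) * N" using card_entries by (rule mult_right_mono) simp
    ultimately show ?thesis unfolding K_def point_base_def by linarith
  qed
  ultimately obtain s where s: "s < K ^ Suc N" "kev s K Z \<noteq> 0" using kron_nonzero[OF Z0] unfolding kev_def by blast
  have T_s: "kev s K T \<noteq> 0" and den_s: "\<And>e. e \<in> entries \<Longrightarrow> ieval s K (snd e) \<noteq> 0"
  proof -
    have "kev s K Z = kev s K T * (\<Prod>e\<in>entries. of_int (ieval s K (snd e)))"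
      unfolding Z_def kev_hom kev_prod kev_poly_val ..
    with s(2) have *: "kev s K T \<noteq> 0 \<and> (\<Prod>e\<in>entries. of_int (ieval s K (snd e)) :: rat) \<noteq> 0" by simp
    then show "kev s K T \<noteq> 0" by blast
    show "\<And>e. e \<in> entries \<Longrightarrow> ieval s K (snd e) \<noteq> 0" using * finite_entries by simp
  qed
  let ?ev = "\<lambda>p. map_prod (kev s K) (kev s K) p"
  have ev_mp: "?ev (num_den e) = (of_int (ieval s K (fst e)), of_int (ieval s K (snd e)))" for e
    by (simp add: kev_poly_val)
  define w where "w = (\<lambda>k r. pval (?ev (PV k r)))"
  define B where "B = mat n n (\<lambda>(r, c). pval (?ev (num_den (rs ! r ! c))))"
  have PV_ev: "?ev (PV k r) = pvec n (\<lambda>r c. ?ev (num_den (rs ! r ! c))) (\<lambda>r. ?ev (num_den (xs ! r))) k r" for k r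
    unfolding PV_def by (rule pvec_hom[of "kev s K", OF kev_hom])
  have ev_nz: "snd (?ev (PV k r)) \<noteq> 0" if "r < n" for k r
    unfolding PV_ev by (rule pvec_field(1)[OF _ _ that]) (use in_entries den_s in \<open>simp_all add: kev_poly_val\<close>)
  have orb: "orbit n B w"
    unfolding B_def w_def PV_ev by (rule pvec_field(2)) (use in_entries den_s in \<open>simp_all add: kev_poly_val\<close>)
  have cross_ev: "cross (?ev p) (?ev q) = kev s K (cross p q)" for p q
    unfolding cross_def by (simp add: kev_diff kev_hom)
  have per: "w ?M r0 \<noteq> w n r0"
    using cross_eq_0_iff[OF ev_nz[OF r0(1), of ?M] ev_nz[OF r0(1), of n]] T_s
    unfolding w_def cross_ev T_def by simp
  have wi: "w i r = pval (?ev (num_den (ys ! r)))" if r: "r < n" for r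
  proof -
    have "cross (?ev (PV i r)) (?ev (num_den (ys ! r))) = 0"
      unfolding cross_ev using sol r by (simp add: solves_def kev_hom)
    then show ?thesis unfolding w_def
      using cross_eq_0_iff[OF ev_nz[OF r, of i], of "?ev (num_den (ys ! r))"] den_s[OF in_entries(3)[OF r]]
      by (simp add: kev_poly_val)
  qed
  define V where "V = value_bound N n"
  \<comment> \<open>A common denominator of all specialised entries.\<close>
  define D where "D = (\<Prod>e\<in>entries. nat \<bar>ieval s K (snd e)\<bar>)"
  have K1: "K \<ge> 1" by (simp add: K_def point_base_def)
  have V_le: "nat \<bar>ieval s K (fst e)\<bar> \<le> V \<and> nat \<bar>ieval s K (snd e)\<bar> \<le> V" if e: "e \<in> entries" for e
  proof -
    have le: "ratfun_encode e \<le> N" using codes e unfolding entries_def by blast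
    have "\<bar>ieval s K p\<bar> \<le> int V" if "poly_encode p \<le> ratfun_encode e" for p
      unfolding V_def value_bound_def K_def[symmetric] using that le s(1) K1
      by (intro abs_ieval_le) auto
    then show ?thesis using poly_encode_le_ratfun_encode[of e] by (simp add: nat_le_iff)
  qed
  have V1: "V \<ge> 1"
  proof -
    have "xs ! 0 \<in> entries" using in_entries(2)[of 0] n by simp
    from V_le[OF this] den_s[OF this] show ?thesis by linarith
  qed
  have D_le: "D \<le> V ^ (n * n + 2 * n)"
  proof -
    have "D \<le> V ^ card entries"
      unfolding D_def using prod_mono[of entries "\<lambda>e. nat \<bar>ieval s K (snd e)\<bar>" "\<lambda>_. V"] V_le by simp
    also have "\<dots> \<le> V ^ (n * n + 2 * n)" using V1 card_entries by (rule power_increasing[rotated])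
    finally show ?thesis .
  qed
  have H: "height_bound N n = V ^ (n * n + 2 * n) * V" by (simp add: height_bound_def V_def)
  have D1: "D \<ge> 1" unfolding D_def using den_s finite_entries by (simp add: Suc_le_eq prod_pos)
  have DH: "D \<le> height_bound N n" unfolding H using mult_le_mono[OF D_le V1] by simp
  have entry: "scaled_int D (height_bound N n) (pval (?ev (num_den e)))"
    if e: "e \<in> entries" for e
  proof -
    let ?p = "ieval s K (fst e)" and ?q = "ieval s K (snd e)"
    have q: "?q \<noteq> 0" using den_s[OF e] .
    have "nat \<bar>?q\<bar> dvd D" unfolding D_def using finite_entries e by (rule dvd_prodI)
    then have "?q dvd int D" by (simp add: nat_abs_dvd_iff)
    then obtain g where g: "int D = ?q * g" by blast
    have "(of_nat D :: rat) = of_int (int D)" by simp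
    also have "\<dots> = of_int ?q * of_int g" unfolding g by simp
    finally have eq: "of_nat D * pval (?ev (num_den e)) = of_int (g * ?p)"
      using q unfolding ev_mp pval_def by simp
    have "1 \<le> \<bar>?q\<bar>" using q by linarith
    then have "\<bar>g\<bar> \<le> \<bar>?q\<bar> * \<bar>g\<bar>" using mult_right_mono[of 1 "\<bar>?q\<bar>" "\<bar>g\<bar>"] by simp
    also have "\<dots> = int D" using g by (simp flip: abs_mult)
    finally have "\<bar>g * ?p\<bar> \<le> int D * int V"
      unfolding abs_mult using V_le[OF e] by (intro mult_mono) auto
    also have "\<dots> \<le> int (height_bound N n)"
      unfolding H of_nat_mult[symmetric] of_nat_le_iff using D_le by (rule mult_right_mono) simp
    finally have "\<bar>of_int (g * ?p) :: rat\<bar> \<le> of_nat (height_bound N n)"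
      by (metis of_int_abs of_int_le_iff of_int_of_nat_eq)
    then show ?thesis unfolding scaled_int_def eq by simp
  qed
  have "i \<le> rat_iter_bound n (height_bound N n) \<or> (\<forall>r<n. w (n + common_order n) r = w n r)"
  proof (rule rational_orbit_bound[OF orb n(1) D1 DH])
    fix r assume r: "r < n"
    show "scaled_int D (height_bound N n) (B $$ (r, c))" if "c < n" for c
      using entry[OF in_entries(1)[OF r that]] r that by (simp add: B_def)
    show "scaled_int D (height_bound N n) (w 0 r)"
      using entry[OF in_entries(2)[OF r]] by (simp add: w_def PV_def)
    show "scaled_int D (height_bound N n) (w i r)"
      unfolding wi[OF r] by (rule entry[OF in_entries(3)[OF r]])
  qed
  then have "i \<le> rat_iter_bound n (height_bound N n)" using per r0(1) by blast
  then show ?thesis using sol by (intro exI[of _ i]) (simp add: iter_bound_def)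
qed

end

section \<open>The decision procedure\<close>

text \<open>On codes, the pair \<open>(a, b)\<close> stands for the integer \<open>a - b\<close>.\<close>

definition zval :: "nat \<Rightarrow> int" where
  "zval z = int (pfst z) - int (psnd z)"

definition zadd :: "nat \<Rightarrow> nat \<Rightarrow> nat" where
  "zadd z w = pr (pfst z + pfst w) (psnd z + psnd w)"

definition zmul :: "nat \<Rightarrow> nat \<Rightarrow> nat" where
  "zmul z w = pr (pfst z * pfst w + psnd z * psnd w) (pfst z * psnd w + psnd z * pfst w)"

text \<open>\<open>int_encode\<close> sends \<open>a >= 0\<close> to \<open>2 a\<close> and
  \<open>a < 0\<close> to \<open>-2 a - 1\<close>; parity tells the two apart.\<close>

definition zint :: "nat \<Rightarrow> nat" where
  "zint a = (if a = 2 * (a div 2) then pr (a div 2) 0 else pr 0 (a div 2 + 1))"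

lemma zval_simps [simp]:
  "zval (pr a b) = int a - int b" "zval (zadd z w) = zval z + zval w" "zval (zmul z w) = zval z * zval w"
  by (simp_all add: zval_def zadd_def zmul_def algebra_simps)

lemma zval_zint [simp]: "zval (zint (int_encode a)) = a"
  by (auto simp: zint_def int_encode_def sum_encode_def)

lemma prog_zadd [prog_intros]: "prog f \<Longrightarrow> prog g \<Longrightarrow> prog (\<lambda>x. zadd (f x) (g x))"
  unfolding zadd_def by (intro prog_intros)

lemma prog_zmul [prog_intros]: "prog f \<Longrightarrow> prog g \<Longrightarrow> prog (\<lambda>x. zmul (f x) (g x))"
  unfolding zmul_def by (intro prog_intros)

lemma prog_zint [prog_intros]: "prog f \<Longrightarrow> prog (\<lambda>x. zint (f x))"
  unfolding zint_def by (intro prog_intros prog_comp[OF prog_half])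

definition cmwt :: "nat \<Rightarrow> nat \<Rightarrow> nat" where
  "cmwt K m = foldl (\<lambda>b u. b + K ^ pfst u * psnd u) 0 (list_decode m)"

lemma prog_cmwt [prog_intros]:
  assumes "prog K" "prog m"
  shows "prog (\<lambda>x. cmwt (K x) (m x))"
  unfolding cmwt_def by (intro prog_foldl prog_intros assms assms[THEN prog_comp])

lemma cmwt_encode [simp]: "cmwt K (monom_encode m) = mwt K m"
proof -
  have "foldl (\<lambda>b u. b + K ^ pfst u * psnd u) b (map prod_encode m) = b + mwt K m" for b
    by (induction m arbitrary: b) (auto simp: mwt_def)
  then show ?thesis by (simp add: cmwt_def monom_encode_def)
qed

definition ceval :: "nat \<Rightarrow> nat \<Rightarrow> nat \<Rightarrow> nat" where
  "ceval s K p = foldl (\<lambda>z t. zadd z (zmul (zint (pfst t)) (pr (s ^ cmwt K (psnd t)) 0))) (pr 0 0) (list_decode p)"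

lemma prog_ceval [prog_intros]:
  assumes "prog s" "prog K" "prog p"
  shows "prog (\<lambda>x. ceval (s x) (K x) (p x))"
  unfolding ceval_def by (intro prog_foldl prog_intros assms assms[THEN prog_comp])

lemma zval_ceval [simp]: "zval (ceval s K (poly_encode p)) = ieval s K p"
proof -
  let ?f = "\<lambda>z t. zadd z (zmul (zint (pfst t)) (pr (s ^ cmwt K (psnd t)) 0))"
  have "zval (foldl ?f z (map (\<lambda>(a, m). prod_encode (int_encode a, monom_encode m)) p)) = zval z + ieval s K p" for z
    by (induction p arbitrary: z) (auto simp: ieval_def)
  then show ?thesis by (simp add: ceval_def poly_encode_def)
qed

definition qval :: "nat \<Rightarrow> int \<times> int" where
  "qval q = (zval (pfst q), zval (psnd q))"

definition qadd :: "nat \<Rightarrow> nat \<Rightarrow> nat" where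
  "qadd p q = pr (zadd (zmul (pfst p) (psnd q)) (zmul (pfst q) (psnd p))) (zmul (psnd p) (psnd q))"

definition qmul :: "nat \<Rightarrow> nat \<Rightarrow> nat" where
  "qmul p q = pr (zmul (pfst p) (pfst q)) (zmul (psnd p) (psnd q))"

definition qsum :: "(nat \<Rightarrow> nat) \<Rightarrow> nat \<Rightarrow> nat" where
  "qsum f n = rec_nat (pr (pr 0 0) (pr 1 0)) (\<lambda>j q. qadd q (f j)) n"

definition qent :: "nat \<Rightarrow> nat \<Rightarrow> nat \<Rightarrow> nat" where
  "qent s K e = pr (ceval s K (pfst e)) (ceval s K (psnd e))"

text \<open>The entries are evaluated at the point \<open>s\<close> before the iteration, so the
  program never manipulates polynomials; \<open>pvec_hom\<close> shows that the order does not
  matter.\<close>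

definition cvec :: "nat \<Rightarrow> nat \<Rightarrow> nat \<Rightarrow> nat \<Rightarrow> nat \<Rightarrow> nat \<Rightarrow> nat" where
  "cvec n a x s K k = rec_nat (tabulate (\<lambda>r. qent s K (cnth x r)) n)
     (\<lambda>_ w. tabulate (\<lambda>r. qsum (\<lambda>c. qmul (qent s K (cnth (cnth a r) c)) (cnth w c)) n) n) k"

lemma qval_qadd: "qval (qadd p q) = padd (qval p) (qval q)"
  and qval_qmul: "qval (qmul p q) = pmul (qval p) (qval q)"
  by (simp_all add: qval_def qadd_def qmul_def padd_def pmul_def)

lemma qval_qsum: "qval (qsum f n) = psum (\<lambda>c. qval (f c)) n"
proof (induction n)
  case 0
  then show ?case by (simp add: qsum_def qval_def)
next
  case (Suc n)
  have "qsum f (Suc n) = qadd (qsum f n) (f n)" by (simp add: qsum_def)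
  then show ?case using Suc by (simp add: qval_qadd)
qed

lemma prog_qadd [prog_intros]: "prog f \<Longrightarrow> prog g \<Longrightarrow> prog (\<lambda>x. qadd (f x) (g x))"
  unfolding qadd_def by (intro prog_intros)

lemma prog_qmul [prog_intros]: "prog f \<Longrightarrow> prog g \<Longrightarrow> prog (\<lambda>x. qmul (f x) (g x))"
  unfolding qmul_def by (intro prog_intros)

lemma prog_qent [prog_intros]: "prog s \<Longrightarrow> prog K \<Longrightarrow> prog e \<Longrightarrow> prog (\<lambda>x. qent (s x) (K x) (e x))"
  unfolding qent_def by (intro prog_intros)

lemma prog_qsum:
  assumes f: "prog (\<lambda>z. f (pfst z) (psnd z))" and n: "prog n"
  shows "prog (\<lambda>x. qsum (f x) (n x))"
proof -
  have *: "prog (\<lambda>z. f (u z) (v z))" if "prog u" "prog v" for u v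
    using prog_comp[OF f prog_pr[OF that]] by simp
  show ?thesis unfolding qsum_def by (intro prog_rec prog_intros * n)
qed

lemma prog_cvec [prog_intros]:
  assumes "prog n" "prog a" "prog x" "prog s" "prog K" "prog k"
  shows "prog (\<lambda>z. cvec (n z) (a z) (x z) (s z) (K z) (k z))"
  unfolding cvec_def by (intro prog_rec prog_tabulate prog_qsum prog_intros assms assms[THEN prog_comp])

lemma qval_cvec:
  assumes "r < n"
  shows "qval (cnth (cvec n a x s K k) r) =
    pvec n (\<lambda>r c. qval (qent s K (cnth (cnth a r) c))) (\<lambda>r. qval (qent s K (cnth x r))) k r"
  using assms
proof (induction k arbitrary: r)
  case 0
  then show ?case by (simp add: cvec_def)
next
  case (Suc k)
  have e: "cvec n a x s K (Suc k) =
      tabulate (\<lambda>r. qsum (\<lambda>c. qmul (qent s K (cnth (cnth a r) c)) (cnth (cvec n a x s K k) c)) n) n"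
    by (simp add: cvec_def)
  show ?case unfolding e using Suc by (simp add: qval_qsum qval_qmul cong: psum_cong)
qed

definition zeq :: "nat \<Rightarrow> nat \<Rightarrow> bool" where
  "zeq z w \<longleftrightarrow> pfst z + psnd w = pfst w + psnd z"

lemma zeq_iff: "zeq z w \<longleftrightarrow> zval z = zval w"
  unfolding zeq_def zval_def by linarith

lemma prog_zeq [prog_intros]: "prog f \<Longrightarrow> prog g \<Longrightarrow> prog (\<lambda>x. of_bool (zeq (f x) (g x)))"
  unfolding zeq_def by (intro prog_intros)

definition qeq :: "nat \<Rightarrow> nat \<Rightarrow> bool" where
  "qeq p q \<longleftrightarrow> zeq (zmul (pfst p) (psnd q)) (zmul (pfst q) (psnd p))"

lemma qeq_iff: "qeq p q \<longleftrightarrow> cross (qval p) (qval q) = 0"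
  by (simp add: qeq_def zeq_iff cross_def qval_def)

lemma prog_qeq [prog_intros]: "prog f \<Longrightarrow> prog g \<Longrightarrow> prog (\<lambda>x. of_bool (qeq (f x) (g x)))"
  unfolding qeq_def by (intro prog_intros)

section \<open>Validity of codes and the decision predicate\<close>

definition cvars :: "nat set \<Rightarrow> nat \<Rightarrow> bool" where
  "cvars X p \<longleftrightarrow> (\<forall>t\<in>set (list_decode p). \<forall>u\<in>set (list_decode (psnd t)). pfst u \<in> X)"

lemma cvars_encode: "cvars X (poly_encode p) \<longleftrightarrow> poly_code_vars p \<subseteq> X"
proof -
  have "pfst (prod_encode u) = fst u" for u by (simp add: pfst_def)
  then show ?thesis
    by (simp add: cvars_def poly_encode_def monom_encode_def poly_code_vars_def case_prod_unfold
        UN_subset_iff image_subset_iff)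
qed

text \<open>For codes at most \<open>N\<close>, the denominator has degree at most \<open>N\<close>
  in indeterminates of index at most \<open>N\<close>, so base \<open>N + 1\<close> and the points
  below \<open>(N + 1)^(N + 1)\<close> decide whether it is zero.\<close>

definition ok_nat :: "nat set \<Rightarrow> nat \<Rightarrow> nat \<Rightarrow> bool" where
  "ok_nat X N e \<longleftrightarrow> cvars X (pfst e) \<and> cvars X (psnd e) \<and>
     (\<exists>s < Suc N ^ Suc N. \<not> zeq (ceval s (Suc N) (psnd e)) (pr 0 0))"

lemma ok_nat_encode:
  assumes "ratfun_encode e \<le> N"
  shows "ok_nat X N (ratfun_encode e) \<longleftrightarrow> ok_code X e"
proof -
  obtain p q where e: "e = (p, q)" by (cases e)
  have le: "poly_encode q \<le> N" using assms poly_encode_le_ratfun_encode(2)[of e] e by simp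
  have "poly_val q \<noteq> 0 \<longleftrightarrow> (\<exists>s < Suc N ^ Suc N. ieval s (Suc N) q \<noteq> 0)"
  proof
    assume "poly_val q \<noteq> 0"
    moreover have "degs_le N (poly_val q)" using degs_le_mono[OF degs_le_poly_val le] .
    moreover have "vars (poly_val q) \<subseteq> {..<Suc N}"
      using vars_poly_val[of q] poly_code_vars_le[of q] le by (auto simp: subset_iff)
    ultimately have "\<exists>s < Suc N ^ Suc N. kev s (Suc N) (poly_val q) \<noteq> 0"
      using kron_nonzero[of "poly_val q" "Suc N" N "Suc N"] unfolding kev_def by simp
    then show "\<exists>s < Suc N ^ Suc N. ieval s (Suc N) q \<noteq> 0" by (simp add: kev_poly_val)
  next
    assume "\<exists>s < Suc N ^ Suc N. ieval s (Suc N) q \<noteq> 0"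
    then obtain s where "ieval s (Suc N) q \<noteq> 0" by blast
    then have "kev s (Suc N) (poly_val q) \<noteq> 0" by (simp add: kev_poly_val)
    then show "poly_val q \<noteq> 0" using kev_hom(1) by metis
  qed
  then show ?thesis unfolding ok_nat_def ok_code_def e by (simp add: cvars_encode zeq_iff del: power_Suc)
qed

lemma prog_ok_nat:
  assumes X: "prog (\<lambda>v. of_bool (v \<in> X))" and "prog N" "prog e"
  shows "prog (\<lambda>x. of_bool (ok_nat X (N x) (e x)))"
  unfolding ok_nat_def cvars_def
  by (intro prog_intros prog_comp[OF X] assms assms(2,3)[THEN prog_comp])

text \<open>The base \<open>deg_bound N i + N + 1\<close> exceeds the degree of the cross-multiplied
  equations for exponent \<open>i\<close>, which involve at most \<open>N + 1\<close>
  indeterminates. Agreement at all these points is therefore equality of rational functions.\<close>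

definition decide :: "nat set \<Rightarrow> nat \<Rightarrow> nat \<Rightarrow> nat \<Rightarrow> nat \<Rightarrow> nat \<Rightarrow> bool" where
  "decide X N n a x y \<longleftrightarrow>
     1 \<le> n \<and> length (list_decode a) = n \<and> length (list_decode x) = n \<and> length (list_decode y) = n \<and>
     (\<forall>w\<in>set (list_decode a). length (list_decode w) = n \<and> (\<forall>e\<in>set (list_decode w). ok_nat X N e)) \<and>
     (\<forall>e\<in>set (list_decode x). ok_nat X N e) \<and> (\<forall>e\<in>set (list_decode y). ok_nat X N e) \<and>
     (\<exists>i < Suc (iter_bound N n). \<forall>s < (deg_bound N i + N + 1) ^ Suc N. \<forall>r<n.
        qeq (cnth (cvec n a x s (deg_bound N i + N + 1) i) r) (qent s (deg_bound N i + N + 1) (cnth y r)))"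

lemma prog_deg_bound [prog_intros]: "prog f \<Longrightarrow> prog g \<Longrightarrow> prog (\<lambda>x. deg_bound (f x) (g x))"
  unfolding deg_bound_def by (intro prog_intros)

lemma prog_root_count [prog_intros]: "prog f \<Longrightarrow> prog g \<Longrightarrow> prog (\<lambda>x. root_count (f x) (g x))"
  unfolding root_count_def by (intro prog_intros)

lemma prog_coeff_bound [prog_intros]: "prog f \<Longrightarrow> prog g \<Longrightarrow> prog (\<lambda>x. coeff_bound (f x) (g x))"
  unfolding coeff_bound_def solution_bound_def by (intro prog_intros)

lemma prog_common_order [prog_intros]: "prog f \<Longrightarrow> prog (\<lambda>x. common_order (f x))"
  unfolding common_order_def by (intro prog_intros)

lemma prog_point_base [prog_intros]: "prog f \<Longrightarrow> prog g \<Longrightarrow> prog (\<lambda>x. point_base (f x) (g x))"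
  unfolding point_base_def by (intro prog_intros)

lemma prog_iter_bound [prog_intros]: "prog f \<Longrightarrow> prog g \<Longrightarrow> prog (\<lambda>x. iter_bound (f x) (g x))"
  unfolding iter_bound_def rat_iter_bound_def conjugate_bound_def height_bound_def value_bound_def by (intro prog_intros)

lemma prog_decide:
  assumes X: "prog (\<lambda>v. of_bool (v \<in> X))" and "prog N" "prog n" "prog a" "prog x" "prog y"
  shows "prog (\<lambda>z. of_bool (decide X (N z) (n z) (a z) (x z) (y z)))"
  unfolding decide_def
  by (intro prog_intros prog_ok_nat[OF X] assms(2-) assms(2-)[THEN prog_comp])

lemma list_decode_encodings [simp]:
  "list_decode (vec_encode xs) = map ratfun_encode xs"
  "list_decode (mat_encode rs) = map vec_encode rs"
  by (simp_all add: vec_encode_def mat_encode_def)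

lemma cnth_encodings [simp]:
  "r < length xs \<Longrightarrow> cnth (vec_encode xs) r = ratfun_encode (xs ! r)"
  "r < length rs \<Longrightarrow> cnth (mat_encode rs) r = vec_encode (rs ! r)"
  by (simp_all add: vec_encode_def mat_encode_def)

lemma qval_qent [simp]: "qval (qent s K (ratfun_encode e)) = (ieval s K (fst e), ieval s K (snd e))"
  by (cases e) (simp add: qval_def qent_def)

lemma pvec_cong:
  assumes "\<And>r c. r < n \<Longrightarrow> c < n \<Longrightarrow> a r c = b r c" "\<And>r. r < n \<Longrightarrow> x r = y r" "r < n"
  shows "pvec n a x k r = pvec n b y k r"
  using assms(3)
proof (induction k arbitrary: r)
  case (Suc k)
  show ?case using Suc assms(1) by (auto intro!: psum_cong)
qed (use assms(2) in simp)

context valid_instance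
begin

text \<open>The integers computed at \<open>s\<close> are the values at that point of the
  polynomials in \<open>solves\<close>, and \<open>kron_nonzero\<close> provides enough points to
  recognise the zero polynomial.\<close>

lemma solves_decide:
  "solves i \<longleftrightarrow> (\<forall>s < (deg_bound N i + N + 1) ^ Suc N. \<forall>r<n.
      qeq (cnth (cvec n (mat_encode rs) (vec_encode xs) s (deg_bound N i + N + 1) i) r)
        (qent s (deg_bound N i + N + 1) (cnth (vec_encode ys) r)))"
proof -
  define K where "K = deg_bound N i + N + 1"
  let ?P = "\<lambda>r. cross (PV i r) (num_den (ys ! r))"
  let ?q = "\<lambda>s r. qeq (cnth (cvec n (mat_encode rs) (vec_encode xs) s K i) r) (qent s K (cnth (vec_encode ys) r))"
  have q: "?q s r \<longleftrightarrow> kev s K (?P r) = 0" if r: "r < n" for s r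
  proof -
    let ?i = "\<lambda>e. (ieval s K (fst e), ieval s K (snd e))"
    let ?h = "of_int :: int \<Rightarrow> rat"
    let ?V = "pvec n (\<lambda>r c. ?i (rs ! r ! c)) (\<lambda>r. ?i (xs ! r)) i r"
    have "qval (cnth (cvec n (mat_encode rs) (vec_encode xs) s K i) r) = ?V"
      unfolding qval_cvec[OF r] by (rule pvec_cong) (use r length in simp_all)
    then have "?q s r \<longleftrightarrow> cross ?V (?i (ys ! r)) = 0"
      using r length by (simp add: qeq_iff)
    also have "\<dots> \<longleftrightarrow> ?h (cross ?V (?i (ys ! r))) = 0" by simp
    also have "?h (cross ?V (?i (ys ! r))) = cross (map_prod ?h ?h ?V) (map_prod ?h ?h (?i (ys ! r)))"
      by (simp add: cross_def)
    \<comment> \<open>Both sides iterate the same specialised fractions, once in the integers and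
      once as values of polynomials.\<close>
    also have "map_prod ?h ?h ?V = map_prod (kev s K) (kev s K) (PV i r)"
      unfolding PV_def pvec_hom[of "kev s K", OF kev_hom]
      by (subst pvec_hom) (simp_all add: kev_poly_val)
    also have "map_prod ?h ?h (?i (ys ! r)) = map_prod (kev s K) (kev s K) (num_den (ys ! r))"
      by (simp add: kev_poly_val)
    also have "cross (map_prod (kev s K) (kev s K) (PV i r)) (map_prod (kev s K) (kev s K) (num_den (ys ! r))) = kev s K (?P r)"
      by (simp add: cross_def kev_diff kev_hom)
    finally show ?thesis .
  qed
  have P: "?P r = 0 \<longleftrightarrow> (\<forall>s < K ^ Suc N. kev s K (?P r) = 0)" if r: "r < n" for r
  proof
    assume all: "\<forall>s < K ^ Suc N. kev s K (?P r) = 0"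
    have "degs_le (deg_bound N i + N) (?P r) \<and> vars (?P r) \<subseteq> {..<Suc N}"
      by (rule pdegs_le_cross[OF PV_pdegs[OF r] entries_pdegs[OF in_entries(3)[OF r]]])
    then show "?P r = 0"
      using kron_nonzero[of "?P r" "Suc N" "deg_bound N i + N" K] all unfolding K_def kev_def by auto
  qed (simp add: kev_hom)
  show ?thesis unfolding solves_def K_def[symmetric] using q P by blast
qed

end

section \<open>Correctness of the decision procedure\<close>

lemma bij_list_encode_map: "bij f \<Longrightarrow> bij (\<lambda>xs. list_encode (map f xs))"
proof (rule bijI)
  assume f: "bij f"
  show "inj (\<lambda>xs. list_encode (map f xs))"
    using bij_is_inj[OF f] by (auto intro!: injI dest: list_encode_eq[THEN iffD1] map_injective)
  show "surj (\<lambda>xs. list_encode (map f xs))"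
  proof (rule surjI)
    fix N
    show "list_encode (map f (map (inv_into UNIV f) (list_decode N))) = N"
      using bij_is_surj[OF f] by (simp add: o_def surj_f_inv_f)
  qed
qed

lemma bij_prod_encode_map: "bij f \<Longrightarrow> bij g \<Longrightarrow> bij (\<lambda>(a, b). prod_encode (f a, g b))"
proof (rule bijI)
  assume f: "bij f" and g: "bij g"
  show "inj (\<lambda>(a, b). prod_encode (f a, g b))"
    using bij_is_inj[OF f] bij_is_inj[OF g]
    by (auto intro!: injI dest: injD prod_encode_eq[THEN iffD1])
  show "surj (\<lambda>(a, b). prod_encode (f a, g b))"
  proof (rule surjI)
    fix N
    show "(\<lambda>(a, b). prod_encode (f a, g b)) (inv_into UNIV f (pfst N), inv_into UNIV g (psnd N)) = N"
      using bij_is_surj[OF f] bij_is_surj[OF g] by (simp add: surj_f_inv_f pr_pfst_psnd)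
  qed
qed

text \<open>Every natural number thus codes lists of the intended types, and only lengths, indices
  and denominators remain to be checked.\<close>

lemma bij_encodings: "bij vec_encode" "bij mat_encode"
proof -
  have m: "bij monom_encode"
    using bij_list_encode_map[OF bij_prod_encode] by (simp add: monom_encode_def[abs_def])
  have p: "bij poly_encode"
    using bij_list_encode_map[OF bij_prod_encode_map[OF bij_int_encode m]]
    by (simp add: poly_encode_def[abs_def])
  have "bij (\<lambda>(p, q). prod_encode (poly_encode p, poly_encode q))" by (rule bij_prod_encode_map[OF p p])
  moreover have "(\<lambda>(p, q). prod_encode (poly_encode p, poly_encode q)) = ratfun_encode"
    by (auto simp: fun_eq_iff)
  ultimately have r: "bij ratfun_encode" by simp
  show v: "bij vec_encode" using bij_list_encode_map[OF r] by (simp add: vec_encode_def[abs_def])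
  show "bij mat_encode" using bij_list_encode_map[OF v] by (simp add: mat_encode_def[abs_def])
qed

definition well_formed :: "nat set \<Rightarrow> nat \<Rightarrow> mat_code \<Rightarrow> vec_code \<Rightarrow> vec_code \<Rightarrow> bool" where
  "well_formed X n rs xs ys \<longleftrightarrow> n \<ge> 1 \<and> length rs = n \<and> (\<forall>row\<in>set rs. length row = n) \<and>
     length xs = n \<and> length ys = n \<and> (\<forall>e\<in>set (concat rs) \<union> set xs \<union> set ys. ok_code X e)"

definition instance_code :: "nat \<Rightarrow> mat_code \<Rightarrow> vec_code \<Rightarrow> vec_code \<Rightarrow> nat" where
  "instance_code n rs xs ys =
     prod_encode (n, prod_encode (mat_encode rs, prod_encode (vec_encode xs, vec_encode ys)))"

lemma encodes_vec_iff:
  assumes "x \<in> carrier_vec n"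
  shows "encodes_vec X xs x \<longleftrightarrow> length xs = n \<and> (\<forall>e\<in>set xs. ok_code X e) \<and> x = vec n (\<lambda>r. ratfun_of (xs ! r))"
proof -
  have "encodes_vec X xs x \<longleftrightarrow> length xs = n \<and> (\<forall>r<n. ok_code X (xs ! r) \<and> x $ r = ratfun_of (xs ! r))"
    using assms unfolding encodes_vec_def list_all2_conv_all_nth encodes_ratfun_iff
    by (auto simp: list_of_vec_index)
  also have "\<dots> \<longleftrightarrow> length xs = n \<and> (\<forall>e\<in>set xs. ok_code X e) \<and> (\<forall>r<n. x $ r = ratfun_of (xs ! r))"
    by (auto simp: all_set_conv_all_nth)
  also have "(\<forall>r<n. x $ r = ratfun_of (xs ! r)) \<longleftrightarrow> x = vec n (\<lambda>r. ratfun_of (xs ! r))"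
    using assms by (auto simp: vec_eq_iff)
  finally show ?thesis .
qed

lemma encodes_mat_iff:
  assumes "A \<in> carrier_mat n n"
  shows "encodes_mat X rs A \<longleftrightarrow> length rs = n \<and> (\<forall>row\<in>set rs. length row = n \<and> (\<forall>e\<in>set row. ok_code X e)) \<and>
    A = mat n n (\<lambda>(r, c). ratfun_of (rs ! r ! c))"
proof -
  have "encodes_mat X rs A \<longleftrightarrow> length rs = n \<and> (\<forall>r<n. encodes_vec X (rs ! r) (row A r))"
    using assms unfolding encodes_mat_def list_all2_conv_all_nth by auto
  also have "\<dots> \<longleftrightarrow> length rs = n \<and> (\<forall>r<n. length (rs ! r) = n \<and> (\<forall>e\<in>set (rs ! r). ok_code X e) \<and>
      row A r = vec n (\<lambda>c. ratfun_of (rs ! r ! c)))"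
    using encodes_vec_iff[of "row A r" n for r] assms by auto
  also have "\<dots> \<longleftrightarrow> length rs = n \<and> (\<forall>row\<in>set rs. length row = n \<and> (\<forall>e\<in>set row. ok_code X e)) \<and>
      (\<forall>r<n. row A r = vec n (\<lambda>c. ratfun_of (rs ! r ! c)))"
    by (auto simp: all_set_conv_all_nth)
  also have "(\<forall>r<n. row A r = vec n (\<lambda>c. ratfun_of (rs ! r ! c))) \<longleftrightarrow> A = mat n n (\<lambda>(r, c). ratfun_of (rs ! r ! c))"
    using assms by (auto simp: vec_eq_iff mat_eq_iff)
  finally show ?thesis .
qed

lemma encodes_instance_code:
  assumes "A \<in> carrier_mat n n" "x \<in> carrier_vec n" "y \<in> carrier_vec n"
  shows "encodes_instance X (instance_code m rs xs ys) n A x y \<longleftrightarrow>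
    m = n \<and> encodes_mat X rs A \<and> encodes_vec X xs x \<and> encodes_vec X ys y"
  unfolding encodes_instance_def instance_code_def prod_encode_eq
  using bij_encodings[THEN bij_is_inj] by (auto dest: injD)

lemma ratfun_of_in_ratfuns: "ok_code X e \<Longrightarrow> ratfun_of e \<in> ratfuns X"
  unfolding ratfuns_eq_encodable mem_Collect_eq by (rule exI[of _ e]) (simp add: encodes_ratfun_iff)

lemma code_le:
  "mat_encode rs \<le> instance_code n rs xs ys" "vec_encode xs \<le> instance_code n rs xs ys"
  "vec_encode ys \<le> instance_code n rs xs ys"
  unfolding instance_code_def by (meson le_pr order_trans)+

lemma entry_code_le: "e \<in> set zs \<Longrightarrow> ratfun_encode e \<le> vec_encode zs"
  unfolding vec_encode_def by (intro less_imp_le mem_le_list_encode) simp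

lemma row_code_le: "zs \<in> set rs \<Longrightarrow> vec_encode zs \<le> mat_encode rs"
  unfolding mat_encode_def by (intro less_imp_le mem_le_list_encode) simp

lemma well_formed_valid_instance:
  assumes "well_formed X n rs xs ys"
  shows "valid_instance X (instance_code n rs xs ys) n rs xs ys"
proof
  let ?N = "instance_code n rs xs ys"
  show "1 \<le> n" "length rs = n" "length xs = n" "length ys = n" "\<And>r. r < n \<Longrightarrow> length (rs ! r) = n"
    using assms unfolding well_formed_def by auto
  show "n \<le> ?N" unfolding instance_code_def by (rule le_pr)
  fix e assume e: "e \<in> set (concat rs) \<union> set xs \<union> set ys"
  have "ratfun_encode e \<le> ?N"
  proof -
    consider row where "row \<in> set rs" "e \<in> set row" | "e \<in> set xs" | "e \<in> set ys" using e by auto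
    then show ?thesis
    proof cases
      case 1
      then show ?thesis
        using entry_code_le[OF 1(2)] row_code_le[OF 1(1)] code_le(1)[of rs n xs ys] by linarith
    qed (meson entry_code_le code_le order_trans)+
  qed
  then show "ok_code X e \<and> ratfun_encode e \<le> ?N" using assms e unfolding well_formed_def by blast
qed

lemma decide_correct:
  "decide X (instance_code n rs xs ys) n (mat_encode rs) (vec_encode xs) (vec_encode ys) \<longleftrightarrow>
    well_formed X n rs xs ys \<and> (\<exists>i. mat n n (\<lambda>(r, c). ratfun_of (rs ! r ! c)) ^\<^sub>m i *\<^sub>v vec n (\<lambda>r. ratfun_of (xs ! r)) =
      vec n (\<lambda>r. ratfun_of (ys ! r)))"
proof -
  let ?N = "instance_code n rs xs ys"
  let ?I = "\<exists>i < Suc (iter_bound ?N n). \<forall>s < (deg_bound ?N i + ?N + 1) ^ Suc ?N. \<forall>r<n.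
        qeq (cnth (cvec n (mat_encode rs) (vec_encode xs) s (deg_bound ?N i + ?N + 1) i) r)
          (qent s (deg_bound ?N i + ?N + 1) (cnth (vec_encode ys) r))"
  have ok: "(\<forall>e\<in>set zs. ok_nat X ?N (ratfun_encode e)) \<longleftrightarrow> (\<forall>e\<in>set zs. ok_code X e)"
    if "vec_encode zs \<le> ?N" for zs
    using ok_nat_encode[OF order_trans[OF entry_code_le that]] by blast
  have wf: "decide X ?N n (mat_encode rs) (vec_encode xs) (vec_encode ys) \<longleftrightarrow> well_formed X n rs xs ys \<and> ?I"
  proof -
    have "(\<forall>row\<in>set rs. length row = n \<and> (\<forall>e\<in>set row. ok_nat X ?N (ratfun_encode e))) \<longleftrightarrow>
        (\<forall>row\<in>set rs. length row = n \<and> (\<forall>e\<in>set row. ok_code X e))"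
      using ok order_trans[OF row_code_le code_le(1)] by blast
    moreover define I where "I \<longleftrightarrow> ?I"
    have "decide X ?N n (mat_encode rs) (vec_encode xs) (vec_encode ys) \<longleftrightarrow>
        1 \<le> n \<and> length rs = n \<and> length xs = n \<and> length ys = n \<and>
        (\<forall>row\<in>set rs. length row = n \<and> (\<forall>e\<in>set row. ok_nat X ?N (ratfun_encode e))) \<and>
        (\<forall>e\<in>set xs. ok_nat X ?N (ratfun_encode e)) \<and> (\<forall>e\<in>set ys. ok_nat X ?N (ratfun_encode e)) \<and> I"
      unfolding decide_def I_def[symmetric] by simp
    moreover have "(\<forall>e\<in>set (concat rs) \<union> set xs \<union> set ys. ok_code X e) \<longleftrightarrow>
        (\<forall>row\<in>set rs. \<forall>e\<in>set row. ok_code X e) \<and> (\<forall>e\<in>set xs. ok_code X e) \<and> (\<forall>e\<in>set ys. ok_code X e)"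
      unfolding set_concat by blast
    ultimately show ?thesis
      unfolding well_formed_def I_def[symmetric] using ok[OF code_le(2)] ok[OF code_le(3)] by blast
  qed
  show ?thesis
  proof (cases "well_formed X n rs xs ys")
    case True
    then interpret valid_instance X ?N n rs xs ys by (rule well_formed_valid_instance)
    have "?I \<longleftrightarrow> (\<exists>i < Suc (iter_bound ?N n). solves i)" using solves_decide by blast
    \<comment> \<open>\<open>solves_bounded\<close> makes the bounded search complete.\<close>
    also have "\<dots> \<longleftrightarrow> (\<exists>i. solves i)" using solves_bounded by (meson less_Suc_eq_le)
    finally show ?thesis unfolding wf solves_iff A\<^sub>f_def x\<^sub>f_def y\<^sub>f_def using True by blast
  qed (simp add: wf)
qed

text \<open>An initial segment is either everything or \<open>{..<m}\<close>, and \<open>m\<close>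
  is built into the program. Only the existence of the program is claimed, not that it can be found
  from \<open>X\<close>.\<close>

lemma prog_initial_segment:
  fixes X :: "nat set"
  assumes "\<And>i j. i \<in> X \<Longrightarrow> j < i \<Longrightarrow> j \<in> X"
  shows "prog (\<lambda>v. of_bool (v \<in> X))"
proof (cases "X = UNIV")
  case True
  then show ?thesis by (simp add: prog_const)
next
  case False
  define m where "m = (LEAST v. v \<notin> X)"
  obtain u where "u \<notin> X" using False by blast
  then have m: "m \<notin> X" unfolding m_def by (rule LeastI)
  have "v \<in> X \<longleftrightarrow> v < m" for v
  proof
    assume "v \<in> X"
    with m assms[of v m] show "v < m" by (cases v m rule: linorder_cases) auto
  next
    assume "v < m"
    then show "v \<in> X" using not_less_Least[of v "\<lambda>v. v \<notin> X"] by (simp add: m_def)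
  qed
  then show ?thesis by (simp add: prog_less[OF prog_id prog_const])
qed

theorem corollary1p7:
  fixes X :: "nat set"
  assumes initial_segment: "\<And>i j. i \<in> X \<Longrightarrow> j < i \<Longrightarrow> j \<in> X"
  shows "decidable {N. \<exists>(n :: nat) (A :: ratfun mat) (x :: ratfun vec) (y :: ratfun vec).
           n \<ge> 1 \<and>
           A \<in> carrier_mat n n \<and> elements_mat A \<subseteq> ratfuns X \<and>
           x \<in> carrier_vec n \<and> set\<^sub>v x \<subseteq> ratfuns X \<and>
           y \<in> carrier_vec n \<and> set\<^sub>v y \<subseteq> ratfuns X \<and>
           encodes_instance X N n A x y \<and>
           (\<exists>i :: nat. (A ^\<^sub>m i) *\<^sub>v x = y)}" (is "decidable ?S")
proof (rule decidable_prog)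
  let ?D = "\<lambda>N. decide X N (pfst N) (pfst (psnd N)) (pfst (psnd (psnd N))) (psnd (psnd (psnd N)))"
  have "N \<in> ?S \<longleftrightarrow> ?D N" for N
  proof -
    \<comment> \<open>By surjectivity of the codings any \<open>N\<close> can be read as an
      instance, possibly an ill-formed one.\<close>
    obtain rs xs ys where codes: "mat_encode rs = pfst (psnd N)" "vec_encode xs = pfst (psnd (psnd N))"
      "vec_encode ys = psnd (psnd (psnd N))"
      using bij_encodings[THEN bij_is_surj] by (metis surjD)
    define n where "n = pfst N"
    have N: "N = instance_code n rs xs ys"
      unfolding instance_code_def codes n_def by (simp only: pr_pfst_psnd)
    let ?A = "mat n n (\<lambda>(r, c). ratfun_of (rs ! r ! c))"
    let ?x = "vec n (\<lambda>r. ratfun_of (xs ! r))" and ?y = "vec n (\<lambda>r. ratfun_of (ys ! r))"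
    have wf: "well_formed X n rs xs ys \<longleftrightarrow>
        n \<ge> 1 \<and> encodes_mat X rs ?A \<and> encodes_vec X xs ?x \<and> encodes_vec X ys ?y"
      using encodes_mat_iff[of ?A n X rs] encodes_vec_iff[of ?x n X xs] encodes_vec_iff[of ?y n X ys]
      by (auto simp: well_formed_def)
    \<comment> \<open>The codes determine the matrix and the vectors, so the existential quantifiers
      in the set disappear.\<close>
    have "N \<in> ?S \<longleftrightarrow> well_formed X n rs xs ys \<and> (\<exists>i. ?A ^\<^sub>m i *\<^sub>v ?x = ?y)"
    proof
      assume "N \<in> ?S"
      then obtain m A x y where S: "m \<ge> 1" "A \<in> carrier_mat m m" "x \<in> carrier_vec m" "y \<in> carrier_vec m"
        "encodes_instance X N m A x y" "\<exists>i. A ^\<^sub>m i *\<^sub>v x = y" by blast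
      have e: "m = n" "encodes_mat X rs A" "encodes_vec X xs x" "encodes_vec X ys y"
        using S(5) encodes_instance_code[OF S(2-4)] unfolding N by auto
      have "A = ?A" "x = ?x" "y = ?y"
        using e encodes_mat_iff[OF S(2)] encodes_vec_iff[OF S(3)] encodes_vec_iff[OF S(4)] by blast+
      then show "well_formed X n rs xs ys \<and> (\<exists>i. ?A ^\<^sub>m i *\<^sub>v ?x = ?y)"
        unfolding wf using e S(1,6) by auto
    next
      assume R: "well_formed X n rs xs ys \<and> (\<exists>i. ?A ^\<^sub>m i *\<^sub>v ?x = ?y)"
      have len: "length rs = n" "\<And>r. r < n \<Longrightarrow> length (rs ! r) = n" "length xs = n" "length ys = n"
        and ok: "\<And>e. e \<in> set (concat rs) \<union> set xs \<union> set ys \<Longrightarrow> ok_code X e"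
        using R unfolding well_formed_def by auto
      have "ratfun_of (rs ! r ! c) \<in> ratfuns X" if "r < n" "c < n" for r c
      proof -
        have "rs ! r \<in> set rs" "rs ! r ! c \<in> set (rs ! r)" using that len by simp_all
        then show ?thesis by (intro ratfun_of_in_ratfuns ok) auto
      qed
      then have "elements_mat ?A \<subseteq> ratfuns X" by (auto simp: elements_mat_def)
      moreover have "ratfun_of (xs ! r) \<in> ratfuns X" "ratfun_of (ys ! r) \<in> ratfuns X" if "r < n" for r
        using that len by (simp_all add: ratfun_of_in_ratfuns ok)
      then have "set\<^sub>v ?x \<subseteq> ratfuns X" "set\<^sub>v ?y \<subseteq> ratfuns X"
        by (auto simp: vec_set_def)
      moreover have "encodes_instance X N n ?A ?x ?y"
        unfolding N using encodes_instance_code[of ?A n ?x ?y] R wf by simp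
      ultimately show "N \<in> ?S" using R wf unfolding mem_Collect_eq
        by (intro exI[of _ n] exI[of _ ?A] exI[of _ ?x] exI[of _ ?y]) simp
    qed
    then show ?thesis unfolding codes[symmetric] n_def[symmetric] using decide_correct N by simp
  qed
  then show "prog (\<lambda>N. of_bool (N \<in> ?S))"
    by (simp only:) (intro prog_decide prog_initial_segment prog_intros, rule initial_segment)
qed

end
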